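(* Let $m,n$ be positive integers with $m>n>\frac{m}{2}$, and let $G: S^m\rightarrow S^n$ be a smooth map. Then for any $\epsilon>0$, $G$ extends to a smooth map $F: B^{m+1}\rightarrow B^{n+1}$ with $\mathrm{dil}_{n+1}(F)<\epsilon$.
   Context: $B^{d+1}$ is the closed unit ball in $\mathbb{R}^{d+1}$ with boundary the round unit sphere $S^d$; balls and spheres carry their standard metrics. That $F$ extends $G$ means $F(x)=G(x)\in S^n\subset B^{n+1}$ for all $x\in S^m=\partial B^{m+1}$. For a $C^1$ map $F: M\to N$ of Riemannian manifolds, the $j$-dilation is $\mathrm{dil}_j(F)=\sup_{\Sigma^j\subset M}\frac{\mathrm{Vol}_j(F(\Sigma^j))}{\mathrm{Vol}_j(\Sigma^j)}$, the supremum over $j$-dimensional submanifolds $\Sigma^j$ of $M$; equivalently $\mathrm{dil}_j(F)=\sup_{x\in M}\prod_{l=1}^{j}s_l(x)$, where $s_1(x)\ge s_2(x)\ge\cdots$ are the singular values of $DF_x$ (with $s_l(x)=0$ for $l$ exceeding the number of singular values). *)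

theory Defs
  imports "HOL-Analysis.Analysis"
begin

primrec Ck_on :: "nat \<Rightarrow> 'a::euclidean_space set \<Rightarrow> ('a \<Rightarrow> 'b::euclidean_space) \<Rightarrow> bool" where
  "Ck_on 0 U f \<longleftrightarrow> continuous_on U f"
| "Ck_on (Suc k) U f \<longleftrightarrow>
     (\<forall>x\<in>U. f differentiable (at x)) \<and> (\<forall>v. Ck_on k U (\<lambda>x. frechet_derivative f (at x) v))"

text \<open>Smoothness on an arbitrary subset \<open>X\<close> of a Euclidean space: \<open>f\<close> locally extends to an ordinary
  smooth map on an open set. For the unit sphere this is smoothness as a map on the manifold, and for
  the closed unit ball it is smoothness up to the boundary. Note that \<open>Ck_on\<close> is meant only for
  open \<open>U\<close>, as it uses the unrestricted derivative.\<close>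

definition smooth_map_on :: "'a::euclidean_space set \<Rightarrow> ('a \<Rightarrow> 'b::euclidean_space) \<Rightarrow> bool" where
  "smooth_map_on X f \<longleftrightarrow>
     (\<forall>x\<in>X. \<exists>U g. open U \<and> x \<in> U \<and> (\<forall>k. Ck_on k U g) \<and> (\<forall>y\<in>X \<inter> U. g y = f y))"

definition singular_set :: "('a::euclidean_space \<Rightarrow> 'b::euclidean_space) \<Rightarrow> real set" where
  "singular_set A = {s. s \<ge> 0 \<and> (\<exists>v. v \<noteq> 0 \<and> adjoint A (A v) = s\<^sup>2 *\<^sub>R v)}"

text \<open>For linear \<open>A\<close>, each singular value is repeated according to the dimension of the corresponding
  eigenspace of \<open>adjoint A \<circ> A\<close>. The list has length \<open>DIM('a)\<close>, so it may end in zeros beyond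
  \<open>min DIM('a) DIM('b)\<close>.\<close>

definition singular_values :: "('a::euclidean_space \<Rightarrow> 'b::euclidean_space) \<Rightarrow> real list" where
  "singular_values A =
     concat (map (\<lambda>s. replicate (dim {v. adjoint A (A v) = s\<^sup>2 *\<^sub>R v}) s)
                 (rev (sorted_list_of_set (singular_set A))))"

text \<open>Indexed from \<open>1\<close>, in decreasing order.\<close>

definition singular_value :: "('a::euclidean_space \<Rightarrow> 'b::euclidean_space) \<Rightarrow> nat \<Rightarrow> real" where
  "singular_value A l =
     (if 1 \<le> l \<and> l \<le> length (singular_values A) then singular_values A ! (l - 1) else 0)"

text \<open>The derivative is taken within \<open>M\<close>, so that boundary points of \<open>M\<close> are allowed; on the closed
  unit ball it is uniquely determined. The supremum is taken in \<^typ>\<open>ennreal\<close>, where it always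
  exists.\<close>

definition dil :: "nat \<Rightarrow> 'a::euclidean_space set \<Rightarrow> ('a \<Rightarrow> 'b::euclidean_space) \<Rightarrow> ennreal" where
  "dil j M F =
     (SUP x\<in>M. ennreal (\<Prod>l=1..j. singular_value (frechet_derivative F (at x within M)) l))"

text \<open>Since \<^const>\<open>sorted_list_of_set\<close> is empty on infinite sets, finiteness matters.\<close>

lemma finite_singular_set:
  fixes A :: "'a::euclidean_space \<Rightarrow> 'b::euclidean_space"
  assumes "linear A"
  shows "finite (singular_set A)"
proof -
  have "\<forall>s\<in>singular_set A. \<exists>v. v \<noteq> 0 \<and> adjoint A (A v) = s\<^sup>2 *\<^sub>R v"
    by (auto simp: singular_set_def)
  then obtain e where e: "\<And>s. s \<in> singular_set A \<Longrightarrow> e s \<noteq> 0 \<and> adjoint A (A (e s)) = s\<^sup>2 *\<^sub>R e s"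
    by metis
  have orth: "e s \<bullet> e t = 0" if s: "s \<in> singular_set A" and t: "t \<in> singular_set A" and "s \<noteq> t" for s t
  proof -
    have "s\<^sup>2 * (e s \<bullet> e t) = A (e s) \<bullet> A (e t)"
      using e[OF s] adjoint_works[OF assms, of "e t" "A (e s)"] by (simp add: inner_commute)
    also have "\<dots> = t\<^sup>2 * (e s \<bullet> e t)"
      using e[OF t] adjoint_works[OF assms, of "e s" "A (e t)"] by (simp add: inner_commute)
    finally show ?thesis
      using s t \<open>s \<noteq> t\<close> by (auto simp: singular_set_def)
  qed
  have inj: "inj_on e (singular_set A)"
    by (rule inj_onI) (metis e orth inner_eq_zero_iff)
  have "pairwise orthogonal (e ` singular_set A)"
    using orth by (auto simp: pairwise_def orthogonal_def)
  moreover have "0 \<notin> e ` singular_set A"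
    using e by auto
  ultimately have "finite (e ` singular_set A)"
    using pairwise_orthogonal_independent independent_imp_finite by blast
  then show ?thesis
    using inj finite_imageD by blast
qed

end

theory Submission
  imports Defs
begin

text \<open>Put \<open>k = n + 1\<close> and \<open>N = m + 1\<close>, so that \<open>k < N\<close> and \<open>N + 1 < 2 k\<close>. Let \<open>f\<close> be a smooth map from
  \<open>\<real>\<^sup>N\<close> to \<open>\<real>\<^sup>k\<close> that equals \<open>G (x / \<bar>x\<bar>)\<close> far out. Following \<open>f\<close> by a coordinatewise staircase with steps of
  height \<open>h\<close> makes the rank drop below \<open>k\<close> except over tiny neighbourhoods of the lattice points
  \<open>y \<in> h\<int>\<^sup>k\<close>, each of which is blown up to size \<open>h\<close>. Since \<open>N + 1 < 2 k\<close>, for generic \<open>f\<close> no line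
  parallel to a coordinate axis meets two of the fibres \<open>f\<^sup>-\<^sup>1(y)\<close>. So shears move thin tubes around them
  into disjoint unit balls, and there each tube can be widened to a fixed thickness, because all these
  fibres are close to one regular fibre. On a widened tube the derivative is \<open>O(h)\<close>. The \<open>O(h\<^sup>-\<^sup>k)\<close> unit
  balls fit into a ball of radius \<open>O(h\<^sup>-\<^sup>k\<^sup>/\<^sup>N)\<close>; rescaling that ball to unit size leaves a derivative of order
  \<open>h\<^sup>1\<^sup>-\<^sup>k\<^sup>/\<^sup>N\<close> there, which tends to \<open>0\<close> with \<open>h\<close> because \<open>k < N\<close>.\<close>

section \<open>Smooth maps on open sets\<close>

text \<open>The dilation is a supremum of pointwise products, so a point is harmless if the
  derivative there is not onto or is small. The shears may therefore be violent and the tubes as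
  thin as compactness dictates: where the rank has dropped, their derivatives do not matter, and on
  the tubes the stretch \<open>h / \<sigma>\<close> of the staircase is cancelled by the contraction
  of order \<sigma> that the widening brings. Only constants depending on \<open>f\<close> survive.
  Fibres have to be controlled only over a small ball around 0, because a final radial push sends
  all values farther out onto the unit sphere, where the rank is below k. So one regular value
  suffices, and its radius \<delta> is fixed before h. The same push handles the collar in which the
  rearranged map returns to \<open>f\<close>: values stay near the unit sphere there. Regularity and
  genericity come from adding a small affine map, since the bad pairs \<open>(A, b)\<close> form a
  null set. The inequality N + 1 < 2 k compares the unknowns \<open>(x, s)\<close> with the 2 k
  equations for two aligned points on two given fibres.\<close>

lemma Ck_on_imp_diff: "Ck_on (Suc k) U f \<Longrightarrow> x \<in> U \<Longrightarrow> f differentiable (at x)"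
  by simp

lemma Ck_on_Suc_imp: "Ck_on (Suc k) U f \<Longrightarrow> Ck_on k U f"
proof (induction k arbitrary: f)
  case 0
  then show ?case
    by (auto intro!: continuous_at_imp_continuous_on differentiable_imp_continuous_within)
next
  case (Suc k)
  from Suc.prems show ?case
    by (auto intro!: Suc.IH simp del: Ck_on.simps(1))
qed

lemma Ck_on_continuous: "Ck_on k U f \<Longrightarrow> continuous_on U f"
proof (induction k)
  case (Suc k)
  then show ?case using Ck_on_Suc_imp by blast
qed simp

lemma Ck_on_subset: "Ck_on k U f \<Longrightarrow> V \<subseteq> U \<Longrightarrow> Ck_on k V f"
  by (induction k arbitrary: f) (auto intro: continuous_on_subset)

lemma Ck_on_cong:
  assumes "open U" "\<And>x. x \<in> U \<Longrightarrow> f x = g x"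
  shows "Ck_on k U f = Ck_on k U g"
  using assms(2)
proof (induction k arbitrary: f g)
  case 0
  then show ?case by (auto intro: continuous_on_eq)
next
  case (Suc k)
  have 1: "(f has_derivative f') (at x) \<longleftrightarrow> (g has_derivative f') (at x)" if "x \<in> U" for x f'
    using Suc.prems that assms(1)
    by (metis has_derivative_transform_within_open)
  then have "f differentiable at x \<longleftrightarrow> g differentiable at x" if "x \<in> U" for x
    using that by (auto simp: differentiable_def)
  moreover have "frechet_derivative f (at x) = frechet_derivative g (at x)" if "x \<in> U" for x
    using 1[OF that] by (auto simp: frechet_derivative_def)
  then have "Ck_on k U (\<lambda>x. frechet_derivative f (at x) v) = Ck_on k U (\<lambda>x. frechet_derivative g (at x) v)" for v
    by (intro Suc.IH) simp
  ultimately show ?case by simp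
qed

lemma Ck_onI:
  assumes "open U"
    and d: "\<And>x. x \<in> U \<Longrightarrow> (f has_derivative f' x) (at x)"
    and c: "\<And>v. Ck_on k U (\<lambda>x. f' x v)"
  shows "Ck_on (Suc k) U f"
proof -
  have eq: "frechet_derivative f (at x) = f' x" if "x \<in> U" for x
    using d[OF that] frechet_derivative_at by metis
  have "Ck_on k U (\<lambda>x. frechet_derivative f (at x) v)" for v
    using Ck_on_cong[OF assms(1), of "\<lambda>x. frechet_derivative f (at x) v" "\<lambda>x. f' x v" k] eq c by simp
  then show ?thesis using d by (auto simp: differentiable_def)
qed

lemma Ck_onD:
  assumes "Ck_on (Suc k) U f" "x \<in> U"
  shows "(f has_derivative frechet_derivative f (at x)) (at x)"
  using assms frechet_derivative_works by auto

lemma Ck_onD2: "Ck_on (Suc k) U f \<Longrightarrow> Ck_on k U (\<lambda>x. frechet_derivative f (at x) v)"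
  by simp

lemma Ck_on_local:
  assumes "\<And>x. x \<in> U \<Longrightarrow> \<exists>V. open V \<and> x \<in> V \<and> Ck_on k V f"
  shows "Ck_on k U f"
  using assms
proof (induction k arbitrary: f)
  case 0
  have "continuous (at x) f" if x: "x \<in> U" for x
    using 0[OF x] continuous_on_eq_continuous_at by (metis Ck_on.simps(1))
  then show ?case by (auto intro: continuous_at_imp_continuous_on)
next
  case (Suc k)
  have "f differentiable at x" if "x \<in> U" for x
    using Suc.prems[OF that] by auto
  moreover have "Ck_on k U (\<lambda>x. frechet_derivative f (at x) v)" for v
    using Suc.prems by (intro Suc.IH) (metis Ck_onD2)
  ultimately show ?case by simp
qed

lemma Ck_on_const: "Ck_on k U (\<lambda>x. c)"
  by (induction k arbitrary: c) (simp_all add: frechet_derivative_const)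

lemma Ck_on_linear:
  fixes f :: "'a::euclidean_space \<Rightarrow> 'b::euclidean_space"
  assumes "linear f"
  shows "Ck_on k U f"
proof -
  have d: "(f has_derivative f) (at x)" for x
    using assms linear_conv_bounded_linear bounded_linear_imp_has_derivative by blast
  show ?thesis
  proof (cases k)
    case 0
    then show ?thesis
      using assms by (simp add: linear_continuous_on linear_conv_bounded_linear)
  next
    case (Suc j)
    have "Ck_on (Suc j) UNIV f"
      by (rule Ck_onI[where f' = "\<lambda>x. f"]) (auto intro: d Ck_on_const)
    then show ?thesis
      using Suc Ck_on_subset by blast
  qed
qed

lemma Ck_on_add:
  assumes "open U"
  shows "Ck_on k U f \<Longrightarrow> Ck_on k U g \<Longrightarrow> Ck_on k U (\<lambda>x. f x + g x)"
proof (induction k arbitrary: f g)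
  case 0
  then show ?case by (simp add: continuous_on_add)
next
  case (Suc k)
  show ?case
    by (rule Ck_onI[OF assms has_derivative_add[OF Ck_onD[OF Suc.prems(1)] Ck_onD[OF Suc.prems(2)]]])
      (use Suc in auto)
qed

lemma Ck_on_linear_compose:
  assumes "open U" "linear h"
  shows "Ck_on k U f \<Longrightarrow> Ck_on k U (\<lambda>x. h (f x))"
proof (induction k arbitrary: f)
  case 0
  then show ?case
    using assms(2) linear_continuous_on_compose by auto
next
  case (Suc k)
  have "bounded_linear h" using assms(2) linear_conv_bounded_linear by blast
  show ?case
    by (rule Ck_onI[OF assms(1) bounded_linear.has_derivative[OF \<open>bounded_linear h\<close> Ck_onD[OF Suc.prems(1)]]])
      (use Suc in auto)
qed

lemma Ck_on_bilinear:
  fixes h :: "'a::euclidean_space \<Rightarrow> 'b::euclidean_space \<Rightarrow> 'c::euclidean_space"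
    and f :: "'d::euclidean_space \<Rightarrow> 'a"
  assumes "open U" "bounded_bilinear h"
  shows "Ck_on k U f \<Longrightarrow> Ck_on k U g \<Longrightarrow> Ck_on k U (\<lambda>x. h (f x) (g x))"
proof (induction k arbitrary: f g)
  case 0
  then show ?case
    using bounded_bilinear.continuous_on[OF assms(2)] by auto
next
  case (Suc k)
  show ?case
    by (rule Ck_onI[OF assms(1) bounded_bilinear.FDERIV[OF assms(2) Ck_onD[OF Suc.prems(1)] Ck_onD[OF Suc.prems(2)]]])
      (simp_all add: Ck_on_add assms(1) Suc.IH Ck_on_Suc_imp[OF Suc.prems(1)] Ck_on_Suc_imp[OF Suc.prems(2)]
        Ck_onD2[OF Suc.prems(1)] Ck_onD2[OF Suc.prems(2)])
qed

lemma Ck_on_sum: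
  assumes "open U" "\<And>i. i \<in> I \<Longrightarrow> Ck_on k U (f i)"
  shows "Ck_on k U (\<lambda>x. \<Sum>i\<in>I. f i x)"
  using assms(2) by (induction I rule: infinite_finite_induct) (auto intro: Ck_on_const Ck_on_add[OF assms(1)])

lemma Ck_on_Pair:
  assumes "open U" "Ck_on k U f" "Ck_on k U g"
  shows "Ck_on k U (\<lambda>x. (f x, g x))"
proof -
  have "linear (\<lambda>a. (a, 0))" "linear (\<lambda>b. (0, b))"
    by (auto intro!: linearI)
  from Ck_on_add[OF assms(1) Ck_on_linear_compose[OF assms(1) this(1) assms(2)] Ck_on_linear_compose[OF assms(1) this(2) assms(3)]]
  show ?thesis by simp
qed

lemma linear_euclidean_expand:
  fixes h :: "'a::euclidean_space \<Rightarrow> 'b::real_vector"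
  assumes "linear h"
  shows "h v = (\<Sum>b\<in>Basis. (v \<bullet> b) *\<^sub>R h b)"
proof -
  have "h v = h (\<Sum>b\<in>Basis. (v \<bullet> b) *\<^sub>R b)" by (simp add: euclidean_representation)
  then show ?thesis
    using assms by (simp add: linear_sum linear_cmul)
qed

lemma Ck_on_compose:
  fixes f :: "'a::euclidean_space \<Rightarrow> 'b::euclidean_space"
    and g :: "'b \<Rightarrow> 'c::euclidean_space"
  assumes "open U" "open V" "f ` U \<subseteq> V"
  shows "Ck_on k V g \<Longrightarrow> Ck_on k U f \<Longrightarrow> Ck_on k U (\<lambda>x. g (f x))"
proof (induction k arbitrary: g)
  case 0
  then show ?case
    using assms continuous_on_compose2 by (metis Ck_on.simps(1))
next
  case (Suc k)
  let ?g = "\<lambda>y. frechet_derivative g (at y)"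
  let ?f = "\<lambda>x. frechet_derivative f (at x)"
  have dg: "(g has_derivative ?g (f x)) (at (f x))" if "x \<in> U" for x
    using Ck_onD[OF Suc.prems(1)] that assms(3) by auto
  have df: "(f has_derivative ?f x) (at x)" if "x \<in> U" for x
    using Ck_onD[OF Suc.prems(2)] that by auto
  have 1: "((\<lambda>x. g (f x)) has_derivative (\<lambda>v. ?g (f x) (?f x v))) (at x)" if "x \<in> U" for x
    using has_derivative_compose[OF df[OF that] dg[OF that]] .
  have lin: "linear (?g (f x))" if "x \<in> U" for x
    using dg[OF that] has_derivative_linear by blast
  \<comment> \<open>\<open>Ck_on\<close> speaks of derivatives in fixed directions, whereas
    \<open>?f x v\<close> moves with \<open>x\<close>; expanding it in the basis leaves products of
    functions that the induction covers.\<close>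
  have 2: "((\<lambda>x. g (f x)) has_derivative (\<lambda>v. \<Sum>b\<in>Basis. (?f x v \<bullet> b) *\<^sub>R ?g (f x) b)) (at x)" if "x \<in> U" for x
  proof -
    have "(\<lambda>v. ?g (f x) (?f x v)) = (\<lambda>v. \<Sum>b\<in>Basis. (?f x v \<bullet> b) *\<^sub>R ?g (f x) b)"
      by (rule ext) (rule linear_euclidean_expand[OF lin[OF that]])
    then show ?thesis using 1[OF that] by (simp only:)
  qed
  have "linear (\<lambda>x. x \<bullet> b)" for b :: 'b
    by (auto intro!: linearI simp: inner_left_distrib)
  then have "Ck_on k U (\<lambda>x. ?f x v \<bullet> b)" for v and b :: 'b
    using Ck_on_linear_compose[OF assms(1) _ Ck_onD2[OF Suc.prems(2)]] by blast
  moreover have "Ck_on k U (\<lambda>x. ?g (f x) b)" for b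
    by (rule Suc.IH[OF Ck_onD2[OF Suc.prems(1)] Ck_on_Suc_imp[OF Suc.prems(2)]])
  ultimately have "Ck_on k U (\<lambda>x. \<Sum>b\<in>Basis. (?f x v \<bullet> b) *\<^sub>R ?g (f x) b)" for v
    by (intro Ck_on_sum assms(1) Ck_on_bilinear[OF assms(1) bounded_bilinear_scaleR])
  from Ck_onI[OF assms(1) 2 this] show ?case by blast
qed

lemma Ck_on_inverse:
  fixes f :: "'a::euclidean_space \<Rightarrow> real"
  assumes "open U" "\<And>x. x \<in> U \<Longrightarrow> f x \<noteq> 0"
  shows "Ck_on k U f \<Longrightarrow> Ck_on k U (\<lambda>x. inverse (f x))"
proof (induction k)
  case 0
  then show ?case
    using assms by (auto intro: continuous_on_inverse)
next
  case (Suc k)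
  have "((\<lambda>x. inverse (f x)) has_derivative (\<lambda>v. -1 *\<^sub>R (inverse (f x) * frechet_derivative f (at x) v * inverse (f x)))) (at x)" if "x \<in> U" for x
    using Deriv.has_derivative_inverse[OF assms(2)[OF that] Ck_onD[OF Suc.prems that]] by simp
  moreover have "Ck_on k U (\<lambda>x. -1 *\<^sub>R (inverse (f x) * frechet_derivative f (at x) v * inverse (f x)))" for v
    by (intro Ck_on_bilinear[OF assms(1) bounded_bilinear_scaleR] Ck_on_bilinear[OF assms(1) bounded_bilinear_mult] Ck_on_const
      Suc.IH Ck_on_Suc_imp[OF Suc.prems] Ck_onD2[OF Suc.prems])
  ultimately show ?case
    by (rule Ck_onI[OF assms(1)])
qed

lemma Ck_on_norm:
  fixes U :: "'a::euclidean_space set"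
  assumes "open U" "0 \<notin> U"
  shows "Ck_on k U norm"
proof (induction k)
  case 0
  then show ?case by (simp add: continuous_on_norm)
next
  case (Suc k)
  have nz: "\<And>x. x \<in> U \<Longrightarrow> norm x \<noteq> 0" using assms by auto
  have "(norm has_derivative (\<lambda>v. inverse (norm x) * (v \<bullet> x))) (at x)" if "x \<in> U" for x
    using has_derivative_norm[of x] that assms(2)
    by (metis (no_types, lifting) ext inner_scaleR_right sgn_div_norm)
  moreover have "linear (\<lambda>x. v \<bullet> x)" for v :: 'a
    by (auto intro!: linearI simp: inner_right_distrib)
  then have "Ck_on k U (\<lambda>x. inverse (norm x) * (v \<bullet> x))" for v
    by (intro Ck_on_bilinear[OF assms(1) bounded_bilinear_mult] Ck_on_inverse assms(1) nz Suc Ck_on_linear)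
  ultimately show ?case
    by (rule Ck_onI[OF assms(1)])
qed

section \<open>Smoothness of all orders and its closure rules\<close>

definition smooth_on :: "'a::euclidean_space set \<Rightarrow> ('a \<Rightarrow> 'b::euclidean_space) \<Rightarrow> bool" where
  "smooth_on U f \<longleftrightarrow> (\<forall>k. Ck_on k U f)"

lemma smooth_on_has_derivative:
  "smooth_on U f \<Longrightarrow> x \<in> U \<Longrightarrow> (f has_derivative frechet_derivative f (at x)) (at x)"
  using Ck_onD unfolding smooth_on_def by blast

lemma smooth_on_differentiable: "smooth_on U f \<Longrightarrow> x \<in> U \<Longrightarrow> f differentiable (at x)"
  unfolding smooth_on_def using Ck_on_imp_diff by blast

lemma smooth_on_derivative: "smooth_on U f \<Longrightarrow> smooth_on U (\<lambda>x. frechet_derivative f (at x) v)"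
  unfolding smooth_on_def using Ck_onD2 by blast

lemma smooth_on_continuous: "smooth_on U f \<Longrightarrow> continuous_on U f"
  unfolding smooth_on_def using Ck_on_continuous by blast

lemma smooth_on_subset: "smooth_on U f \<Longrightarrow> V \<subseteq> U \<Longrightarrow> smooth_on V f"
  unfolding smooth_on_def using Ck_on_subset by blast

lemma smooth_on_cong: "open U \<Longrightarrow> (\<And>x. x \<in> U \<Longrightarrow> f x = g x) \<Longrightarrow> smooth_on U f = smooth_on U g"
  unfolding smooth_on_def using Ck_on_cong by blast

lemma smooth_on_local:
  assumes "\<And>x. x \<in> U \<Longrightarrow> \<exists>V. open V \<and> x \<in> V \<and> smooth_on V f"
  shows "smooth_on U f"
  unfolding smooth_on_def using assms Ck_on_local unfolding smooth_on_def by metis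

lemma smooth_on_const: "smooth_on U (\<lambda>x. c)"
  unfolding smooth_on_def by (simp add: Ck_on_const)

lemma smooth_on_linear: "linear f \<Longrightarrow> smooth_on U f"
  unfolding smooth_on_def by (simp add: Ck_on_linear)

lemma smooth_on_id: "smooth_on U (\<lambda>x. x)"
  by (rule smooth_on_linear) (rule linear_id[unfolded id_def])

lemma smooth_on_add: "open U \<Longrightarrow> smooth_on U f \<Longrightarrow> smooth_on U g \<Longrightarrow> smooth_on U (\<lambda>x. f x + g x)"
  unfolding smooth_on_def by (simp add: Ck_on_add)

lemma smooth_on_sum: "open U \<Longrightarrow> (\<And>i. i \<in> I \<Longrightarrow> smooth_on U (f i)) \<Longrightarrow> smooth_on U (\<lambda>x. \<Sum>i\<in>I. f i x)"
  unfolding smooth_on_def by (simp add: Ck_on_sum)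

lemma smooth_on_linear_compose: "open U \<Longrightarrow> linear h \<Longrightarrow> smooth_on U f \<Longrightarrow> smooth_on U (\<lambda>x. h (f x))"
  unfolding smooth_on_def by (simp add: Ck_on_linear_compose)

lemma smooth_on_bilinear:
  "open U \<Longrightarrow> bounded_bilinear h \<Longrightarrow> smooth_on U f \<Longrightarrow> smooth_on U g \<Longrightarrow> smooth_on U (\<lambda>x. h (f x) (g x))"
  unfolding smooth_on_def by (simp add: Ck_on_bilinear)

lemmas smooth_on_scaleR = smooth_on_bilinear[OF _ bounded_bilinear_scaleR]
  and smooth_on_mult = smooth_on_bilinear[OF _ bounded_bilinear_mult[where 'a = real]]
  and smooth_on_inner = smooth_on_bilinear[OF _ bounded_bilinear_inner]

lemma smooth_on_minus: "open U \<Longrightarrow> smooth_on U f \<Longrightarrow> smooth_on U (\<lambda>x. - f x)"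
  by (rule smooth_on_linear_compose) (auto intro!: linearI)

lemma smooth_on_diff: "open U \<Longrightarrow> smooth_on U f \<Longrightarrow> smooth_on U g \<Longrightarrow> smooth_on U (\<lambda>x. f x - g x)"
  using smooth_on_add[OF _ _ smooth_on_minus, of U f g] by simp

lemma smooth_on_prod:
  fixes f :: "'i \<Rightarrow> 'a::euclidean_space \<Rightarrow> real"
  assumes "open U" "\<And>i. i \<in> I \<Longrightarrow> smooth_on U (f i)"
  shows "smooth_on U (\<lambda>x. \<Prod>i\<in>I. f i x)"
  using assms(2)
  by (induction I rule: infinite_finite_induct) (auto intro: smooth_on_const smooth_on_mult[OF assms(1)])

lemma smooth_on_Pair: "open U \<Longrightarrow> smooth_on U f \<Longrightarrow> smooth_on U g \<Longrightarrow> smooth_on U (\<lambda>x. (f x, g x))"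
  unfolding smooth_on_def by (simp add: Ck_on_Pair)

lemma smooth_on_fst: "open U \<Longrightarrow> smooth_on U f \<Longrightarrow> smooth_on U (\<lambda>x. fst (f x))"
  by (rule smooth_on_linear_compose) (auto intro!: linearI)

lemma smooth_on_snd: "open U \<Longrightarrow> smooth_on U f \<Longrightarrow> smooth_on U (\<lambda>x. snd (f x))"
  by (rule smooth_on_linear_compose) (auto intro!: linearI)

lemma smooth_on_compose:
  "open U \<Longrightarrow> open V \<Longrightarrow> f ` U \<subseteq> V \<Longrightarrow> smooth_on V g \<Longrightarrow> smooth_on U f \<Longrightarrow> smooth_on U (\<lambda>x. g (f x))"
  unfolding smooth_on_def using Ck_on_compose by blast

lemma smooth_on_compose_UNIV:
  "open U \<Longrightarrow> smooth_on UNIV g \<Longrightarrow> smooth_on U f \<Longrightarrow> smooth_on U (\<lambda>x. g (f x))"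
  by (rule smooth_on_compose[of U UNIV f g]) auto

lemma smooth_on_inverse:
  fixes f :: "'a::euclidean_space \<Rightarrow> real"
  shows "open U \<Longrightarrow> (\<And>x. x \<in> U \<Longrightarrow> f x \<noteq> 0) \<Longrightarrow> smooth_on U f \<Longrightarrow> smooth_on U (\<lambda>x. inverse (f x))"
  unfolding smooth_on_def using Ck_on_inverse by blast

lemma smooth_on_norm: "open U \<Longrightarrow> (0::'a::euclidean_space) \<notin> U \<Longrightarrow> smooth_on U norm"
  unfolding smooth_on_def using Ck_on_norm by blast

lemma smooth_on_componentwise:
  fixes f :: "'a::euclidean_space \<Rightarrow> 'b::euclidean_space"
  assumes "open U" "\<And>b. b \<in> Basis \<Longrightarrow> smooth_on U (\<lambda>x. f x \<bullet> b)"
  shows "smooth_on U f"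
proof -
  have "smooth_on U (\<lambda>x. \<Sum>b\<in>Basis. (f x \<bullet> b) *\<^sub>R b)"
    by (intro smooth_on_sum smooth_on_scaleR assms smooth_on_const)
  then show ?thesis by (simp add: euclidean_representation)
qed

lemma smooth_on_vec_lambda:
  fixes f :: "'a::euclidean_space \<Rightarrow> 'n::finite \<Rightarrow> 'b::euclidean_space"
  assumes "open U" "\<And>i. smooth_on U (\<lambda>x. f x i)"
  shows "smooth_on U (\<lambda>x. \<chi> i. f x i)"
proof (rule smooth_on_componentwise[OF assms(1)])
  fix v :: "'b ^ 'n" assume "v \<in> Basis"
  then obtain i u where "v = axis i u" by (auto simp: Basis_vec_def)
  then show "smooth_on U (\<lambda>x. (\<chi> i. f x i) \<bullet> v)"
    using smooth_on_inner[OF assms(1) assms(2)[of i] smooth_on_const[of U u]] by (simp add: inner_axis)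
qed

lemma smooth_on_vec_nth:
  fixes f :: "'a::euclidean_space \<Rightarrow> 'b::euclidean_space ^ 'n"
  shows "open U \<Longrightarrow> smooth_on U f \<Longrightarrow> smooth_on U (\<lambda>x. f x $ i)"
  by (rule smooth_on_linear_compose) (auto intro!: linearI)

text \<open>Base point and direction vary together here, while \<open>smooth_on_derivative\<close>
  covers a fixed direction; linearity in the direction bridges the gap.\<close>

lemma smooth_on_frechet_apply:
  assumes "open U" "open V" "f ` U \<subseteq> V" "smooth_on V g" "smooth_on U f" "smooth_on U h"
  shows "smooth_on U (\<lambda>x. frechet_derivative g (at (f x)) (h x))"
proof -
  have "linear (frechet_derivative g (at (f x)))" if "x \<in> U" for x
    using smooth_on_has_derivative[OF assms(4)] assms(3) that has_derivative_linear by blast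
  then have eq: "frechet_derivative g (at (f x)) (h x) = (\<Sum>b\<in>Basis. (h x \<bullet> b) *\<^sub>R frechet_derivative g (at (f x)) b)" if "x \<in> U" for x
    using linear_euclidean_expand that by blast
  have "smooth_on U (\<lambda>x. \<Sum>b\<in>Basis. (h x \<bullet> b) *\<^sub>R frechet_derivative g (at (f x)) b)"
    by (intro smooth_on_sum smooth_on_scaleR smooth_on_inner smooth_on_const assms
      smooth_on_compose[OF assms(1-3), where g = "\<lambda>y. frechet_derivative g (at y) _"] smooth_on_derivative)
  then show ?thesis using smooth_on_cong[OF assms(1) eq] by simp
qed

lemma smooth_on_det:
  fixes A :: "'a::euclidean_space \<Rightarrow> real ^ 'n ^ 'n"
  assumes "open U" "\<And>i j. smooth_on U (\<lambda>x. A x $ i $ j)"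
  shows "smooth_on U (\<lambda>x. det (A x))"
  unfolding det_def
  by (intro smooth_on_sum smooth_on_mult smooth_on_prod smooth_on_const assms)

section \<open>A smooth step function\<close>

text \<open>The factor \<open>inverse t ^ n\<close> makes the family closed under differentiation:
  the derivative combines the members \<open>n + 1\<close> and \<open>n + 2\<close>, so smoothness
  of all orders follows from one induction with \<open>n\<close> arbitrary.\<close>

definition exp_flat :: "nat \<Rightarrow> real \<Rightarrow> real" where
  "exp_flat n t = (if t \<le> 0 then 0 else exp (- inverse t) * inverse t ^ n)"

lemma exp_flat_DERIV:
  "(exp_flat n has_real_derivative exp_flat (n + 2) t - real n * exp_flat (n + 1) t) (at t)"
proof -
  consider "t > 0" | "t < 0" | "t = 0" by linarith
  then show ?thesis
  proof cases
    case 1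
    have "((\<lambda>t. exp (- inverse t) * inverse t ^ n) has_real_derivative
        exp_flat (n + 2) t - real n * exp_flat (n + 1) t) (at t)"
      using 1
      by (auto intro!: derivative_eq_intros simp: exp_flat_def)
        (cases n; auto simp: field_simps power2_eq_square)
    then show ?thesis
      by (rule has_field_derivative_transform_within_open[where S = "{0<..}"])
        (use 1 in \<open>auto simp: exp_flat_def\<close>)
  next
    case 2
    have "((\<lambda>t. 0) has_real_derivative exp_flat (n + 2) t - real n * exp_flat (n + 1) t) (at t)"
      using 2 by (auto simp: exp_flat_def)
    then show ?thesis
      by (rule has_field_derivative_transform_within_open[where S = "{..<0}"])
        (use 2 in \<open>auto simp: exp_flat_def\<close>)
  next
    case 3
    have "((\<lambda>h. (exp_flat n h - exp_flat n 0) / (h - 0)) \<longlongrightarrow> 0) (at_left 0)"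
      by (rule tendsto_eventually)
        (auto simp: exp_flat_def eventually_at_left_field intro!: exI[of _ "-1"])
    moreover have "((\<lambda>h. (exp_flat n h - exp_flat n 0) / (h - 0)) \<longlongrightarrow> 0) (at_right 0)"
    proof -
      have "((\<lambda>h. inverse h ^ (n + 1) / exp (inverse h)) \<longlongrightarrow> (0::real)) (at_right 0)"
        by (rule filterlim_compose[OF tendsto_power_div_exp_0 filterlim_inverse_at_top_right])
      moreover have "\<forall>\<^sub>F h in at_right 0. inverse h ^ (n + 1) / exp (inverse h)
          = (exp_flat n h - exp_flat n 0) / (h - 0)"
        by (auto simp: exp_flat_def eventually_at_right_field exp_minus field_simps intro!: exI[of _ 1])
      ultimately show ?thesis
        by (rule Lim_transform_eventually)
    qed
    ultimately show ?thesis
      using 3 by (auto simp: has_field_derivative_iff filterlim_split_at exp_flat_def)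
  qed
qed

lemma smooth_on_exp_flat: "open U \<Longrightarrow> smooth_on U (exp_flat n)"
proof -
  assume U: "open U"
  have "Ck_on k U (exp_flat n)" for k
  proof (induction k arbitrary: n)
    case 0
    show ?case
      by (simp, intro continuous_at_imp_continuous_on ballI DERIV_isCont[OF exp_flat_DERIV])
  next
    case (Suc k)
    have "(exp_flat n has_derivative (\<lambda>v. v *\<^sub>R (exp_flat (n + 2) t + (- real n) *\<^sub>R exp_flat (n + 1) t))) (at t)" for t
      using exp_flat_DERIV[of n t] by (simp add: has_field_derivative_def mult.commute[of _ "_ - _"] mult_commute_abs)
    moreover have "Ck_on k U (\<lambda>t. v *\<^sub>R (exp_flat (n + 2) t + (- real n) *\<^sub>R exp_flat (n + 1) t))" for v
      by (intro Ck_on_bilinear[OF U bounded_bilinear_scaleR] Ck_on_const Ck_on_add[OF U] Suc)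
    ultimately show ?case
      by (rule Ck_onI[OF U])
  qed
  then show ?thesis by (simp add: smooth_on_def)
qed

text \<open>The transition lies in [1, 2], so that
  \<open>smooth_step ((norm x)\<^sup>2 / c\<^sup>2)\<close> is 0 for norms up to \<open>c\<close>
  and 1 for norms from \<open>2 * c\<close> on; squaring the norm keeps such cut-offs smooth at the
  origin.\<close>

definition smooth_step :: "real \<Rightarrow> real" where
  "smooth_step t = exp_flat 0 (t - 1) / (exp_flat 0 (t - 1) + exp_flat 0 (2 - t))"

lemma exp_flat_nonneg: "exp_flat n t \<ge> 0"
  by (simp add: exp_flat_def)

lemma smooth_step_denominator: "exp_flat 0 (t - 1) + exp_flat 0 (2 - t) > 0"
  by (cases "t \<le> 1") (auto simp: exp_flat_def add_pos_pos)

lemma smooth_step_eq_0: "t \<le> 1 \<Longrightarrow> smooth_step t = 0"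
  by (simp add: smooth_step_def exp_flat_def)

lemma smooth_step_eq_1: "2 \<le> t \<Longrightarrow> smooth_step t = 1"
  by (simp add: smooth_step_def exp_flat_def)

lemma smooth_step_nonneg: "0 \<le> smooth_step t"
  by (simp add: smooth_step_def exp_flat_nonneg)

lemma smooth_step_le_1: "smooth_step t \<le> 1"
  using smooth_step_denominator[of t] exp_flat_nonneg[of 0 "2 - t"] by (simp add: smooth_step_def)

lemma smooth_on_smooth_step: "smooth_on UNIV smooth_step"
proof -
  have 1: "smooth_on UNIV (\<lambda>t. exp_flat 0 (t - 1))" "smooth_on UNIV (\<lambda>t. exp_flat 0 (2 - t))"
    by (intro smooth_on_compose_UNIV[OF open_UNIV smooth_on_exp_flat[OF open_UNIV]] smooth_on_diff
        smooth_on_id smooth_on_const open_UNIV)+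
  have "smooth_on UNIV (\<lambda>t. exp_flat 0 (t - 1) * inverse (exp_flat 0 (t - 1) + exp_flat 0 (2 - t)))"
    using smooth_step_denominator
    by (intro smooth_on_mult smooth_on_inverse smooth_on_add 1 open_UNIV) (metis less_irrefl)
  then show ?thesis
    by (simp add: smooth_step_def[abs_def] divide_inverse)
qed

section \<open>Singular values\<close>

lemma set_singular_values:
  assumes "linear A"
  shows "set (singular_values A) \<subseteq> singular_set A"
  using finite_singular_set[OF assms] by (auto simp: singular_values_def)

lemma singular_set_le:
  assumes A: "linear A" and B: "\<And>v. norm (A v) \<le> B * norm v" and s: "s \<in> singular_set A"
  shows "s \<le> B"
proof -
  obtain v where v: "v \<noteq> 0" "adjoint A (A v) = s\<^sup>2 *\<^sub>R v" and "s \<ge> 0"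
    using s by (auto simp: singular_set_def)
  have "(norm (A v))\<^sup>2 = adjoint A (A v) \<bullet> v"
    using adjoint_works[OF A, of v "A v"] by (simp add: power2_norm_eq_inner inner_commute)
  also have "\<dots> = (s * norm v)\<^sup>2"
    using v by (simp add: power2_norm_eq_inner[symmetric] power_mult_distrib)
  finally have "norm (A v) = s * norm v"
    using \<open>s \<ge> 0\<close> by (simp add: power2_eq_iff_nonneg)
  then show ?thesis
    using B[of v] v by simp
qed

lemma singular_value_bounds:
  assumes "linear A" and "\<And>v. norm (A v) \<le> B * norm v" and "B \<ge> 0"
  shows "0 \<le> singular_value A l" and "singular_value A l \<le> B"
proof -
  have "singular_values A ! (l - 1) \<in> singular_set A" if "1 \<le> l" "l \<le> length (singular_values A)"
    using set_singular_values[OF assms(1)] that nth_mem[of "l - 1" "singular_values A"] by auto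
  then show "0 \<le> singular_value A l" "singular_value A l \<le> B"
    using singular_set_le[OF assms(1,2)] \<open>B \<ge> 0\<close> by (auto simp: singular_value_def singular_set_def)
qed

text \<open>Since \<open>A u \<bullet> A v = s\<^sup>2 * (u \<bullet> v)\<close> for an eigenvector
  \<open>u\<close>, the map \<open>A\<close> takes the union of orthonormal bases of these
  eigenspaces to nonzero, pairwise orthogonal vectors of its range.\<close>

lemma sum_dim_eigenspaces_le:
  fixes A :: "'a::euclidean_space \<Rightarrow> 'b::euclidean_space"
  assumes A: "linear A" and P: "finite P" "\<And>s. s \<in> P \<Longrightarrow> s > 0"
  shows "(\<Sum>s\<in>P. dim {v. adjoint A (A v) = s\<^sup>2 *\<^sub>R v}) \<le> dim (range A)"
proof -
  let ?E = "\<lambda>s. {v. adjoint A (A v) = s\<^sup>2 *\<^sub>R v}"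
  have lin: "linear (adjoint A)" using adjoint_linear[OF A] .
  have "subspace (?E s)" for s
    by (auto simp: subspace_def linear_0[OF A] linear_0[OF lin] linear_add[OF A] linear_add[OF lin]
        linear_cmul[OF A] linear_cmul[OF lin] scaleR_add_right)
  then have "\<exists>B. B \<subseteq> ?E s \<and> pairwise orthogonal B \<and> (\<forall>x\<in>B. norm x = 1) \<and> independent B \<and> card B = dim (?E s)" for s
    using orthonormal_basis_subspace[of "?E s"] by metis
  then obtain B where B: "\<And>s. B s \<subseteq> ?E s" "\<And>s. pairwise orthogonal (B s)" "\<And>s x. x \<in> B s \<Longrightarrow> norm x = 1"
    "\<And>s. independent (B s)" "\<And>s. card (B s) = dim (?E s)"
    by metis
  have AA: "A u \<bullet> A v = s\<^sup>2 * (u \<bullet> v)" if "u \<in> ?E s" for u v s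
    using adjoint_works[OF A, of v "A u"] that by (simp add: inner_commute)
  have ortE: "u \<bullet> v = 0" if "u \<in> ?E s" "v \<in> ?E t" "s \<in> P" "t \<in> P" "s \<noteq> t" for u v s t
  proof -
    have "s\<^sup>2 * (u \<bullet> v) = t\<^sup>2 * (u \<bullet> v)"
      using AA[OF that(1), of v] AA[OF that(2), of u] by (simp add: inner_commute)
    moreover have "s\<^sup>2 \<noteq> t\<^sup>2"
      using P(2)[OF that(3)] P(2)[OF that(4)] that(5) by (simp add: power2_eq_iff)
    ultimately show ?thesis by simp
  qed
  let ?U = "\<Union>s\<in>P. B s"
  have ort: "u \<bullet> v = 0" if "u \<in> ?U" "v \<in> ?U" "u \<noteq> v" for u v
  proof -
    obtain s t where st: "s \<in> P" "t \<in> P" "u \<in> B s" "v \<in> B t" using \<open>u \<in> ?U\<close> \<open>v \<in> ?U\<close> by blast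
    show ?thesis
    proof (cases "s = t")
      case True
      then show ?thesis using B(2)[of s] st \<open>u \<noteq> v\<close> by (auto simp: pairwise_def orthogonal_def)
    next
      case False
      then show ?thesis using ortE st B(1) by blast
    qed
  qed
  have A0: "A u \<noteq> 0" if u: "u \<in> ?U" for u
  proof -
    obtain s where s: "s \<in> P" "u \<in> B s" using u by blast
    have "A u \<bullet> A u = s\<^sup>2 * (u \<bullet> u)" using AA s B(1) by blast
    also have "\<dots> \<noteq> 0" using P(2)[OF s(1)] B(3)[OF s(2)] by auto
    finally show ?thesis by auto
  qed
  have Aort: "A u \<bullet> A v = 0" if "u \<in> ?U" "v \<in> ?U" "u \<noteq> v" for u v
  proof -
    obtain s where s: "s \<in> P" "u \<in> B s" using \<open>u \<in> ?U\<close> by blast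
    then show ?thesis using AA[of u s v] B(1) ort[OF that] by auto
  qed
  have inj: "inj_on A ?U"
    by (rule inj_onI) (metis Aort A0 inner_eq_zero_iff)
  have "pairwise orthogonal (A ` ?U)"
    using Aort by (fastforce simp: pairwise_def orthogonal_def)
  moreover have "0 \<notin> A ` ?U" using A0 by (metis imageE)
  ultimately have "independent (A ` ?U)"
    by (rule pairwise_orthogonal_independent)
  then have "card (A ` ?U) \<le> dim (range A)"
    by (intro independent_card_le_dim) auto
  moreover have "card ?U = (\<Sum>s\<in>P. card (B s))"
  proof (rule card_UN_disjoint[OF P(1)])
    show "\<forall>i\<in>P. finite (B i)" using B(4) independent_imp_finite by blast
    show "\<forall>i\<in>P. \<forall>j\<in>P. i \<noteq> j \<longrightarrow> B i \<inter> B j = {}"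
    proof (intro ballI impI)
      fix i j assume "i \<in> P" "j \<in> P" "i \<noteq> j"
      show "B i \<inter> B j = {}"
      proof (rule ccontr)
        assume "B i \<inter> B j \<noteq> {}"
        then obtain x where x: "x \<in> B i" "x \<in> B j" by blast
        have "x \<bullet> x = 0"
          using ortE[of x i x j] x B(1) \<open>i \<in> P\<close> \<open>j \<in> P\<close> \<open>i \<noteq> j\<close> by blast
        then show False using B(3)[OF x(1)] by auto
      qed
    qed
  qed
  ultimately show ?thesis
    using card_image[OF inj] B(5) by simp
qed

lemma filter_append_decreasing:
  fixes xs :: "real list"
  shows "sorted_wrt (\<ge>) xs \<Longrightarrow> xs = filter (\<lambda>s. s > 0) xs @ filter (\<lambda>s. \<not> s > 0) xs"
proof (induction xs)
  case (Cons x xs)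
  show ?case
  proof (cases "x > 0")
    case False
    then have "filter (\<lambda>s. s > 0) xs = []"
      using Cons.prems by (auto simp: filter_empty_conv)
    moreover from this have "filter (\<lambda>s. \<not> s > 0) xs = xs"
      using Cons by auto
    ultimately show ?thesis using False by simp
  qed (use Cons in auto)
qed simp

text \<open>The list is decreasing and its positive entries number at most the rank. A later index
  hits a zero entry or runs past the end, where the default value is 0.\<close>

lemma singular_value_eq_0:
  fixes A :: "'a::euclidean_space \<Rightarrow> 'b::euclidean_space"
  assumes A: "linear A" and l: "dim (range A) < l"
  shows "singular_value A l = 0"
proof (cases "l \<le> length (singular_values A)")
  case True
  let ?E = "\<lambda>s. {v. adjoint A (A v) = s\<^sup>2 *\<^sub>R v}"
  let ?r = "\<lambda>s. replicate (dim (?E s)) s"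
  define xs where "xs = rev (sorted_list_of_set (singular_set A))"
  define ps where "ps = filter (\<lambda>s. s > 0) xs"
  define zs where "zs = filter (\<lambda>s. \<not> s > 0) xs"
  have fin: "finite (singular_set A)" by (rule finite_singular_set[OF A])
  have "sorted_wrt (\<ge>) xs"
    unfolding xs_def sorted_wrt_rev using sorted_sorted_list_of_set by blast
  then have xs: "xs = ps @ zs" unfolding ps_def zs_def by (rule filter_append_decreasing)
  have dist: "distinct ps" unfolding ps_def xs_def by simp
  have sv: "singular_values A = concat (map ?r ps) @ concat (map ?r zs)"
    unfolding singular_values_def xs_def[symmetric] xs by simp
  have "length (concat (map ?r ps)) = (\<Sum>s\<in>set ps. dim (?E s))"
    using dist by (simp add: length_concat sum_list_distinct_conv_sum_set o_def)
  also have "\<dots> \<le> dim (range A)"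
    by (rule sum_dim_eigenspaces_le[OF A]) (auto simp: ps_def)
  finally have len: "length (concat (map ?r ps)) \<le> l - 1" using l by simp
  have "singular_values A ! (l - 1) = concat (map ?r zs) ! (l - 1 - length (concat (map ?r ps)))"
    unfolding sv using len by (simp add: nth_append)
  also have "\<dots> \<in> set (concat (map ?r zs))"
    using True l len by (intro nth_mem) (auto simp: sv)
  finally have "singular_values A ! (l - 1) \<in> set zs" by auto
  then have "singular_values A ! (l - 1) = 0"
    using fin by (auto simp: zs_def xs_def singular_set_def)
  then show ?thesis by (simp add: singular_value_def)
qed (simp add: singular_value_def)

lemma prod_singular_values_eq_0:
  fixes A :: "'a::euclidean_space \<Rightarrow> 'b::euclidean_space"
  assumes A: "linear A" and "\<not> surj A"
  shows "(\<Prod>l=1..DIM('b). singular_value A l) = 0"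
proof -
  have "dim (range A) < DIM('b)"
    using assms dim_eq_full[of "range A"] dim_subset_UNIV[of "range A"] span_linear_image[OF A, of UNIV]
    by (metis le_neq_implies_less span_UNIV)
  then have "singular_value A DIM('b) = 0"
    by (rule singular_value_eq_0[OF A])
  then show ?thesis
    by (auto intro!: bexI[of _ "DIM('b)"] simp: Suc_le_eq)
qed

lemma prod_singular_values_le:
  assumes "linear A" and "\<And>v. norm (A v) \<le> B * norm v" and "B \<ge> 0"
  shows "(\<Prod>l=1..j. singular_value A l) \<le> B ^ j"
proof -
  have "(\<Prod>l=1..j. singular_value A l) \<le> (\<Prod>l=1..j. B)"
    using singular_value_bounds[OF assms] by (intro prod_mono) auto
  then show ?thesis by simp
qed

section \<open>General position\<close>

lemma bounded_bilinear_matrix_vector_mult: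
  "bounded_bilinear (\<lambda>(A::real^'n^'m) x. A *v x)"
proof -
  have "bilinear (\<lambda>(A::real^'n^'m) x. A *v x)"
    unfolding bilinear_def
    by (auto intro!: linearI simp: matrix_vector_right_distrib matrix_vector_mult_add_rdistrib
        scaleR_matrix_vector_assoc matrix_vector_mult_scaleR)
  then show ?thesis by (simp add: bilinear_conv_bounded_bilinear)
qed

lemmas smooth_on_matrix_vector_mult = smooth_on_bilinear[OF _ bounded_bilinear_matrix_vector_mult]

text \<open>Inside the space of all pairs \<open>(A, b)\<close>, the bad pairs are parametrised by a hyperplane: the row
  \<open>i\<close> of a singular matrix that depends on the others is replaced by the point \<open>x\<close>.\<close>

lemma negligible_singular_perturbations:
  fixes f :: "real^'p \<Rightarrow> real^'q"
  assumes f: "smooth_on UNIV f"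
  shows "negligible {(A :: real^'p^'q, b).
    \<exists>x. f x + A *v x + b = 0 \<and> \<not> surj (\<lambda>v. frechet_derivative f (at x) v + A *v v)}"
proof -
  define D where "D x = matrix (frechet_derivative f (at x))" for x
  define M where "M i z = (\<chi> r. if r = i then \<Sum>r\<in>UNIV. (snd z $ r) *\<^sub>R (fst z $ r) else fst z $ r)"
    for i :: 'q and z :: "(real^'p^'q) \<times> (real^'q)"
  \<comment> \<open>\<open>M i z\<close> stands for the total derivative \<open>D x + A\<close> at
    the point \<open>x = fst z $ i\<close>; then \<open>A\<close> is recovered by subtraction and
    \<open>b\<close> from the equation \<open>f x + A *v x + b = 0\<close>.\<close>
  define h where "h i z = (M i z - D (fst z $ i),
      - f (fst z $ i) - (M i z - D (fst z $ i)) *v (fst z $ i))"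
    for i :: 'q and z :: "(real^'p^'q) \<times> (real^'q)"
  have linD: "linear (frechet_derivative f (at x))" for x
    using smooth_on_has_derivative[OF f] has_derivative_linear by blast
  have D: "D x *v v = frechet_derivative f (at x) v" for x v
    unfolding D_def using matrix_vector_mul(2)[OF linD] by metis
  have row: "smooth_on UNIV (\<lambda>z :: (real^'p^'q) \<times> (real^'q). fst z $ i)" for i
    by (intro smooth_on_vec_nth smooth_on_fst smooth_on_id open_UNIV)
  have coef: "smooth_on UNIV (\<lambda>z :: (real^'p^'q) \<times> (real^'q). snd z $ i)" for i
    by (intro smooth_on_vec_nth smooth_on_snd smooth_on_id open_UNIV)
  have smM: "smooth_on UNIV (M i)" for i
  proof -
    have "smooth_on UNIV (\<lambda>z :: (real^'p^'q) \<times> (real^'q). if r = i then \<Sum>r\<in>UNIV. (snd z $ r) *\<^sub>R (fst z $ r) else fst z $ r)" for r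
      using row coef by (cases "r = i") (auto intro!: smooth_on_sum smooth_on_scaleR)
    then show ?thesis
      unfolding M_def by (intro smooth_on_vec_lambda open_UNIV)
  qed
  have smD: "smooth_on UNIV D"
    unfolding D_def matrix_def
    by (intro smooth_on_vec_lambda smooth_on_vec_nth smooth_on_derivative f open_UNIV)
  have smDrow: "smooth_on UNIV (\<lambda>z :: (real^'p^'q) \<times> (real^'q). D (fst z $ i))" for i
    by (rule smooth_on_compose_UNIV[OF open_UNIV smD row])
  have smfrow: "smooth_on UNIV (\<lambda>z :: (real^'p^'q) \<times> (real^'q). f (fst z $ i))" for i
    by (rule smooth_on_compose_UNIV[OF open_UNIV f row])
  have smh: "smooth_on UNIV (h i)" for i
    unfolding h_def[abs_def]
    by (intro smooth_on_Pair smooth_on_diff smooth_on_minus smooth_on_matrix_vector_mult smM smDrow smfrow row open_UNIV)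
  \<comment> \<open>With coefficient \<open>i\<close> equal to zero, the sum in \<open>M i z\<close>
    combines genuine rows and leaves out \<open>x\<close>. Domain and target of \<open>h i\<close>
    have the same dimension, so the smooth image of a hyperplane is null.\<close>
  define S where "S i = {z :: (real^'p^'q) \<times> (real^'q). (0, axis i 1) \<bullet> z = 0}" for i
  have "negligible (S i)" for i
    unfolding S_def by (rule negligible_hyperplane) (simp add: axis_eq_0_iff zero_prod_def)
  then have "negligible (h i ` S i)" for i
    using smooth_on_differentiable[OF smh]
    by (intro negligible_differentiable_image_negligible differentiable_at_imp_differentiable_on) auto
  then have "negligible (\<Union>i. h i ` S i)"
    by (intro negligible_Union) auto
  moreover have "{(A :: real^'p^'q, b). \<exists>x. f x + A *v x + b = 0
      \<and> \<not> surj (\<lambda>v. frechet_derivative f (at x) v + A *v v)} \<subseteq> (\<Union>i. h i ` S i)"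
  proof clarify
    fix A :: "real^'p^'q" and b x
    assume 0: "f x + A *v x + b = 0" and ns: "\<not> surj (\<lambda>v. frechet_derivative f (at x) v + A *v v)"
    define M' where "M' = A + D x"
    have M': "M' *v v = frechet_derivative f (at x) v + A *v v" for v
      by (simp add: M'_def matrix_vector_mult_add_rdistrib D)
    have lin: "linear (\<lambda>v. M' *v v)" by simp
    have "dim (range (\<lambda>v. M' *v v)) < DIM(real^'q)"
      using ns dim_eq_full[of "range (\<lambda>v. M' *v v)"] dim_subset_UNIV[of "range (\<lambda>v. M' *v v)"]
        span_linear_image[OF lin, of UNIV]
      unfolding M'[symmetric] by (metis le_neq_implies_less span_UNIV)
    then obtain c where c: "c \<noteq> 0" "\<And>y. y \<in> span (range (\<lambda>v. M' *v v)) \<Longrightarrow> orthogonal c y"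
      using orthogonal_to_subspace_exists by blast
    \<comment> \<open>A vector orthogonal to the range is a linear relation between the
      rows.\<close>
    have rel: "(\<Sum>r\<in>UNIV. (c $ r) *\<^sub>R (M' $ r)) = 0"
    proof -
      have "(\<Sum>r\<in>UNIV. (c $ r) *\<^sub>R (M' $ r)) \<bullet> v = c \<bullet> (M' *v v)" for v
      proof -
        have "(\<Sum>r\<in>UNIV. (c $ r) *\<^sub>R (M' $ r)) \<bullet> v = (\<Sum>r\<in>UNIV. c $ r * (M' $ r \<bullet> v))"
          by (simp add: inner_sum_left)
        also have "\<dots> = c \<bullet> (M' *v v)"
          by (simp add: inner_vec_def matrix_vector_mult_def)
        finally show ?thesis .
      qed
      also have "c \<bullet> (M' *v v) = 0" for v
        using c(2)[of "M' *v v"] by (auto simp: orthogonal_def intro: span_base)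
      finally show ?thesis by (metis inner_eq_zero_iff)
    qed
    obtain i where i: "c $ i \<noteq> 0" using c(1) by (auto simp: vec_eq_iff)
    define z :: "(real^'p^'q) \<times> (real^'q)" where
      "z = (\<chi> r. if r = i then x else M' $ r, \<chi> r. if r = i then 0 else - (c $ r / c $ i))"
    have zx: "fst z $ i = x" by (simp add: z_def)
    have "M i z = M'"
    proof -
      have "(\<Sum>r\<in>UNIV. (snd z $ r) *\<^sub>R (fst z $ r)) = (\<Sum>r\<in>UNIV-{i}. (- (1 / c $ i)) *\<^sub>R ((c $ r) *\<^sub>R (M' $ r)))"
        by (rule sum.mono_neutral_cong_right) (auto simp: z_def)
      also have "\<dots> = (- (1 / c $ i)) *\<^sub>R (\<Sum>r\<in>UNIV-{i}. (c $ r) *\<^sub>R (M' $ r))"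
        by (simp only: scaleR_right.sum)
      also have "(\<Sum>r\<in>UNIV-{i}. (c $ r) *\<^sub>R (M' $ r)) = - (c $ i) *\<^sub>R (M' $ i)"
        using rel by (simp add: sum.remove[of UNIV i] add_eq_0_iff)
      finally have "(\<Sum>r\<in>UNIV. (snd z $ r) *\<^sub>R (fst z $ r)) = M' $ i"
        using i by simp
      then show ?thesis
        by (auto simp: M_def vec_eq_iff z_def)
    qed
    moreover have "b = - (f x + A *v x)"
      using 0 by (metis add_eq_0_iff)
    ultimately have "h i z = (A, b)"
      unfolding h_def zx by (simp add: M'_def)
    moreover have "z \<in> S i"
      by (simp add: S_def z_def inner_axis')
    ultimately have "(A, b) \<in> h i ` S i"
      by (rule image_eqI[OF sym])
    then show "(A, b) \<in> (\<Union>i. h i ` S i)"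
      by (rule UN_I[OF UNIV_I])
  qed
  ultimately show ?thesis
    using negligible_subset by blast
qed

text \<open>Here the bad pairs are parametrised by \<open>(x, s)\<close> and the columns of \<open>A\<close> other than the \<open>a\<close>-th; the
  dimension hypothesis leaves room for \<open>(x, s)\<close> in a hyperplane of the space of pairs
  (\<open>a\<close>-th column, \<open>b\<close>).\<close>

lemma negligible_aligned_perturbations:
  fixes f :: "real^'p \<Rightarrow> real^'q"
  assumes f: "smooth_on UNIV f" and "y \<noteq> y'" and dims: "CARD('p) + 1 < 2 * CARD('q)"
  shows "negligible {(A :: real^'p^'q, b). \<exists>x s. f x + A *v x + b = y
    \<and> f (x + s *\<^sub>R axis a 1) + A *v (x + s *\<^sub>R axis a 1) + b = y'}"
proof -
  obtain i0 :: 'q where True by blast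
  define H where "H = {w :: (real^'q) \<times> (real^'q). (0, axis i0 1) \<bullet> w = 0}"
  have subH: "subspace H" unfolding H_def by (rule subspace_hyperplane)
  have "dim H = DIM((real^'q) \<times> (real^'q)) - 1"
    unfolding H_def by (rule dim_hyperplane) (simp add: axis_eq_0_iff zero_prod_def)
  \<comment> \<open>The dimension count: \<open>CARD('p) + 1\<close> unknowns \<open>(x, s)\<close>
    fit into \<open>H\<close>, whose dimension is \<open>2 * CARD('q) - 1\<close>.\<close>
  then have "dim (UNIV :: ((real^'p) \<times> real) set) \<le> dim H"
    using dims by simp
  then obtain g :: "(real^'p) \<times> real \<Rightarrow> (real^'q) \<times> (real^'q)"
    where g: "linear g" "g \<in> UNIV \<rightarrow> H" "\<And>x. norm (g x) = norm x"
    using isometry_subset_subspace[OF subspace_UNIV subH] by (metis UNIV_I)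
  have "inj g"
    using g(3) linear_injective_0[OF g(1)] by (metis norm_eq_zero)
  then obtain L where L: "linear L" "L \<circ> g = id"
    using linear_injective_left_inverse[OF g(1)] by blast
  \<comment> \<open>The left inverse \<open>L\<close> is defined on the whole space and decodes
    \<open>(x, s)\<close> from column \<open>a\<close> and the second component.\<close>
  define w where "w z = L (\<chi> r. fst z $ r $ a, snd z)" for z :: "(real^'p^'q) \<times> (real^'q)"
  define X where "X z = fst (w z)" for z
  define s where "s z = snd (w z)" for z
  \<comment> \<open>Subtracting the two equations determines column \<open>a\<close> of the
    perturbation as a difference quotient along the axis. Division by \<open>s\<close> is legitimate
    because \<open>y \<noteq> y'\<close> excludes \<open>s = 0\<close>.\<close>
  define A where "A z = (\<chi> r t. if t = a
      then inverse (s z) * ((y' - y - f (X z + s z *\<^sub>R axis a 1) + f (X z)) $ r) else fst z $ r $ t)"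
    for z :: "(real^'p^'q) \<times> (real^'q)"
  define h where "h z = (A z, y - f (X z) - A z *v X z)" for z
  define U where "U = {z. s z \<noteq> 0}"
  define S where "S = {z :: (real^'p^'q) \<times> (real^'q). (0, axis i0 1) \<bullet> z = 0}"
  have smw: "smooth_on V w" if "open V" for V
    unfolding w_def
    by (intro smooth_on_linear_compose[OF that L(1)] smooth_on_Pair smooth_on_vec_lambda smooth_on_vec_nth smooth_on_fst
        smooth_on_snd smooth_on_id that)
  have "open U"
  proof -
    have "continuous_on UNIV s"
      using smooth_on_continuous[OF smooth_on_snd[OF open_UNIV smw[OF open_UNIV]]] by (simp add: s_def)
    then show ?thesis
      unfolding U_def by (intro open_Collect_neq continuous_on_const)
  qed
  have smX: "smooth_on U X" and sms: "smooth_on U s"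
    unfolding X_def s_def by (intro smooth_on_fst smooth_on_snd \<open>open U\<close> smw)+
  have smA: "smooth_on U A"
  proof -
    have 1: "smooth_on U (\<lambda>z. inverse (s z) * ((y' - y - f (X z + s z *\<^sub>R axis a 1) + f (X z)) $ r))" for r
      by (intro smooth_on_mult smooth_on_inverse smooth_on_vec_nth smooth_on_add smooth_on_diff smooth_on_const
        smooth_on_compose_UNIV[OF _ f] smooth_on_scaleR smX sms \<open>open U\<close>) (auto simp: U_def)
    have 2: "smooth_on U (\<lambda>z :: (real^'p^'q) \<times> (real^'q). fst z $ r $ t)" for r t
      by (intro smooth_on_vec_nth smooth_on_fst smooth_on_id \<open>open U\<close>)
    have "smooth_on U (\<lambda>z. if t = a
      then inverse (s z) * ((y' - y - f (X z + s z *\<^sub>R axis a 1) + f (X z)) $ r) else fst z $ r $ t)" for r t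
      using 1 2 by (cases "t = a") auto
    then show ?thesis
      unfolding A_def[abs_def] by (intro smooth_on_vec_lambda \<open>open U\<close>)
  qed
  have smh: "smooth_on U h"
    unfolding h_def[abs_def]
    by (intro smooth_on_Pair smooth_on_diff smooth_on_const smooth_on_compose_UNIV[OF _ f]
        smooth_on_matrix_vector_mult smA smX \<open>open U\<close>)
  have "negligible S"
    unfolding S_def by (rule negligible_hyperplane) (simp add: axis_eq_0_iff zero_prod_def)
  then have "negligible (h ` (S \<inter> U))"
    using smooth_on_differentiable[OF smh]
    by (intro negligible_differentiable_image_negligible differentiable_at_imp_differentiable_on negligible_Int) auto
  moreover have "{(A :: real^'p^'q, b). \<exists>x s. f x + A *v x + b = y
    \<and> f (x + s *\<^sub>R axis a 1) + A *v (x + s *\<^sub>R axis a 1) + b = y'} \<subseteq> h ` (S \<inter> U)"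
  proof clarify
    fix A' :: "real^'p^'q" and x s' and b :: "real^'q"
    assume y: "y = f x + A' *v x + b"
      and y': "y' = f (x + s' *\<^sub>R axis a 1) + A' *v (x + s' *\<^sub>R axis a 1) + b"
    have "s' \<noteq> 0"
      using \<open>y \<noteq> y'\<close> y y' by auto
    obtain c1 c2 where c: "g (x, s') = (c1, c2)" by fastforce
    define z :: "(real^'p^'q) \<times> (real^'q)" where
      "z = (\<chi> r t. if t = a then c1 $ r else A' $ r $ t, c2)"
    have "w z = L (g (x, s'))"
      unfolding w_def c by (simp add: z_def vec_eq_iff)
    then have "w z = (x, s')"
      using L(2) by (metis comp_apply id_apply)
    then have X: "X z = x" and s: "s z = s'" by (simp_all add: X_def s_def)
    have "y' - y - f (x + s' *\<^sub>R axis a 1) + f x = s' *\<^sub>R (A' *v axis a 1)"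
      unfolding y y' by (simp add: matrix_vector_right_distrib matrix_vector_mult_scaleR)
    then have *: "(y' - y - f (x + s' *\<^sub>R axis a 1) + f x) $ r = s' * A' $ r $ a" for r
      by (simp add: matrix_vector_mult_basis column_def)
    have "A z = A'"
      unfolding A_def X s * using \<open>s' \<noteq> 0\<close> by (auto simp: vec_eq_iff z_def)
    then have "h z = (A', b)"
      by (simp add: h_def X y)
    moreover have "z \<in> S"
      using g(2) c by (auto simp: S_def H_def z_def Pi_iff) (metis inner_Pair inner_zero_left add_0)
    moreover have "z \<in> U" using s \<open>s' \<noteq> 0\<close> by (simp add: U_def)
    ultimately show "(A', b) \<in> h ` (S \<inter> U)"
      by (metis IntI imageI)
  qed
  ultimately show ?thesis
    using negligible_subset by blast
qed

text \<open>The bad pairs are covered by countably many null sets, so every ball around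
  \<open>(0, 0)\<close> contains a good pair.\<close>

lemma generic_affine_perturbation:
  fixes f :: "real^'p \<Rightarrow> real^'q"
  assumes f: "smooth_on UNIV f" and dims: "CARD('p) + 1 < 2 * CARD('q)" and Y: "countable Y" and "r > 0"
  obtains A :: "real^'p^'q" and b where
    "\<And>x. norm x \<le> 2 \<Longrightarrow> norm (A *v x + b) < r"
    "\<And>x. f x + A *v x + b = 0 \<Longrightarrow> surj (\<lambda>v. frechet_derivative f (at x) v + A *v v)"
    "\<And>y y' a x s. \<lbrakk>y \<in> Y; y' \<in> Y; f x + A *v x + b = y;
      f (x + s *\<^sub>R axis a 1) + A *v (x + s *\<^sub>R axis a 1) + b = y'\<rbrakk> \<Longrightarrow> y = y'"
proof -
  obtain K where K: "K > 0" "\<And>(A::real^'p^'q) x. norm (A *v x) \<le> norm A * norm x * K"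
    using bounded_bilinear.pos_bounded[OF bounded_bilinear_matrix_vector_mult] by blast
  define B1 where "B1 = {(A :: real^'p^'q, b).
    \<exists>x. f x + A *v x + b = 0 \<and> \<not> surj (\<lambda>v. frechet_derivative f (at x) v + A *v v)}"
  define B2 where "B2 p = (case p of (y, y', a) \<Rightarrow> {(A :: real^'p^'q, b). \<exists>x s. f x + A *v x + b = y
    \<and> f (x + s *\<^sub>R axis a 1) + A *v (x + s *\<^sub>R axis a 1) + b = y'})" for p
  define I where "I = {(y, y', a :: 'p). y \<in> Y \<and> y' \<in> Y \<and> y \<noteq> y'}"
  have "countable (Y \<times> Y \<times> (UNIV :: 'p set))"
    using Y by (intro countable_SIGMA) (auto intro: countable_finite)
  then have "countable I" by (rule countable_subset[rotated]) (auto simp: I_def)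
  have "negligible B1"
    unfolding B1_def by (rule negligible_singular_perturbations[OF f])
  moreover have "negligible (\<Union>p\<in>I. B2 p)"
    using negligible_aligned_perturbations[OF f _ dims] \<open>countable I\<close>
    by (intro negligible_countable_Union) (auto simp: I_def B2_def)
  ultimately have "negligible (B1 \<union> (\<Union>p\<in>I. B2 p))"
    by (rule negligible_Un)
  \<comment> \<open>For \<open>norm x \<le> 2\<close> the perturbation stays below
    \<open>2 * K * d + d\<close>, which is \<open>r\<close>.\<close>
  moreover define d where "d = r / (2 * K + 1)"
  have "d > 0" using \<open>r > 0\<close> K(1) by (simp add: d_def)
  then have "\<not> negligible (ball (0 :: (real^'p^'q) \<times> (real^'q)) d)"
    by (intro open_not_negligible) auto
  ultimately have "\<not> ball (0 :: (real^'p^'q) \<times> (real^'q)) d \<subseteq> B1 \<union> (\<Union>p\<in>I. B2 p)"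
    using negligible_subset by blast
  then obtain A b where Ab: "norm (A, b) < d" "(A, b) \<notin> B1" "(A, b) \<notin> (\<Union>p\<in>I. B2 p)"
    by (auto simp: subset_iff)
  show thesis
  proof (rule that[of A b])
    fix x :: "real^'p" assume x: "norm x \<le> 2"
    have A: "norm A < d" and b: "norm b < d"
      using Ab(1) norm_fst_le[of A b] norm_snd_le[of b A] by auto
    have "norm (A *v x + b) \<le> norm A * norm x * K + norm b"
      using K(2)[of A x] norm_triangle_ineq[of "A *v x" b] by linarith
    also have "\<dots> \<le> d * 2 * K + norm b"
      using A x K(1) \<open>d > 0\<close> by (intro add_right_mono mult_right_mono mult_mono) auto
    also have "\<dots> < d * 2 * K + d" using b by simp
    also have "\<dots> = d * (2 * K + 1)" by (simp add: algebra_simps)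
    also have "\<dots> = r" using K(1) by (simp add: d_def)
    finally show "norm (A *v x + b) < r" .
  next
    fix x assume "f x + A *v x + b = 0"
    then show "surj (\<lambda>v. frechet_derivative f (at x) v + A *v v)"
      using Ab(2) by (auto simp: B1_def)
  next
    fix y y' a x s assume *: "y \<in> Y" "y' \<in> Y" "f x + A *v x + b = y"
      "f (x + s *\<^sub>R axis a 1) + A *v (x + s *\<^sub>R axis a 1) + b = y'"
    show "y = y'"
    proof (rule ccontr)
      assume "y \<noteq> y'"
      then have "(A, b) \<in> (\<Union>p\<in>I. B2 p)"
        using * by (intro UN_I[of "(y, y', a)"]) (auto simp: I_def B2_def)
      then show False using Ab(3) by blast
    qed
  qed
qed

section \<open>Lifting near a regular fibre\<close>

text \<open>The lift is \<open>H (x, y) = x + Df(x)\<^sup>T u\<close>, where \<open>u\<close> solves \<open>f (x + Df(x)\<^sup>T u) = y\<close>. On the zero set the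
  \<open>u\<close>-derivative of the left-hand side is \<open>Df(x) Df(x)\<^sup>T\<close>, so nearby the equation is strongly monotone
  in \<open>u\<close>.\<close>

lemma submersion_lift:
  fixes f :: "real^'p \<Rightarrow> real^'q"
  assumes f: "smooth_on UNIV f" and c: "c > 0" and cpt: "\<And>x. norm (f x) < c \<Longrightarrow> norm x \<le> 1"
    and reg: "\<And>x. f x = 0 \<Longrightarrow> surj (frechet_derivative f (at x))"
  obtains \<delta> and H :: "(real^'p) \<times> (real^'q) \<Rightarrow> real^'p" where
    "0 < \<delta>" "\<delta> \<le> c"
    "smooth_on {(x, y). norm (f x) < \<delta> \<and> norm y < \<delta>} H"
    "\<And>x y. norm (f x) < \<delta> \<Longrightarrow> norm y < \<delta> \<Longrightarrow> f (H (x, y)) = y"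
    "\<And>x. norm (f x) < \<delta> \<Longrightarrow> H (x, f x) = x"
proof -
  define D where "D x = frechet_derivative f (at x)" for x
  have Df: "(f has_derivative D x) (at x)" for x
    unfolding D_def using smooth_on_has_derivative[OF f] by blast
  have linD: "linear (D x)" for x using Df has_derivative_linear by blast
  \<comment> \<open>\<open>T x\<close> is the adjoint of \<open>D x\<close>, written out in the
    basis so that its smooth dependence on \<open>x\<close> is visible.\<close>
  define T where "T x u = (\<Sum>b\<in>Basis. (D x b \<bullet> u) *\<^sub>R b)" for x and u :: "real^'q"
  have T0: "T x 0 = 0" for x by (simp add: T_def)
  have linT: "linear (T x)" for x
    by (auto intro!: linearI simp: T_def inner_add_right scaleR_add_left sum.distrib scaleR_sum_right)
  have smT: "smooth_on U (\<lambda>z. T (a z) (v z))"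
    if "open U" "smooth_on U a" "smooth_on U v" for U :: "((real^'p) \<times> (real^'q)) set" and a v
    unfolding T_def D_def
    by (intro smooth_on_sum smooth_on_scaleR smooth_on_inner smooth_on_const that smooth_on_frechet_apply[OF _ open_UNIV _ f]) auto
  define g where "g z = f (fst z + T (fst z) (snd z))" for z
  have smg: "smooth_on UNIV g"
    unfolding g_def
    by (intro smooth_on_compose_UNIV[OF _ f] smooth_on_add smT smooth_on_fst smooth_on_snd smooth_on_id open_UNIV)
  have g0: "g (x, 0) = f x" for x by (simp add: g_def T0)
  define E where "E z = frechet_derivative g (at z)" for z
  have Eg: "(g has_derivative E z) (at z)" for z
    unfolding E_def using smooth_on_has_derivative[OF smg] by blast
  have linE: "linear (E z)" for z using Eg has_derivative_linear by blast
  have smE: "smooth_on UNIV (\<lambda>z. E z v)" for v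
    unfolding E_def by (rule smooth_on_derivative[OF smg])
  have linE2: "linear (\<lambda>w. E z (0, w))" for z
  proof -
    have "linear (\<lambda>w::real^'q. (0::real^'p, w))" by (rule linearI) auto
    from linear_compose[OF this linE[of z]] show ?thesis by (simp add: o_def)
  qed
  have Eg2: "((\<lambda>u. g (x, u)) has_derivative (\<lambda>w. E (x, u) (0, w))) (at u)" for x u
  proof -
    have "((\<lambda>u. (x, u)) has_derivative (\<lambda>w. (0, w))) (at u)"
      by (auto intro!: derivative_eq_intros)
    from has_derivative_compose[OF this Eg] show ?thesis .
  qed
  have E0: "E (x, 0) (0, w) = D x (T x w)" for x w
  proof -
    have "((\<lambda>u. x + T x u) has_derivative T x) (at 0)"
      using linear_imp_has_derivative[OF linT] by (auto intro!: derivative_eq_intros)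
    from has_derivative_compose[OF this] have "((\<lambda>u. g (x, u)) has_derivative (\<lambda>w. D x (T x w))) (at 0)"
      using Df[of "x + T x 0"] by (simp add: g_def T0)
    from has_derivative_unique[OF this Eg2] show ?thesis by metis
  qed
  have pos0: "E (x, 0) (0, w) \<bullet> w > 0" if "f x = 0" "w \<noteq> 0" for x w
  proof -
    have 1: "D x v \<bullet> w = v \<bullet> T x w" for v
    proof -
      have "D x v \<bullet> w = (\<Sum>b\<in>Basis. (v \<bullet> b) * (D x b \<bullet> w))"
        by (subst linear_euclidean_expand[OF linD]) (simp add: inner_sum_left)
      also have "\<dots> = v \<bullet> T x w"
        by (simp add: T_def inner_sum_right mult.commute)
      finally show ?thesis .
    qed
    obtain v where "D x v = w"
      using reg[OF \<open>f x = 0\<close>] unfolding D_def by (metis surjD)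
    then have "T x w \<noteq> 0"
      using 1[of v] \<open>w \<noteq> 0\<close> by auto
    then show ?thesis
      unfolding E0 1 by simp
  qed
  have smEE: "smooth_on UNIV (\<lambda>p :: ((real^'p) \<times> (real^'q)) \<times> (real^'q). E (fst p) (0, snd p))"
    unfolding E_def
    by (rule smooth_on_frechet_apply[OF open_UNIV open_UNIV _ smg])
      (auto intro!: smooth_on_Pair smooth_on_const smooth_on_fst smooth_on_snd smooth_on_id)
  obtain \<nu> where \<nu>: "\<nu> > 0" "\<And>x u w. \<lbrakk>norm x \<le> 1; norm u \<le> 1; norm w = 1; norm (f x) \<le> \<nu>; norm u \<le> \<nu>\<rbrakk>
      \<Longrightarrow> E (x, u) (0, w) \<bullet> w \<ge> \<nu>"
  proof -
    define C where "C = (cball (0::real^'p) 1 \<times> cball (0::real^'q) 1) \<times> sphere (0::real^'q) 1"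
    \<comment> \<open>By \<open>pos0\<close> the three terms never vanish together on
      \<open>C\<close>, so \<theta> has a positive minimum. When the first two terms are each at
      most a third of it, the last is at least a third.\<close>
    define \<theta> where "\<theta> p = norm (f (fst (fst p))) + norm (snd (fst p)) + max 0 (E (fst p) (0, snd p) \<bullet> snd p)"
      for p :: "((real^'p) \<times> (real^'q)) \<times> (real^'q)"
    have contf: "continuous_on UNIV f" using smooth_on_continuous[OF f] .
    have "continuous_on C \<theta>"
      unfolding \<theta>_def
      by (intro continuous_intros continuous_on_compose2[OF contf]
        continuous_on_subset[OF smooth_on_continuous[OF smEE]]) auto
    moreover have "compact C" unfolding C_def by (intro compact_Times compact_cball compact_sphere)
    moreover have "C \<noteq> {}"
    proof -
      have "(axis undefined 1 :: real^'q) \<in> sphere 0 1" by simp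
      then show ?thesis unfolding C_def by fastforce
    qed
    ultimately obtain p0 where p0: "p0 \<in> C" "\<And>p. p \<in> C \<Longrightarrow> \<theta> p0 \<le> \<theta> p"
      using continuous_attains_inf by metis
    have "\<theta> p0 > 0"
    proof (cases "f (fst (fst p0)) = 0 \<and> snd (fst p0) = 0")
      case True
      then have "fst p0 = (fst (fst p0), 0)" by (simp add: prod_eq_iff)
      moreover have "snd p0 \<noteq> 0" using p0(1) by (auto simp: C_def)
      ultimately have "E (fst p0) (0, snd p0) \<bullet> snd p0 > 0"
        using pos0 True by metis
      then show ?thesis unfolding \<theta>_def by (smt (verit) norm_ge_zero)
    next
      case False
      then have "norm (f (fst (fst p0))) > 0 \<or> norm (snd (fst p0)) > 0" by auto
      then show ?thesis unfolding \<theta>_def by (smt (verit) norm_ge_zero)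
    qed
    show thesis
    proof (rule that[of "\<theta> p0 / 3"])
      show "\<theta> p0 / 3 > 0" using \<open>\<theta> p0 > 0\<close> by simp
      fix x u w
      assume *: "norm (x::real^'p) \<le> 1" "norm (u::real^'q) \<le> 1" "norm (w::real^'q) = 1"
        "norm (f x) \<le> \<theta> p0 / 3" "norm u \<le> \<theta> p0 / 3"
      have "\<theta> p0 \<le> \<theta> ((x, u), w)" using * by (intro p0(2)) (auto simp: C_def)
      also have "\<theta> ((x, u), w) = norm (f x) + norm u + max 0 (E (x, u) (0, w) \<bullet> w)"
        by (simp add: \<theta>_def)
      finally have "\<theta> p0 / 3 \<le> max 0 (E (x, u) (0, w) \<bullet> w)"
        using *(4,5) by linarith
      then show "\<theta> p0 / 3 \<le> E (x, u) (0, w) \<bullet> w"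
        using \<open>\<theta> p0 > 0\<close> by linarith
    qed
  qed
  define r where "r = Min {\<nu>, 1, c / 2}"
  have r: "0 < r" "r \<le> \<nu>" "r \<le> 1" "r < c" using \<nu>(1) c by (auto simp: r_def)
  have pos: "E (x, u) (0, w) \<bullet> w \<ge> \<nu> * (norm w)\<^sup>2" if "norm (f x) < r" "norm u \<le> r" for x u w
  proof (cases "w = 0")
    case False
    have "E (x, u) (0, w /\<^sub>R norm w) \<bullet> (w /\<^sub>R norm w) \<ge> \<nu>"
      using that r False by (intro \<nu>(2) cpt) auto
    moreover have "E (x, u) (0, w /\<^sub>R norm w) = E (x, u) (0, w) /\<^sub>R norm w"
      using linear_cmul[OF linE2] by blast
    ultimately show ?thesis using False by (simp add: field_simps power2_eq_square)
  qed (simp add: linear_0[OF linE2])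
  have mono: "(g (x, u) - g (x, u')) \<bullet> (u - u') \<ge> \<nu> * (norm (u - u'))\<^sup>2"
    if "norm (f x) < r" "norm u \<le> r" "norm u' \<le> r" for x u u'
  proof -
    let ?l = "\<lambda>t::real. u' + t *\<^sub>R (u - u')"
    have "((\<lambda>t. g (x, ?l t) \<bullet> (u - u')) has_derivative (\<lambda>h. E (x, ?l t) (0, h *\<^sub>R (u - u')) \<bullet> (u - u'))) (at t)" for t
    proof -
      have "(?l has_derivative (\<lambda>h. h *\<^sub>R (u - u'))) (at t)"
        by (auto intro!: derivative_eq_intros)
      from has_derivative_inner_left[OF has_derivative_compose[OF this Eg2[of x "?l t"]]]
      show ?thesis .
    qed
    from mvt_simple[of 0 1, OF zero_less_one has_derivative_at_withinI[OF this]]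
    have "\<exists>t\<in>{0<..<1}. g (x, ?l 1) \<bullet> (u - u') - g (x, ?l 0) \<bullet> (u - u')
        = E (x, ?l t) (0, (1 - 0) *\<^sub>R (u - u')) \<bullet> (u - u')" .
    then obtain t where t: "0 < t" "t < 1"
      "(g (x, u) - g (x, u')) \<bullet> (u - u') = E (x, ?l t) (0, u - u') \<bullet> (u - u')"
      by (auto simp: inner_diff_left)
    have "?l t = (1 - t) *\<^sub>R u' + t *\<^sub>R u" by (simp add: algebra_simps)
    then have "?l t \<in> cball 0 r"
      using convexD_alt[OF convex_cball, of u' "0::real^'q" r u t] that t by auto
    then show ?thesis
      unfolding t(3) using pos[OF that(1), of "?l t" "u - u'"] by simp
  qed
  have linear_iso: "inj (\<lambda>w. E (x, u) (0, w))" if "norm (f x) < r" "norm u \<le> r" for x u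
  proof -
    have "w = 0" if "E (x, u) (0, w) = 0" for w
      using pos[OF \<open>norm (f x) < r\<close> \<open>norm u \<le> r\<close>, of w] that \<nu>(1)
      by (simp add: mult_le_0_iff)
    then show ?thesis using linear_injective_0[OF linE2] by blast
  qed
  \<comment> \<open>This keeps minimisers off the boundary: for \<open>norm u = r\<close>
    monotonicity gives \<open>\<nu> * r \<le> norm (g (x, u) - f x)\<close>, whereas minimality
    would bound the right-hand side by \<open>2 * norm (f x) + 2 * norm y\<close>, which is below
    \<open>4 * \<delta>\<close>.\<close>
  define \<delta> where "\<delta> = min r (\<nu> * r / 4)"
  have \<delta>: "\<delta> > 0" "\<delta> \<le> r" "4 * \<delta> \<le> \<nu> * r" using r \<nu>(1) by (auto simp: \<delta>_def)
  define W where "W = {(x, y). norm (f x) < \<delta> \<and> norm (y::real^'q) < \<delta>}"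
  have "open W"
  proof -
    have "W = {x. norm (f x) < \<delta>} \<times> ball 0 \<delta>" by (auto simp: W_def)
    moreover have "open {x. norm (f x) < \<delta>}"
      using smooth_on_continuous[OF f] by (intro open_Collect_less continuous_intros)
    ultimately show ?thesis by (simp add: open_Times)
  qed
  have ex: "\<exists>u. norm u \<le> r \<and> g (fst z, u) = snd z" if z: "z \<in> W" for z
  proof -
    obtain x y where xy: "z = (x, y)" "norm (f x) < \<delta>" "norm y < \<delta>" using z by (auto simp: W_def)
    \<comment> \<open>The squared residual is minimised over a closed ball. At an interior minimum
      the residual is orthogonal to the range of a surjective derivative, hence it is zero.\<close>
    let ?N = "\<lambda>u. (g (x, u) - y) \<bullet> (g (x, u) - y)"
    have d: "(?N has_derivative (\<lambda>w. (g (x, u) - y) \<bullet> E (x, u) (0, w) + E (x, u) (0, w) \<bullet> (g (x, u) - y))) (at u)" for u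
      using Eg2[of x u] by (auto intro!: derivative_eq_intros)
    then have "continuous_on (cball 0 r) ?N"
      by (intro continuous_at_imp_continuous_on ballI has_derivative_continuous)
    then obtain u where u: "u \<in> cball 0 r" "\<And>v. v \<in> cball 0 r \<Longrightarrow> ?N u \<le> ?N v"
      using continuous_attains_inf[of "cball 0 r" ?N] r(1) by force
    have "norm u < r"
    proof (rule ccontr)
      assume "\<not> norm u < r"
      then have nu: "norm u = r" using u(1) by simp
      have "\<nu> * r\<^sup>2 \<le> (g (x, u) - f x) \<bullet> u"
        using mono[of x u 0] xy \<delta> nu r by (simp add: g0)
      also have "\<dots> \<le> norm (g (x, u) - f x) * r"
        using norm_cauchy_schwarz[of "g (x, u) - f x" u] nu by simp
      finally have "\<nu> * r \<le> norm (g (x, u) - f x)"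
        using r(1) by (simp add: power2_eq_square)
      moreover have "norm (g (x, u) - f x) \<le> norm (g (x, u) - y) + norm y + norm (f x)"
        using norm_triangle_ineq4[of "g (x, u) - y + y" "f x"] norm_triangle_ineq[of "g (x, u) - y" y] by simp
      moreover have "norm (g (x, u) - y) \<le> norm (f x - y)"
        using u(2)[of 0] r(1) by (simp add: g0 norm_le)
      moreover have "norm (f x - y) \<le> norm (f x) + norm y" by (rule norm_triangle_ineq4)
      ultimately show False using xy \<delta>(3) by linarith
    qed
    then have "(\<lambda>w. (g (x, u) - y) \<bullet> E (x, u) (0, w) + E (x, u) (0, w) \<bullet> (g (x, u) - y)) = (\<lambda>w. 0)"
      using u(2) by (intro differential_zero_maxmin[OF _ open_ball[of 0 r] d]) auto
    note crit = fun_cong[OF this]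
    have "surj (\<lambda>w. E (x, u) (0, w))"
      using xy \<delta>(2) u(1) by (intro linear_injective_imp_surjective linE2 linear_iso) auto
    then obtain w where "E (x, u) (0, w) = g (x, u) - y"
      by (metis surjE)
    then have "(g (x, u) - y) \<bullet> (g (x, u) - y) + (g (x, u) - y) \<bullet> (g (x, u) - y) = 0"
      using crit[of w] by simp
    then have "g (x, u) = y" by simp
    then show ?thesis using u(1) xy(1) by auto
  qed
  then obtain V where V: "\<And>z. z \<in> W \<Longrightarrow> norm (V z) \<le> r" "\<And>z. z \<in> W \<Longrightarrow> g (fst z, V z) = snd z"
    by metis
  have Wr: "norm (f (fst z)) < r" if "z \<in> W" for z using that \<delta>(2) by (auto simp: W_def)
  have V0: "V (x, f x) = 0" if "norm (f x) < \<delta>" for x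
  proof -
    have "(x, f x) \<in> W" using that by (auto simp: W_def)
    then have "\<nu> * (norm (V (x, f x)))\<^sup>2 \<le> 0"
      using mono[of x "V (x, f x)" 0] Wr V r by (force simp: g0)
    then show ?thesis using \<nu>(1) by (simp add: mult_le_0_iff)
  qed
  have contV: "isCont V z0" if z0: "z0 \<in> W" for z0
  proof -
    \<comment> \<open>Strong monotonicity bounds the variation of the solution by a residual that is
      continuous in \<open>z\<close> and vanishes at \<open>z0\<close>.\<close>
    have bound: "norm (V z - V z0) \<le> norm (snd z - g (fst z, V z0)) / \<nu>" if z: "z \<in> W" for z
    proof (cases "V z = V z0")
      case False
      have "\<nu> * (norm (V z - V z0))\<^sup>2 \<le> (snd z - g (fst z, V z0)) \<bullet> (V z - V z0)"
        using mono[of "fst z" "V z" "V z0"] Wr[OF z] V(1)[OF z] V(1)[OF z0] V(2)[OF z] by simp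
      also have "\<dots> \<le> norm (snd z - g (fst z, V z0)) * norm (V z - V z0)"
        by (rule norm_cauchy_schwarz)
      finally show ?thesis
        using False \<nu>(1) by (simp add: power2_eq_square field_simps)
    qed (use \<nu>(1) in simp)
    have "continuous_on UNIV (\<lambda>z. norm (snd z - g (fst z, V z0)) / \<nu>)"
      using \<nu>(1) by (intro continuous_intros continuous_on_compose2[OF smooth_on_continuous[OF smg]]) auto
    then have "isCont (\<lambda>z. norm (snd z - g (fst z, V z0)) / \<nu>) z0"
      using continuous_on_eq_continuous_at[OF open_UNIV] by blast
    then have "((\<lambda>z. norm (snd z - g (fst z, V z0)) / \<nu>) \<longlongrightarrow> 0) (at z0)"
      using V(2)[OF z0] by (auto simp: isCont_def)
    moreover have "\<forall>\<^sub>F z in at z0. norm (V z - V z0) \<le> norm (snd z - g (fst z, V z0)) / \<nu>"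
      using bound z0 \<open>open W\<close> by (auto simp: eventually_at_topological)
    ultimately have "((\<lambda>z. V z - V z0) \<longlongrightarrow> 0) (at z0)"
      by (rule Lim_null_comparison[rotated])
    then show ?thesis
      unfolding isCont_def by (subst Lim_null)
  qed
  define M where "M z = matrix (\<lambda>w. E z (0, w))" for z
  have M: "M z *v w = E z (0, w)" for z w
    unfolding M_def using matrix_vector_mul(2)[OF linE2] by metis
  \<comment> \<open>Cramer's rule for the implicit derivative. It exhibits the derivative of
    \<open>V\<close> as a smooth function of \<open>(fst z, V z)\<close>, so that each order of
    differentiability of \<open>V\<close> yields the next.\<close>
  define R where "R v z = (\<chi> k. det (\<chi> i j. if j = k then (snd v - E z (fst v, 0)) $ i else M z $ i $ j) * inverse (det (M z)))"
    for v z
  define O' where "O' = {z. det (M z) \<noteq> 0}"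
  have smM: "smooth_on UNIV (\<lambda>z. M z $ i $ j)" for i j
    unfolding M_def matrix_def using smE by (auto intro!: smooth_on_vec_nth)
  have "open O'"
    unfolding O'_def
    by (intro open_Collect_neq continuous_on_const smooth_on_continuous[OF smooth_on_det] smM open_UNIV)
  have smR: "smooth_on O' (R v)" for v
  proof -
    have "smooth_on O' (\<lambda>z. if j = k then (snd v - E z (fst v, 0)) $ i else M z $ i $ j)" for i j k
      using smooth_on_subset[OF smM] smooth_on_subset[OF smE]
      by (cases "j = k") (auto intro!: smooth_on_vec_nth smooth_on_diff smooth_on_const \<open>open O'\<close>)
    then show ?thesis
      unfolding R_def[abs_def]
      by (intro smooth_on_vec_lambda smooth_on_mult smooth_on_det smooth_on_inverse \<open>open O'\<close>
          smooth_on_subset[OF smM]) (auto simp: O'_def)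
  qed
  have inO: "(fst z, V z) \<in> O'" if "z \<in> W" for z
  proof -
    have "inj (\<lambda>w. M (fst z, V z) *v w)"
      using linear_iso[of "fst z" "V z"] Wr[OF that] V(1)[OF that] by (simp add: M)
    then have "invertible (M (fst z, V z))"
      by (metis matrix_left_invertible_injective invertible_left_inverse)
    then show ?thesis by (simp add: O'_def invertible_det_nz)
  qed
  have dV: "(V has_derivative (\<lambda>v. R v (fst z, V z))) (at z)" if z: "z \<in> W" for z
  proof -
    let ?z = "(fst z, V z)"
    \<comment> \<open>The map \<open>z \<mapsto> (fst z, V z)\<close> is a continuous right inverse
      of \<open>\<Theta>\<close>, so it is differentiable wherever the derivative of
      \<open>\<Theta>\<close> is invertible.\<close>
    define \<Theta> where "\<Theta> p = (fst p, g p)" for p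
    have d\<Theta>: "(\<Theta> has_derivative (\<lambda>v. (fst v, E ?z v))) (at ?z)"
      unfolding \<Theta>_def using Eg by (auto intro!: derivative_eq_intros)
    have Esplit: "E ?z v = E ?z (fst v, 0) + E ?z (0, snd v)" for v
      using linear_add[OF linE, of ?z "(fst v, 0)" "(0, snd v)"] by simp
    obtain B where B: "linear B" "B \<circ> (\<lambda>w. E ?z (0, w)) = id"
      using linear_injective_left_inverse[OF linE2 linear_iso] Wr[OF z] V(1)[OF z] by metis
    have B': "E ?z (0, B y) = y" for y
    proof -
      obtain w where "y = E ?z (0, w)"
        using linear_injective_imp_surjective[OF linE2 linear_iso[OF Wr[OF z] V(1)[OF z]]] by (metis surjE)
      moreover from this have "B y = w" using B(2) by (metis comp_apply id_apply)
      ultimately show ?thesis by simp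
    qed
    define G' where "G' v = (fst v, B (snd v - E ?z (fst v, 0)))" for v
    have "linear G'"
    proof -
      have "linear (\<lambda>v. snd v - E ?z (fst v, 0))"
        using linear_add[OF linE, of ?z "(_, 0)" "(_, 0)"] linear_cmul[OF linE, of ?z _ "(_, 0)"]
        by (auto intro!: linearI simp: algebra_simps)
      from linear_compose[OF this B(1)] have l: "linear (\<lambda>v. B (snd v - E ?z (fst v, 0)))"
        by (simp add: o_def)
      show ?thesis
        unfolding G'_def by (rule linearI) (use linear_add[OF l] linear_cmul[OF l] in simp_all)
    qed
    moreover have "G' \<circ> (\<lambda>v. (fst v, E ?z v)) = id"
    proof
      fix v
      have "E ?z v - E ?z (fst v, 0) = E ?z (0, snd v)" using Esplit[of v] by simp
      then show "(G' \<circ> (\<lambda>v. (fst v, E ?z v))) v = id v"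
        using fun_cong[OF B(2), of "snd v"] by (simp add: G'_def)
    qed
    ultimately have "((\<lambda>z. (fst z, V z)) has_derivative G') (at z)"
      using z contV[OF z] V(2) \<open>open W\<close> d\<Theta>
      by (intro has_derivative_inverse_basic[where f = \<Theta> and T = W and g = "\<lambda>z. (fst z, V z)" and y = z
          and f' = "\<lambda>v. (fst v, E ?z v)"])
        (auto simp: linear_conv_bounded_linear \<Theta>_def intro!: continuous_intros)
    from has_derivative_snd[OF this] have "(V has_derivative (\<lambda>v. snd (G' v))) (at z)" by simp
    moreover have "snd (G' v) = R v ?z" for v
    proof -
      have "M ?z *v snd (G' v) = snd v - E ?z (fst v, 0)"
        by (simp add: M G'_def B')
      then show ?thesis
        using cramer[of "M ?z"] inO[OF z] by (simp add: R_def O'_def divide_inverse)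
    qed
    ultimately show ?thesis by simp
  qed
  have "Ck_on k W V" for k
  proof (induction k)
    case 0
    show ?case using contV by (simp add: continuous_at_imp_continuous_on)
  next
    case (Suc k)
    have "Ck_on k O' (R v)" for v
      using smR by (simp add: smooth_on_def)
    moreover have "Ck_on k W (\<lambda>z. (fst z, V z))"
      using smooth_on_fst[OF \<open>open W\<close> smooth_on_id] unfolding smooth_on_def
      by (intro Ck_on_Pair \<open>open W\<close> Suc) blast
    moreover have "(\<lambda>z. (fst z, V z)) ` W \<subseteq> O'" using inO by blast
    ultimately have "Ck_on k W (\<lambda>z. R v (fst z, V z))" for v
      using Ck_on_compose[OF \<open>open W\<close> \<open>open O'\<close>, of "\<lambda>z. (fst z, V z)" k "R v"] by blast
    from Ck_onI[OF \<open>open W\<close> dV this] show ?case by blast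
  qed
  then have smV: "smooth_on W V" by (simp add: smooth_on_def)
  show thesis
  proof (rule that[of \<delta> "\<lambda>z. fst z + T (fst z) (V z)"])
    show "smooth_on {(x, y). norm (f x) < \<delta> \<and> norm y < \<delta>} (\<lambda>z. fst z + T (fst z) (V z))"
      unfolding W_def[symmetric]
      by (intro smooth_on_add smT smV smooth_on_fst smooth_on_id \<open>open W\<close>)
  next
    fix x y assume "norm (f x) < \<delta>" "norm (y::real^'q) < \<delta>"
    then have "(x, y) \<in> W" by (simp add: W_def)
    from V(2)[OF this] show "f (fst (x, y) + T (fst (x, y)) (V (x, y))) = y"
      by (simp add: g_def)
  qed (use \<delta> r V0 T0 in auto)
qed

section \<open>Separating shears\<close>

lemma smooth_on_polynomial_function:
  fixes f :: "'a::euclidean_space \<Rightarrow> real"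
  assumes "polynomial_function f"
  shows "smooth_on UNIV f"
proof -
  have "real_polynomial_function f" using assms by (simp add: real_polynomial_function_eq)
  then show ?thesis
  proof (induction rule: real_polynomial_function.induct)
    case (linear f)
    then show ?case by (simp add: smooth_on_linear bounded_linear.linear)
  next
    case (const c)
    show ?case by (rule smooth_on_const)
  next
    case (add f g)
    then show ?case by (intro smooth_on_add open_UNIV)
  next
    case (mult f g)
    then show ?case by (intro smooth_on_mult open_UNIV)
  qed
qed

text \<open>A polynomial within 1/4 of the prescribed integers is rounded by a sum of steps: where
  \<open>\<bar>g y - n i\<bar> < 1/3\<close>, each \<open>3 * (g y - k)\<close> is at least 2 or at
  most 1, outside the transition of \<open>smooth_step\<close>. The rounding is what makes \<phi>
  constant on whole neighbourhoods.\<close>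

lemma smooth_locally_constant_extension:
  fixes C :: "'i \<Rightarrow> 'a::euclidean_space set" and n :: "'i \<Rightarrow> nat"
  assumes I: "finite I" and C: "\<And>i. i \<in> I \<Longrightarrow> compact (C i)"
    and disj: "\<And>i j. i \<in> I \<Longrightarrow> j \<in> I \<Longrightarrow> i \<noteq> j \<Longrightarrow> C i \<inter> C j = {}"
    and n: "\<And>i. i \<in> I \<Longrightarrow> n i \<le> L"
  obtains \<phi> :: "'a \<Rightarrow> real" where "smooth_on UNIV \<phi>" "\<And>x. 0 \<le> \<phi> x \<and> \<phi> x \<le> L"
    "\<And>i x. i \<in> I \<Longrightarrow> x \<in> C i \<Longrightarrow> \<exists>V. open V \<and> x \<in> V \<and> (\<forall>y\<in>V. \<phi> y = n i)"
proof -
  define f where "f x = real (n (SOME i. i \<in> I \<and> x \<in> C i))" for x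
  have f: "f x = n i" if "i \<in> I" "x \<in> C i" for i x
  proof -
    have "(SOME i. i \<in> I \<and> x \<in> C i) = i"
      by (rule some_equality) (use that disj in blast)+
    then show ?thesis by (simp add: f_def)
  qed
  have "continuous_on (C i) f" if "i \<in> I" for i
    using continuous_on_eq[OF continuous_on_const[of "C i" "real (n i)"]] f that by metis
  then have "continuous_on (\<Union>i\<in>I. C i) f"
    using I C by (intro continuous_on_closed_Union compact_imp_closed)
  moreover have "compact (\<Union>i\<in>I. C i)" using I C by (rule compact_UN)
  ultimately obtain g where g: "polynomial_function g" "\<And>x. x \<in> (\<Union>i\<in>I. C i) \<Longrightarrow> norm (f x - g x) < 1/4"
    using Stone_Weierstrass_polynomial_function[of "\<Union>i\<in>I. C i" f "1/4"] by auto
  have smg: "smooth_on UNIV g" using g(1) by (rule smooth_on_polynomial_function)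
  define \<phi> where "\<phi> x = (\<Sum>k<L. smooth_step (3 * (g x - real k)))" for x
  show thesis
  proof (rule that[of \<phi>])
    show "smooth_on UNIV \<phi>"
      unfolding \<phi>_def
      by (intro smooth_on_sum smooth_on_compose_UNIV[OF _ smooth_on_smooth_step] smooth_on_mult
          smooth_on_diff smooth_on_const smg open_UNIV)
    show "0 \<le> \<phi> x \<and> \<phi> x \<le> L" for x
      using sum_bounded_above[of "{..<L}" "\<lambda>k. smooth_step (3 * (g x - real k))" 1] smooth_step_le_1
      by (auto simp: \<phi>_def intro!: sum_nonneg smooth_step_nonneg)
    fix i x assume i: "i \<in> I" and x: "x \<in> C i"
    let ?V = "{y. \<bar>g y - n i\<bar> < 1/3}"
    have "\<phi> y = n i" if "y \<in> ?V" for y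
    proof -
      have v: "g y > real (n i) - 1/3" "g y < real (n i) + 1/3"
        using CollectD[OF that] unfolding abs_diff_less_iff by argo+
      have "smooth_step (3 * (g y - real k)) = (if k < n i then 1 else 0)" for k
      proof (cases "k < n i")
        case True
        then have "real k + 1 \<le> n i" by linarith
        then have "2 \<le> 3 * (g y - k)" using v by argo
        then show ?thesis using True smooth_step_eq_1 by presburger
      next
        case False
        then have "real (n i) \<le> k" by linarith
        then have "3 * (g y - k) \<le> 1" using v by argo
        then show ?thesis using False smooth_step_eq_0 by presburger
      qed
      then have "\<phi> y = (\<Sum>k<L. if k < n i then 1 else 0)" by (simp add: \<phi>_def)
      also have "\<dots> = real (card {k. k < L \<and> k < n i})" by (simp add: sum.If_cases Int_def)
      also have "{k. k < L \<and> k < n i} = {..<n i}" using n[OF i] by auto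
      finally show ?thesis by simp
    qed
    moreover have "open ?V"
      by (intro open_Collect_less continuous_intros smooth_on_continuous[OF smg])
    moreover have "x \<in> ?V"
    proof -
      have "\<bar>real (n i) - g x\<bar> < 1/4" using g(2)[of x] f[OF i x] i x by force
      then show ?thesis unfolding mem_Collect_eq abs_diff_less_iff by argo
    qed
    ultimately show "\<exists>V. open V \<and> x \<in> V \<and> (\<forall>y\<in>V. \<phi> y = n i)" by blast
  qed
qed

text \<open>Each coordinate is handled by one shear in that direction; the sets stay separated for the next
  direction because sets that have already been moved apart differ by at least \<open>4\<close> in some other
  coordinate.\<close>

lemma separating_shears:
  fixes T :: "'i \<Rightarrow> (real^'p) set" and n :: "'i \<Rightarrow> 'p \<Rightarrow> nat"
  assumes I: "finite I" and T: "\<And>i. i \<in> I \<Longrightarrow> compact (T i)" "\<And>i. i \<in> I \<Longrightarrow> T i \<subseteq> cball 0 1"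
    and disj: "\<And>i j x s a. \<lbrakk>i \<in> I; j \<in> I; i \<noteq> j; x \<in> T i; x + s *\<^sub>R axis a 1 \<in> T j\<rbrakk> \<Longrightarrow> False"
    and n: "\<And>i a. i \<in> I \<Longrightarrow> n i a \<le> L"
  shows "\<exists>\<Phi>. smooth_on UNIV \<Phi> \<and> (\<forall>x. norm (\<Phi> x - x) \<le> 4 * L * card A) \<and>
    (\<forall>i\<in>I. \<forall>x. \<Phi> x \<in> T i \<longrightarrow> (\<exists>V. open V \<and> x \<in> V \<and>
      (\<forall>y\<in>V. \<Phi> y = y - (\<chi> a. if a \<in> A then 4 * real (n i a) else 0))))"
  using finite[of A]
proof (induction A rule: finite_induct)
  case empty
  have "(\<chi> a. 0) = (0 :: real^'p)" by (simp add: vec_eq_iff)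
  then show ?case
    by (intro exI[of _ "\<lambda>x. x"]) (auto simp: smooth_on_id)
next
  case (insert a A)
  define w where "w A i = (\<chi> a. if a \<in> A then 4 * real (n i a) else 0)" for A i
  obtain \<Phi> where \<Phi>: "smooth_on UNIV \<Phi>" "\<And>x. norm (\<Phi> x - x) \<le> 4 * L * card A"
    "\<And>i x. i \<in> I \<Longrightarrow> \<Phi> x \<in> T i \<Longrightarrow> \<exists>V. open V \<and> x \<in> V \<and> (\<forall>y\<in>V. \<Phi> y = y - w A i)"
    using insert.IH unfolding w_def by blast
  define \<pi> where "\<pi> x = x - (x $ a) *\<^sub>R axis a 1" for x :: "real^'p"
  have \<pi>_nth: "\<pi> x $ b = (if b = a then 0 else x $ b)" for x b by (simp add: \<pi>_def axis_def)
  have lin: "linear \<pi>" by (rule linearI) (auto simp: \<pi>_def scaleR_left_distrib algebra_simps)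
  have sm\<pi>: "smooth_on UNIV \<pi>" using lin by (rule smooth_on_linear)
  have cont\<pi>: "continuous_on UNIV \<pi>" using sm\<pi> by (rule smooth_on_continuous)
  \<comment> \<open>The shadow along direction \<open>a\<close> of \<open>T i\<close> at its current
    position. Once the shadows are disjoint, a function of the remaining coordinates can tell the
    sets apart.\<close>
  define C where "C i = \<pi> ` ((+) (w A i) ` T i)" for i
  have disjC: "C i \<inter> C j = {}" if ij: "i \<in> I" "j \<in> I" "i \<noteq> j" for i j
  proof (rule ccontr)
    assume "C i \<inter> C j \<noteq> {}"
    then obtain y y' where y: "y \<in> T i" "y' \<in> T j" "\<pi> (w A i + y) = \<pi> (w A j + y')"
      by (auto simp: C_def)
    have eq: "w A i $ b + y $ b = w A j $ b + y' $ b" if "b \<noteq> a" for b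
      using arg_cong[OF y(3), of "\<lambda>v. v $ b"] that by (simp add: \<pi>_nth)
    show False
    proof (cases "w A i = w A j")
      case True
      then have "y' = y + (y' $ a - y $ a) *\<^sub>R axis a 1"
        using eq by (auto simp: vec_eq_iff axis_def)
      then show False using disj[OF ij y(1)] y(2) by metis
    next
      case False
      then obtain b where b: "b \<in> A" "n i b \<noteq> n j b" by (auto simp: w_def vec_eq_iff split: if_splits)
      then have "b \<noteq> a" using insert.hyps(2) by blast
      from eq[OF this] b(1) have "4 * (real (n i b) - real (n j b)) = y' $ b - y $ b"
        by (simp add: w_def algebra_simps)
      moreover have "\<bar>y $ b\<bar> \<le> 1" "\<bar>y' $ b\<bar> \<le> 1"
        using T(2)[OF ij(1)] T(2)[OF ij(2)] y(1,2) component_le_norm_cart[of y b] component_le_norm_cart[of y' b]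
        by fastforce+
      moreover have "\<bar>real (n i b) - real (n j b)\<bar> \<ge> 1" using b(2) by linarith
      ultimately show False by (smt (verit))
    qed
  qed
  have compC: "compact (C i)" if "i \<in> I" for i
    unfolding C_def using T(1)[OF that] continuous_on_subset[OF cont\<pi>]
    by (intro compact_continuous_image compact_translation) auto
  obtain \<phi> :: "real^'p \<Rightarrow> real" where \<phi>: "smooth_on UNIV \<phi>" "\<And>x. 0 \<le> \<phi> x \<and> \<phi> x \<le> L"
    "\<And>i x. i \<in> I \<Longrightarrow> x \<in> C i \<Longrightarrow> \<exists>V. open V \<and> x \<in> V \<and> (\<forall>y\<in>V. \<phi> y = n i a)"
    by (rule smooth_locally_constant_extension[of I C "\<lambda>i. n i a" L]) (use I compC disjC n in blast)+
  \<comment> \<open>\<open>\<Phi>\<close> carries the displaced copies back to the sets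
    \<open>T i\<close>; hence the new shear subtracts and is composed on the inside. It leaves
    \<open>\<pi> x\<close>, on which its amount depends, unchanged.\<close>
  define S where "S x = x - (4 * \<phi> (\<pi> x)) *\<^sub>R axis a 1" for x
  have smS: "smooth_on UNIV S"
    unfolding S_def[abs_def]
    by (intro smooth_on_diff smooth_on_scaleR smooth_on_mult smooth_on_const smooth_on_id
        smooth_on_compose_UNIV[OF _ \<phi>(1)] sm\<pi> open_UNIV)
  have \<pi>S: "\<pi> (S x) = \<pi> x" for x
    by (auto simp: vec_eq_iff \<pi>_nth S_def axis_def)
  show ?case
  proof (intro exI[of _ "\<lambda>x. \<Phi> (S x)"] conjI allI ballI impI)
    show "smooth_on UNIV (\<lambda>x. \<Phi> (S x))"
      by (rule smooth_on_compose_UNIV[OF open_UNIV \<Phi>(1) smS])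
  next
    fix x
    have "norm (\<Phi> (S x) - x) \<le> norm (\<Phi> (S x) - S x) + norm (S x - x)"
      using norm_triangle_ineq[of "\<Phi> (S x) - S x" "S x - x"] by simp
    also have "\<dots> \<le> real (4 * L * card A) + 4 * real L"
      using \<phi>(2)[of "\<pi> x"] by (intro add_mono \<Phi>(2)) (simp add: S_def)
    finally show "norm (\<Phi> (S x) - x) \<le> 4 * L * card (insert a A)"
      using insert.hyps by (simp add: algebra_simps)
  next
    fix i x assume i: "i \<in> I" and "\<Phi> (S x) \<in> T i"
    obtain V where V: "open V" "S x \<in> V" "\<And>y. y \<in> V \<Longrightarrow> \<Phi> y = y - w A i"
      using \<Phi>(3)[OF i \<open>\<Phi> (S x) \<in> T i\<close>] by metis
    have "S x - w A i \<in> T i" using V(2,3) \<open>\<Phi> (S x) \<in> T i\<close> by metis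
    then have "\<pi> (w A i + (S x - w A i)) \<in> C i" unfolding C_def by blast
    then have \<pi>x: "\<pi> x \<in> C i" by (simp add: \<pi>S)
    obtain V' where V': "open V'" "\<pi> x \<in> V'" "\<And>y. y \<in> V' \<Longrightarrow> \<phi> y = n i a"
      using \<phi>(3)[OF i \<pi>x] by metis
    have "open (S -` V)" "open (\<pi> -` V')"
      using V(1) V'(1) smooth_on_continuous[OF smS] cont\<pi> by (simp_all add: open_vimage)
    moreover have "\<Phi> (S y) = y - (\<chi> b. if b \<in> insert a A then 4 * real (n i b) else 0)"
      if "y \<in> S -` V \<inter> \<pi> -` V'" for y
    proof -
      have "\<Phi> (S y) = S y - w A i" using that V(3) by blast
      also have "\<dots> = y - (\<chi> b. if b \<in> insert a A then 4 * real (n i b) else 0)"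
        using that V'(3)[of "\<pi> y"] insert.hyps(2) by (auto simp: S_def w_def vec_eq_iff axis_def)
      finally show ?thesis .
    qed
    ultimately show "\<exists>V. open V \<and> x \<in> V \<and>
        (\<forall>y\<in>V. \<Phi> (S y) = y - (\<chi> b. if b \<in> insert a A then 4 * real (n i b) else 0))"
      using V(2) V'(2) by (intro exI[of _ "S -` V \<inter> \<pi> -` V'"]) auto
  qed
qed

section \<open>Staircases\<close>

definition smooth_step' :: "real \<Rightarrow> real" where
  "smooth_step' t = frechet_derivative smooth_step (at t) 1"

lemma smooth_step_DERIV: "(smooth_step has_real_derivative smooth_step' t) (at t)"
proof -
  have d: "(smooth_step has_derivative frechet_derivative smooth_step (at t)) (at t)"
    using smooth_on_has_derivative[OF smooth_on_smooth_step] by blast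
  have "frechet_derivative smooth_step (at t) = (*) (smooth_step' t)"
  proof
    fix x :: real
    show "frechet_derivative smooth_step (at t) x = smooth_step' t * x"
      using linear_cmul[OF has_derivative_linear[OF d], of x 1] by (simp add: smooth_step'_def)
  qed
  then show ?thesis using d by (simp add: has_field_derivative_def)
qed

lemma smooth_step'_eq_0:
  assumes "t < 1 \<or> 2 < t"
  shows "smooth_step' t = 0"
proof -
  define S where "S = (if t < 1 then {..<1} else {2<..} :: real set)"
  define c where "c = (if t < 1 then 0 else 1 :: real)"
  have "((\<lambda>_. c) has_real_derivative 0) (at t)" by simp
  then have "(smooth_step has_real_derivative 0) (at t)"
    by (rule has_field_derivative_transform_within_open[where S = S])
      (use assms in \<open>auto simp: S_def c_def smooth_step_eq_0 smooth_step_eq_1 split: if_splits\<close>)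
  then show ?thesis using DERIV_unique smooth_step_DERIV by blast
qed

lemma smooth_step'_bounded: obtains C where "C > 0" "\<And>t. \<bar>smooth_step' t\<bar> \<le> C"
proof -
  have "continuous_on {1..2} smooth_step'"
    unfolding smooth_step'_def[abs_def]
    by (rule continuous_on_subset[OF smooth_on_continuous[OF smooth_on_derivative[OF smooth_on_smooth_step]]]) auto
  then have "bounded (smooth_step' ` {1..2})"
    by (intro compact_imp_bounded compact_continuous_image) auto
  then obtain C where C: "C > 0" "\<And>t. t \<in> {1..2} \<Longrightarrow> \<bar>smooth_step' t\<bar> \<le> C"
    by (auto simp: bounded_pos)
  have "\<bar>smooth_step' t\<bar> \<le> C" for t
    using C smooth_step'_eq_0[of t] by (cases "t \<in> {1..2}") auto
  then show thesis using C(1) that by blast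
qed

text \<open>A staircase approximating the identity, with steps of height \<open>h\<close> located within \<open>\<sigma>\<close> of the
  points of \<open>h\<int>\<close>.\<close>

definition stair :: "real \<Rightarrow> real \<Rightarrow> nat \<Rightarrow> real \<Rightarrow> real" where
  "stair h \<sigma> M t = h * ((\<Sum>j\<in>{- int M..int M}. smooth_step ((t - h * real_of_int j) / \<sigma> + 3/2)) - real M - 1/2)"

definition stair' :: "real \<Rightarrow> real \<Rightarrow> nat \<Rightarrow> real \<Rightarrow> real" where
  "stair' h \<sigma> M t = h / \<sigma> * (\<Sum>j\<in>{- int M..int M}. smooth_step' ((t - h * real_of_int j) / \<sigma> + 3/2))"

lemma smooth_on_stair: "smooth_on UNIV (stair h \<sigma> M)"
  unfolding stair_def[abs_def] divide_inverse
  by (intro smooth_on_mult smooth_on_diff smooth_on_sum smooth_on_add smooth_on_id smooth_on_const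
      smooth_on_compose_UNIV[OF _ smooth_on_smooth_step] open_UNIV)

lemma stair_DERIV:
  assumes "\<sigma> \<noteq> 0"
  shows "(stair h \<sigma> M has_real_derivative stair' h \<sigma> M t) (at t)"
proof -
  have "((\<lambda>t. smooth_step ((t - h * real_of_int j) / \<sigma> + 3/2)) has_real_derivative
      smooth_step' ((t - h * real_of_int j) / \<sigma> + 3/2) * (1 / \<sigma>)) (at t)" for j :: int
    by (rule DERIV_chain2[OF smooth_step_DERIV]) (use assms in \<open>auto intro!: derivative_eq_intros\<close>)
  then have "(stair h \<sigma> M has_real_derivative
      h * ((\<Sum>j\<in>{- int M..int M}. smooth_step' ((t - h * real_of_int j) / \<sigma> + 3/2) * (1 / \<sigma>)) - 0 - 0)) (at t)"
    unfolding stair_def[abs_def]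
    by (intro DERIV_cmult DERIV_diff DERIV_sum DERIV_const)
  then show ?thesis
    by (simp add: stair'_def sum_divide_distrib[symmetric])
qed

text \<open>Let \<open>i\<close> be the integer nearest to \<open>t / h\<close>. Steps before
  \<open>i\<close> are complete and steps after \<open>i\<close> have not begun, so both
  \<open>t\<close> and the value lie within \<open>h / 2\<close> of \<open>h * i\<close>. The shift
  by 3/2 centres each transition at its lattice point, and the bound on \<open>t\<close> ensures
  that step \<open>i\<close> occurs in the sum.\<close>

lemma stair_close:
  assumes "0 < h" "0 < \<sigma>" "\<sigma> \<le> h" "\<bar>t\<bar> \<le> h * M"
  shows "\<bar>stair h \<sigma> M t - t\<bar> \<le> h"
proof -
  define i where "i = \<lfloor>t / h + 1/2\<rfloor>"
  have i: "h * (real_of_int i - 1/2) \<le> t" "t \<le> h * (real_of_int i + 1/2)"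
  proof -
    have "of_int i \<le> t / h + 1/2" "t / h + 1/2 < of_int i + 1" unfolding i_def by linarith+
    then have "of_int i - 1/2 \<le> t / h" "t / h \<le> of_int i + 1/2" by linarith+
    then show "h * (real_of_int i - 1/2) \<le> t" "t \<le> h * (real_of_int i + 1/2)"
      using \<open>0 < h\<close> by (simp_all add: field_simps)
  qed
  have "\<bar>t / h\<bar> \<le> M" using assms by (simp add: field_simps)
  then have "- int M \<le> i" "i \<le> int M" unfolding i_def by linarith+
  have "smooth_step ((t - h * real_of_int j) / \<sigma> + 3/2) = (if j < i then 1 else 0)" if "j \<noteq> i" for j :: int
  proof (cases "j < i")
    case True
    then have "h * (real_of_int j + 1) \<le> h * real_of_int i" using \<open>0 < h\<close> by (intro mult_left_mono) auto
    then have "\<sigma> / 2 \<le> t - h * real_of_int j" using i(1) \<open>\<sigma> \<le> h\<close> by (simp add: algebra_simps)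
    then have "1/2 \<le> (t - h * real_of_int j) / \<sigma>" using \<open>0 < \<sigma>\<close> by (simp add: field_simps)
    then have "2 \<le> (t - h * real_of_int j) / \<sigma> + 3/2" by argo
    then show ?thesis using True smooth_step_eq_1 by presburger
  next
    case False
    then have "h * (real_of_int i + 1) \<le> h * real_of_int j" using \<open>0 < h\<close> that by (intro mult_left_mono) auto
    then have "t - h * real_of_int j \<le> - \<sigma> / 2" using i(2) \<open>\<sigma> \<le> h\<close> by (simp add: algebra_simps)
    then have "(t - h * real_of_int j) / \<sigma> \<le> - 1/2" using \<open>0 < \<sigma>\<close> by (simp add: field_simps)
    then have "(t - h * real_of_int j) / \<sigma> + 3/2 \<le> 1" by argo
    then show ?thesis using False smooth_step_eq_0 by presburger
  qed
  then have "(\<Sum>j\<in>{- int M..int M} - {i}. smooth_step ((t - h * real_of_int j) / \<sigma> + 3/2))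
      = (\<Sum>j\<in>{- int M..int M} - {i}. if j < i then 1 else 0)"
    by (intro sum.cong) auto
  also have "\<dots> = (\<Sum>j\<in>{- int M..<i}. 1 :: real)"
    by (rule sum.mono_neutral_cong_right) (use \<open>i \<le> int M\<close> in auto)
  also have "\<dots> = real_of_int i + M" using \<open>- int M \<le> i\<close> by simp
  finally have "stair h \<sigma> M t = h * (real_of_int i - 1/2 + smooth_step ((t - h * real_of_int i) / \<sigma> + 3/2))"
    using \<open>- int M \<le> i\<close> \<open>i \<le> int M\<close> by (simp add: stair_def sum.remove[of "{- int M..int M}" i])
  moreover have "0 \<le> h * smooth_step ((t - h * real_of_int i) / \<sigma> + 3/2)" "h * smooth_step ((t - h * real_of_int i) / \<sigma> + 3/2) \<le> h * 1"
    using smooth_step_nonneg smooth_step_le_1 \<open>0 < h\<close> by (auto intro!: mult_left_mono)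
  ultimately show ?thesis using i by (simp add: algebra_simps)
qed

lemma stair'_eq_0:
  assumes "0 < \<sigma>" "\<And>j :: int. \<bar>j\<bar> \<le> M \<Longrightarrow> \<sigma> \<le> \<bar>t - h * real_of_int j\<bar>"
  shows "stair' h \<sigma> M t = 0"
proof -
  have "smooth_step' ((t - h * real_of_int j) / \<sigma> + 3/2) = 0" if "j \<in> {- int M..int M}" for j
  proof -
    have "\<bar>(t - h * real_of_int j) / \<sigma>\<bar> \<ge> 1" using assms(2)[of j] that \<open>0 < \<sigma>\<close> by (simp add: abs_le_iff field_simps)
    then show ?thesis by (intro smooth_step'_eq_0) linarith
  qed
  then show ?thesis by (simp add: stair'_def)
qed

text \<open>The windows of radius \<sigma> around the points of the lattice are disjoint, so at most
  one summand is nonzero.\<close>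

lemma stair'_le:
  assumes C: "\<And>t. \<bar>smooth_step' t\<bar> \<le> C" and "0 < h" "0 < \<sigma>" "2 * \<sigma> \<le> h"
  shows "\<bar>stair' h \<sigma> M t\<bar> \<le> C * h / \<sigma>"
proof (cases "\<exists>i :: int. \<bar>i\<bar> \<le> M \<and> \<bar>t - h * real_of_int i\<bar> < \<sigma>")
  case True
  then obtain i :: int where i: "\<bar>i\<bar> \<le> M" "\<bar>t - h * real_of_int i\<bar> < \<sigma>" by blast
  have "smooth_step' ((t - h * real_of_int j) / \<sigma> + 3/2) = 0" if "j \<noteq> i" for j :: int
  proof -
    have "h * 1 \<le> h * \<bar>real_of_int i - j\<bar>" using \<open>0 < h\<close> that by (intro mult_left_mono) linarith+
    also have "\<dots> = \<bar>h * real_of_int i - h * real_of_int j\<bar>" using \<open>0 < h\<close> by (simp add: abs_mult right_diff_distrib[symmetric])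
    finally have "\<sigma> \<le> \<bar>t - h * real_of_int j\<bar>" using i(2) \<open>2 * \<sigma> \<le> h\<close> by linarith
    then have "\<bar>(t - h * real_of_int j) / \<sigma>\<bar> \<ge> 1" using \<open>0 < \<sigma>\<close> by (simp add: field_simps)
    then show ?thesis by (intro smooth_step'_eq_0) linarith
  qed
  then have "(\<Sum>j\<in>{- int M..int M}. smooth_step' ((t - h * real_of_int j) / \<sigma> + 3/2)) = smooth_step' ((t - h * real_of_int i) / \<sigma> + 3/2)"
    using i(1) by (subst sum.remove[of _ i]) auto
  then have "\<bar>stair' h \<sigma> M t\<bar> = h / \<sigma> * \<bar>smooth_step' ((t - h * real_of_int i) / \<sigma> + 3/2)\<bar>"
    using assms by (simp add: stair'_def abs_mult)
  also have "\<dots> \<le> h / \<sigma> * C" using assms by (intro mult_left_mono) auto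
  finally show ?thesis by (simp add: mult.commute)
next
  case False
  then have "stair' h \<sigma> M t = 0" using \<open>0 < \<sigma>\<close> by (intro stair'_eq_0) (auto simp: not_less)
  moreover have "C \<ge> 0" using C[of 0] by linarith
  ultimately show ?thesis using assms by simp
qed

section \<open>Coordinatewise staircases\<close>

definition lattice_stair :: "real \<Rightarrow> real \<Rightarrow> nat \<Rightarrow> real^'q \<Rightarrow> real^'q" where
  "lattice_stair h \<sigma> M y = (\<chi> a. stair h \<sigma> M (y $ a))"

lemma smooth_on_lattice_stair: "smooth_on UNIV (lattice_stair h \<sigma> M)"
  unfolding lattice_stair_def[abs_def]
  by (intro smooth_on_vec_lambda smooth_on_compose_UNIV[OF _ smooth_on_stair] smooth_on_vec_nth
      smooth_on_id open_UNIV)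

text \<open>The derivative is diagonal, so a single coordinate on a flat part of the staircase
  already destroys surjectivity.\<close>

lemma lattice_stair_has_derivative:
  fixes y :: "real^'q"
  assumes "\<sigma> \<noteq> 0"
  shows "(lattice_stair h \<sigma> M has_derivative (\<lambda>v. \<chi> a. stair' h \<sigma> M (y $ a) * v $ a)) (at y)"
proof -
  have "((\<lambda>y. stair h \<sigma> M (y $ a)) has_derivative (\<lambda>v. stair' h \<sigma> M (y $ a) * v $ a)) (at y)" for a :: 'q
    using has_derivative_compose[OF bounded_linear_imp_has_derivative[OF bounded_linear_vec_nth[of a]]
      stair_DERIV[OF assms, unfolded has_field_derivative_def]] .
  then show ?thesis
    unfolding lattice_stair_def[abs_def]
    by (subst has_derivative_componentwise_within) (auto simp: Basis_vec_def inner_axis)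
qed

lemma lattice_stair_close:
  fixes y :: "real^'q" and h :: real
  assumes "0 < h" "0 < \<sigma>" "\<sigma> \<le> h" "norm y \<le> h * M"
  shows "norm (lattice_stair h \<sigma> M y - y) \<le> CARD('q) * h"
proof -
  have "norm (lattice_stair h \<sigma> M y - y) \<le> (\<Sum>a\<in>UNIV. \<bar>(lattice_stair h \<sigma> M y - y) $ a\<bar>)"
    by (rule norm_le_l1_cart)
  also have "\<dots> \<le> (\<Sum>a\<in>(UNIV :: 'q set). h)"
  proof (rule sum_mono)
    fix a :: 'q
    have "\<bar>y $ a\<bar> \<le> h * M" using component_le_norm_cart[of y a] assms(4) by linarith
    then show "\<bar>(lattice_stair h \<sigma> M y - y) $ a\<bar> \<le> h"
      using stair_close[OF assms(1-3)] by (simp add: lattice_stair_def)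
  qed
  finally show ?thesis by simp
qed

section \<open>Generic extensions, pushes and squeezes\<close>

lemma smooth_on_radial:
  fixes G :: "'a::euclidean_space \<Rightarrow> 'b::euclidean_space"
  assumes G: "smooth_map_on (sphere 0 1) G"
  shows "smooth_on (- {0}) (\<lambda>x. G (inverse (norm x) *\<^sub>R x))"
proof (rule smooth_on_local)
  fix x :: 'a assume "x \<in> - {0}"
  then have x: "x \<noteq> 0" by simp
  define r where "r x = inverse (norm x) *\<^sub>R x" for x :: 'a
  have smr: "smooth_on (- {0}) r"
    unfolding r_def[abs_def]
    by (intro smooth_on_scaleR smooth_on_inverse smooth_on_norm smooth_on_id open_Compl closed_singleton) auto
  have "r x \<in> sphere 0 1" using x by (simp add: r_def)
  then obtain U g where U: "open U" "r x \<in> U" "smooth_on U g" "\<And>y. y \<in> sphere 0 1 \<inter> U \<Longrightarrow> g y = G y"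
    using G unfolding smooth_map_on_def smooth_on_def by metis
  define V where "V = (- {0}) \<inter> r -` U"
  have "open V"
    unfolding V_def using smooth_on_continuous[OF smr] U(1) by (intro continuous_open_preimage) auto
  moreover have "x \<in> V" using x U(2) by (simp add: V_def)
  moreover have "smooth_on V (\<lambda>x. g (r x))"
    by (rule smooth_on_compose[OF \<open>open V\<close> U(1) _ U(3) smooth_on_subset[OF smr]]) (auto simp: V_def)
  then have "smooth_on V (\<lambda>x. G (inverse (norm x) *\<^sub>R x))"
  proof (rule smooth_on_cong[OF \<open>open V\<close>, THEN iffD1, rotated])
    fix y assume y: "y \<in> V"
    then have "r y \<in> sphere 0 1 \<inter> U" by (auto simp: V_def r_def)
    then show "g (r y) = G (inverse (norm y) *\<^sub>R y)" using U(4) by (simp add: r_def)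
  qed
  ultimately show "\<exists>V. open V \<and> x \<in> V \<and> smooth_on V (\<lambda>x. G (inverse (norm x) *\<^sub>R x))" by blast
qed

lemma smooth_on_power2_norm: "open U \<Longrightarrow> smooth_on U f \<Longrightarrow> smooth_on U (\<lambda>x. (norm (f x))\<^sup>2)"
  unfolding power2_norm_eq_inner by (rule smooth_on_inner)

lemma smooth_on_smooth_step_compose:
  "open U \<Longrightarrow> smooth_on U f \<Longrightarrow> smooth_on U (\<lambda>x. smooth_step (f x))"
  by (rule smooth_on_compose_UNIV[OF _ smooth_on_smooth_step])

lemma smooth_on_glue:
  assumes "open U" "open V" "smooth_on U f" "smooth_on V g" "\<And>x. x \<in> U \<Longrightarrow> h x = f x" "\<And>x. x \<in> V \<Longrightarrow> h x = g x"
    "W \<subseteq> U \<union> V"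
  shows "smooth_on W h"
proof (rule smooth_on_local)
  fix x assume "x \<in> W"
  have "smooth_on U h" "smooth_on V h"
    using smooth_on_cong[OF assms(1), of h f] smooth_on_cong[OF assms(2), of h g] assms by auto
  then show "\<exists>V. open V \<and> x \<in> V \<and> smooth_on V h"
    using assms \<open>x \<in> W\<close> by blast
qed

lemma smooth_on_cutoff_radial:
  fixes g :: "'a::euclidean_space \<Rightarrow> 'b::euclidean_space"
  assumes g: "smooth_on (- {0}) g" and c: "c > 0"
  shows "smooth_on UNIV (\<lambda>x. smooth_step ((norm x)\<^sup>2 / c\<^sup>2) *\<^sub>R g x)"
proof (rule smooth_on_glue[where U = "ball 0 c" and V = "- {0}" and f = "\<lambda>x. 0"])
  show "smooth_on (- {0}) (\<lambda>x. smooth_step ((norm x)\<^sup>2 / c\<^sup>2) *\<^sub>R g x)"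
    unfolding divide_inverse
    by (intro smooth_on_scaleR smooth_on_smooth_step_compose smooth_on_mult smooth_on_power2_norm
        smooth_on_id smooth_on_const g open_Compl closed_singleton)
  fix x :: 'a assume "x \<in> ball 0 c"
  then have "(norm x)\<^sup>2 \<le> c\<^sup>2" by (intro power_mono) auto
  then have "(norm x)\<^sup>2 / c\<^sup>2 \<le> 1" using c by (simp add: divide_le_eq_1)
  then show "smooth_step ((norm x)\<^sup>2 / c\<^sup>2) *\<^sub>R g x = 0" by (simp add: smooth_step_eq_0)
qed (use c in \<open>auto intro: smooth_on_const\<close>)

section \<open>Generic extension of a map given away from the origin\<close>

lemma countable_rational_vectors: "countable {y :: real^'q. \<forall>a. y $ a \<in> \<rat>}"
proof -
  have "countable (PiE (UNIV :: 'q set) (\<lambda>_. \<rat> :: real set))"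
    by (intro countable_PiE) (auto simp: countable_rat)
  then have "countable (vec_lambda ` (PiE (UNIV :: 'q set) (\<lambda>_. \<rat> :: real set)))"
    by (rule countable_image)
  moreover have "{y :: real^'q. \<forall>a. y $ a \<in> \<rat>} \<subseteq> vec_lambda ` (PiE UNIV (\<lambda>_. \<rat>))"
  proof
    fix y :: "real^'q" assume "y \<in> {y. \<forall>a. y $ a \<in> \<rat>}"
    then show "y \<in> vec_lambda ` (PiE UNIV (\<lambda>_. \<rat>))"
      by (intro image_eqI[of _ _ "vec_nth y"]) auto
  qed
  ultimately show ?thesis by (rule countable_subset[rotated])
qed

text \<open>The last condition concerns all rational values because the lattice is chosen only after \<open>f\<close>.\<close>

definition generic_map :: "(real^'p \<Rightarrow> real^'q) \<Rightarrow> bool" where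
  "generic_map f \<longleftrightarrow> smooth_on UNIV f \<and> (\<forall>x. norm (f x) \<le> 2) \<and> (\<forall>x. norm x \<ge> 1 \<longrightarrow> norm (f x) \<ge> 7/8) \<and>
     (\<forall>x. f x = 0 \<longrightarrow> surj (frechet_derivative f (at x))) \<and>
     (\<forall>x s a. norm (f x) < 7/8 \<and> norm (f (x + s *\<^sub>R axis a 1)) < 7/8 \<and>
        (\<forall>b. f x $ b \<in> \<rat>) \<and> (\<forall>b. f (x + s *\<^sub>R axis a 1) $ b \<in> \<rat>) \<longrightarrow> f (x + s *\<^sub>R axis a 1) = f x)"

text \<open>The affine perturbation has to fade out before norm 2, but its genericity is available
  only where the cut-off \<theta> is 1, on the unit ball. The two agree because outside that ball
  \<open>f0\<close> has norm 1 and the perturbation is at most 1/8, so values of norm below 7/8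
  occur only inside. The scale 1/2 in \<open>f0\<close> makes it equal to \<open>g\<close> from norm
  1 on.\<close>

lemma generic_extension:
  fixes g :: "real^'p \<Rightarrow> real^'q"
  assumes g: "smooth_on (- {0}) g" "\<And>x. x \<noteq> 0 \<Longrightarrow> norm (g x) = 1" and dims: "CARD('p) + 1 < 2 * CARD('q)"
  obtains f where "generic_map f" "\<And>x. norm x \<ge> 2 \<Longrightarrow> f x = g x"
proof -
  define f0 where "f0 x = smooth_step ((norm x)\<^sup>2 / (1/2)\<^sup>2) *\<^sub>R g x" for x
  have smf0: "smooth_on UNIV f0"
    unfolding f0_def by (rule smooth_on_cutoff_radial[OF g(1)]) simp
  obtain A b where Ab: "\<And>x. norm x \<le> 2 \<Longrightarrow> norm (A *v x + b) < 1/8"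
    "\<And>x. f0 x + A *v x + b = 0 \<Longrightarrow> surj (\<lambda>v. frechet_derivative f0 (at x) v + A *v v)"
    "\<And>y y' a x s. \<lbrakk>y \<in> {y. \<forall>a. y $ a \<in> \<rat>}; y' \<in> {y. \<forall>a. y $ a \<in> \<rat>}; f0 x + A *v x + b = y;
      f0 (x + s *\<^sub>R axis a 1) + A *v (x + s *\<^sub>R axis a 1) + b = y'\<rbrakk> \<Longrightarrow> y = y'"
    by (rule generic_affine_perturbation[OF smf0 dims countable_rational_vectors, of "1/8"]) (simp, blast)
  define \<theta> where "\<theta> x = 1 - smooth_step ((norm x)\<^sup>2)" for x :: "real^'p"
  define f where "f x = f0 x + \<theta> x *\<^sub>R (A *v x + b)" for x
  have \<theta>01: "0 \<le> \<theta> x" "\<theta> x \<le> 1" for x using smooth_step_nonneg smooth_step_le_1 by (auto simp: \<theta>_def)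
  have \<theta>2: "\<theta> x = 0" if "norm x \<ge> 2" for x
  proof -
    have "2\<^sup>2 \<le> (norm x)\<^sup>2" using that by (intro power_mono) auto
    then have "2 \<le> (norm x)\<^sup>2" by simp
    then show ?thesis by (simp add: \<theta>_def smooth_step_eq_1)
  qed
  have \<theta>1: "\<theta> x = 1" if "norm x \<le> 1" for x
    using that by (simp add: \<theta>_def smooth_step_eq_0 abs_square_le_1)
  have pert: "norm (\<theta> x *\<^sub>R (A *v x + b)) \<le> 1/8" for x
  proof (cases "norm x \<le> 2")
    case True
    have "norm (\<theta> x *\<^sub>R (A *v x + b)) \<le> 1 * (1/8)"
      unfolding norm_scaleR using \<theta>01[of x] Ab(1)[OF True] by (intro mult_mono) auto
    then show ?thesis by simp
  qed (simp add: \<theta>2)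
  have f0_le: "norm (f0 x) \<le> 1" for x
  proof (cases "x = 0")
    case False
    then show ?thesis using smooth_step_nonneg smooth_step_le_1 g(2) by (simp add: f0_def)
  qed (simp add: f0_def smooth_step_eq_0)
  have f0_far: "f0 x = g x" if "norm x \<ge> 1" for x
  proof -
    have "1\<^sup>2 \<le> (norm x)\<^sup>2" using that by (intro power_mono) auto
    then have "2 \<le> (norm x)\<^sup>2 / (1/2)\<^sup>2" by (simp add: power2_eq_square)
    then show ?thesis by (simp add: f0_def smooth_step_eq_1)
  qed
  have smf: "smooth_on UNIV f"
    unfolding f_def[abs_def] \<theta>_def
    by (intro smooth_on_add smooth_on_scaleR smooth_on_diff smooth_on_const smooth_on_smooth_step_compose smf0
        smooth_on_power2_norm smooth_on_id smooth_on_matrix_vector_mult open_UNIV)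
  have far: "norm (f x) \<ge> 7/8" if "norm x \<ge> 1" for x
  proof -
    have "norm (f0 x) = 1" using f0_far[OF that] g(2)[of x] that by (cases "x = 0") auto
    then show ?thesis
      using pert[of x] norm_triangle_ineq4[of "f x" "\<theta> x *\<^sub>R (A *v x + b)"] by (simp add: f_def)
  qed
  have near: "f x = f0 x + A *v x + b" if "norm (f x) < 7/8" for x
  proof -
    have "norm x \<le> 1" using far[of x] that by fastforce
    then show ?thesis by (simp add: f_def \<theta>1 algebra_simps)
  qed
  have reg: "surj (frechet_derivative f (at x))" if "f x = 0" for x
  proof -
    have "norm x < 1" using far[of x] that by fastforce
    then have "x \<in> ball 0 1" by simp
    moreover have "((\<lambda>x. f0 x + A *v x + b) has_derivative (\<lambda>v. frechet_derivative f0 (at x) v + A *v v)) (at x)"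
      using smooth_on_has_derivative[OF smf0, of x] bounded_linear_imp_has_derivative[OF matrix_vector_mul_bounded_linear[of A]]
      by (auto intro!: derivative_eq_intros)
    ultimately have "(f has_derivative (\<lambda>v. frechet_derivative f0 (at x) v + A *v v)) (at x)"
      by (intro has_derivative_transform_within_open[of "\<lambda>x. f0 x + A *v x + b" _ x UNIV "ball 0 1" f])
        (auto simp: f_def \<theta>1 algebra_simps)
    then have "frechet_derivative f (at x) = (\<lambda>v. frechet_derivative f0 (at x) v + A *v v)"
      using frechet_derivative_at by metis
    then show ?thesis using Ab(2)[of x] near[of x] that by simp
  qed
  show thesis
  proof (rule that[of f])
    have "norm (f x) \<le> 2" for x
      using pert[of x] f0_le[of x] norm_triangle_ineq[of "f0 x" "\<theta> x *\<^sub>R (A *v x + b)"] by (simp add: f_def)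
    moreover have "f (x + s *\<^sub>R axis a 1) = f x"
      if "norm (f x) < 7/8" "norm (f (x + s *\<^sub>R axis a 1)) < 7/8" "\<forall>b. f x $ b \<in> \<rat>"
        "\<forall>b. f (x + s *\<^sub>R axis a 1) $ b \<in> \<rat>" for x s a
      using Ab(3)[of "f x" "f (x + s *\<^sub>R axis a 1)" x s a] near that by auto
    ultimately show "generic_map f"
      unfolding generic_map_def using smf far reg by blast
    show "f x = g x" if "norm x \<ge> 2" for x
      using \<theta>2[OF that] f0_far[of x] that by (simp add: f_def)
  qed
qed

text \<open>Where a map takes values of norm at least \<open>2 * c\<close>, following it by this
  push puts the values on the unit sphere and so lowers the rank. Hence only lattice points near 0
  need tubes.\<close>

definition sphere_push :: "real \<Rightarrow> 'a::euclidean_space \<Rightarrow> 'a" where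
  "sphere_push c y = smooth_step ((norm y)\<^sup>2 / c\<^sup>2) *\<^sub>R (inverse (norm y) *\<^sub>R y)"

lemma smooth_on_sphere_push: "c > 0 \<Longrightarrow> smooth_on UNIV (sphere_push c)"
  unfolding sphere_push_def[abs_def]
  by (intro smooth_on_cutoff_radial smooth_on_scaleR smooth_on_inverse smooth_on_norm smooth_on_id
      open_Compl closed_singleton) auto

lemma norm_sphere_push_le: "norm (sphere_push c y) \<le> 1"
  using smooth_step_nonneg smooth_step_le_1 by (cases "y = 0") (auto simp: sphere_push_def mult.assoc)

lemma sphere_push_far:
  assumes "c > 0" "norm y \<ge> 2 * c"
  shows "sphere_push c y = inverse (norm y) *\<^sub>R y" "norm (sphere_push c y) = 1"
proof -
  have "(2 * c)\<^sup>2 \<le> (norm y)\<^sup>2" using assms by (intro power_mono) auto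
  moreover have "2 * c\<^sup>2 \<le> (2 * c)\<^sup>2" using zero_le_power2[of c] by (simp add: power_mult_distrib del: zero_le_power2)
  ultimately have "2 * c\<^sup>2 \<le> (norm y)\<^sup>2" by linarith
  then have "2 \<le> (norm y)\<^sup>2 / c\<^sup>2" using assms by (simp add: field_simps)
  then show 1: "sphere_push c y = inverse (norm y) *\<^sub>R y"
    by (simp add: sphere_push_def smooth_step_eq_1)
  have "y \<noteq> 0" using assms by auto
  then show "norm (sphere_push c y) = 1" unfolding 1 by simp
qed

text \<open>A model in the target for widening a tube: a homothety of ratio \<mu> on the ball of
  radius \<open>r\<close> around \<open>y\<close>, the identity beyond \<open>2 * r\<close>. Under
  pullback the ball of radius \<open>\<mu> * r\<close> becomes the ball of radius
  \<open>r\<close>.\<close>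

definition squeeze :: "real \<Rightarrow> real \<Rightarrow> 'a::euclidean_space \<Rightarrow> 'a \<Rightarrow> 'a" where
  "squeeze \<mu> r y z = y + (\<mu> + (1 - \<mu>) * smooth_step ((norm (z - y))\<^sup>2 / r\<^sup>2)) *\<^sub>R (z - y)"

lemma smooth_on_squeeze: "smooth_on UNIV (squeeze \<mu> r y)"
  unfolding squeeze_def[abs_def] divide_inverse
  by (intro smooth_on_add smooth_on_scaleR smooth_on_mult smooth_on_diff smooth_on_smooth_step_compose
    smooth_on_power2_norm smooth_on_id smooth_on_const open_UNIV)

lemma squeeze_near:
  assumes "r > 0" "norm (z - y) \<le> r"
  shows "squeeze \<mu> r y z = y + \<mu> *\<^sub>R (z - y)"
proof -
  have "(norm (z - y))\<^sup>2 \<le> r\<^sup>2" using assms by (intro power_mono) auto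
  then have "(norm (z - y))\<^sup>2 / r\<^sup>2 \<le> 1" using assms by (simp add: divide_le_eq_1)
  then show ?thesis by (simp add: squeeze_def smooth_step_eq_0)
qed

lemma squeeze_far:
  assumes "r > 0" "norm (z - y) \<ge> 2 * r"
  shows "squeeze \<mu> r y z = z"
proof -
  have "(2 * r)\<^sup>2 \<le> (norm (z - y))\<^sup>2" using assms by (intro power_mono) auto
  moreover have "2 * r\<^sup>2 \<le> (2 * r)\<^sup>2" using zero_le_power2[of r] by (simp add: power_mult_distrib del: zero_le_power2)
  ultimately have "2 * r\<^sup>2 \<le> (norm (z - y))\<^sup>2" by linarith
  then have "2 \<le> (norm (z - y))\<^sup>2 / r\<^sup>2" using assms by (simp add: field_simps)
  then show ?thesis by (simp add: squeeze_def smooth_step_eq_1)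
qed

lemma squeeze_coefficient:
  assumes "0 < \<mu>" "\<mu> < 1"
  obtains c where "\<mu> \<le> c" "c \<le> 1" "squeeze \<mu> r y z = y + c *\<^sub>R (z - y)"
proof (rule that)
  let ?s = "smooth_step ((norm (z - y))\<^sup>2 / r\<^sup>2)"
  show "\<mu> \<le> \<mu> + (1 - \<mu>) * ?s" using assms smooth_step_nonneg by simp
  have "(1 - \<mu>) * ?s \<le> (1 - \<mu>) * 1" using assms smooth_step_le_1 by (intro mult_left_mono) auto
  then show "\<mu> + (1 - \<mu>) * ?s \<le> 1" by simp
qed (simp add: squeeze_def)

lemma squeeze_in_ball:
  assumes "0 < \<mu>" "\<mu> < 1" "norm y < d" "norm z < d"
  shows "norm (squeeze \<mu> r y z) < d"
proof -
  obtain c where c: "\<mu> \<le> c" "c \<le> 1" "squeeze \<mu> r y z = y + c *\<^sub>R (z - y)"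
    using squeeze_coefficient[OF assms(1,2)] by blast
  have "(1 - c) *\<^sub>R y + c *\<^sub>R z \<in> ball 0 d"
    using convexD_alt[OF convex_ball, of y "0::'a" d z c] assms c by auto
  moreover have "(1 - c) *\<^sub>R y + c *\<^sub>R z = squeeze \<mu> r y z" by (simp add: c(3) algebra_simps)
  ultimately show ?thesis by simp
qed

lemma squeeze_preimage:
  assumes "0 < \<mu>" "\<mu> < 1" "norm (squeeze \<mu> r y z - y) < \<mu> * r"
  shows "norm (z - y) < r"
proof -
  obtain c where c: "\<mu> \<le> c" "c \<le> 1" "squeeze \<mu> r y z = y + c *\<^sub>R (z - y)"
    using squeeze_coefficient[OF assms(1,2)] by blast
  have "\<mu> * norm (z - y) \<le> c * norm (z - y)" using c by (intro mult_right_mono) auto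
  also have "\<dots> = norm (squeeze \<mu> r y z - y)" using c assms(1) by simp
  finally have "\<mu> * norm (z - y) < \<mu> * r" using assms(3) by linarith
  then show ?thesis using assms(1) by simp
qed

section \<open>Rank and dilation\<close>

text \<open>Differentiating \<open>f y \<bullet> f y\<close> shows that the range of
  \<open>D\<close> is orthogonal to the nonzero vector \<open>f x\<close>.\<close>

lemma not_surj_of_constant_norm:
  fixes f :: "'a::euclidean_space \<Rightarrow> 'b::euclidean_space"
  assumes f: "(f has_derivative D) (at x)" and V: "open V" "x \<in> V" "\<And>y. y \<in> V \<Longrightarrow> norm (f y) = 1"
  shows "\<not> surj D"
proof
  assume "surj D"
  then obtain v where v: "D v = f x" by (metis surjD)
  have "((\<lambda>y. f y \<bullet> f y) has_derivative (\<lambda>v. f x \<bullet> D v + D v \<bullet> f x)) (at x)"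
    using f by (auto intro!: derivative_eq_intros)
  moreover have "((\<lambda>y. f y \<bullet> f y) has_derivative (\<lambda>v. 0)) (at x)"
  proof (rule has_derivative_transform_within_open[OF has_derivative_const[of 1] V(1,2)])
    fix y assume "y \<in> V"
    then show "1 = f y \<bullet> f y" using V(3)[of y] by (simp add: norm_eq_1)
  qed
  ultimately have "(\<lambda>v. f x \<bullet> D v + D v \<bullet> f x) = (\<lambda>v. 0)" by (rule has_derivative_unique)
  from fun_cong[OF this, of v] have "f x \<bullet> f x = 0" using v by simp
  then show False using V(3)[OF V(2)] by simp
qed

lemma not_surj_compose:
  fixes D :: "'a::euclidean_space \<Rightarrow> 'b::euclidean_space" and E :: "'b \<Rightarrow> 'b"
  assumes "linear E" "\<not> surj D"
  shows "\<not> surj (\<lambda>v. E (D v))"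
proof
  assume ED: "surj (\<lambda>v. E (D v))"
  then have "surj E" unfolding surj_def by metis
  then have "inj E" using linear_surjective_imp_injective[OF assms(1)] by blast
  have "surj D"
    unfolding surj_def using ED \<open>inj E\<close> by (metis injD surjD)
  then show False using assms(2) by blast
qed

text \<open>Boundary points are the issue. Along the segment from \<open>x\<close> to any
  \<open>z\<close> in the ball the one-sided derivative is unique, which settles the directions
  \<open>z - x\<close>; a small multiple of an arbitrary vector \<open>v\<close> is the difference
  of two of these, for \<open>z = e *\<^sub>R v\<close> and \<open>z = 0\<close>.\<close>

lemma has_derivative_within_cball_unique:
  fixes f :: "'a::euclidean_space \<Rightarrow> 'b::real_normed_vector"
  assumes x: "x \<in> cball 0 1" and D: "(f has_derivative D) (at x within cball 0 1)"
    and D': "(f has_derivative D') (at x within cball 0 1)"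
  shows "D = D'"
proof -
  have lin: "linear D" "linear D'" using D D' has_derivative_linear by blast+
  have eq: "D (z - x) = D' (z - x)" if z: "z \<in> cball 0 1" for z
  proof -
    let ?l = "\<lambda>t::real. x + t *\<^sub>R (z - x)"
    have "?l ` cbox 0 1 \<subseteq> cball 0 1"
    proof clarify
      fix t :: real assume "t \<in> cbox 0 1"
      then have "(1 - t) *\<^sub>R x + t *\<^sub>R z \<in> cball 0 1"
        using convexD_alt[OF convex_cball x z] by auto
      then show "?l t \<in> cball 0 1" by (simp add: algebra_simps)
    qed
    then have "(f has_derivative D) (at (?l 0) within ?l ` cbox 0 1)"
      "(f has_derivative D') (at (?l 0) within ?l ` cbox 0 1)"
      using has_derivative_subset[OF D] has_derivative_subset[OF D'] by simp_all
    moreover have "(?l has_derivative (\<lambda>h. h *\<^sub>R (z - x))) (at 0 within cbox 0 1)"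
      by (auto intro!: derivative_eq_intros)
    ultimately have "((\<lambda>t. f (?l t)) has_derivative (\<lambda>h. D (h *\<^sub>R (z - x)))) (at 0 within cbox 0 1)"
      "((\<lambda>t. f (?l t)) has_derivative (\<lambda>h. D' (h *\<^sub>R (z - x)))) (at 0 within cbox 0 1)"
      using has_derivative_in_compose[of ?l _ 0 "cbox 0 1" f] by blast+
    then have "(\<lambda>h. D (h *\<^sub>R (z - x))) = (\<lambda>h. D' (h *\<^sub>R (z - x)))"
      by (intro frechet_derivative_unique_within_closed_interval[of 0 1 0 "\<lambda>t. f (?l t)"]) auto
    from fun_cong[OF this, of 1] show ?thesis by simp
  qed
  show ?thesis
  proof
    fix v :: 'a
    define e where "e = inverse (norm v + 1)"
    have e: "e > 0" by (simp add: e_def add_nonneg_pos)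
    have "norm (e *\<^sub>R v) \<le> 1"
      using e by (simp add: e_def divide_simps add_nonneg_pos add_nonneg_eq_0_iff)
    then have "D (e *\<^sub>R v - x) - D (0 - x) = D' (e *\<^sub>R v - x) - D' (0 - x)"
      using eq[of "e *\<^sub>R v"] eq[of 0] by simp
    then have "D (e *\<^sub>R v) = D' (e *\<^sub>R v)"
      unfolding linear_diff[OF lin(1), symmetric] linear_diff[OF lin(2), symmetric] by simp
    then show "D v = D' v"
      using e by (simp add: linear_cmul[OF lin(1)] linear_cmul[OF lin(2)])
  qed
qed

text \<open>Where the derivative is not onto, the last singular value vanishes; elsewhere every
  singular value is at most \<open>B\<close>.\<close>

lemma dil_cball_le:
  fixes F :: "'a::euclidean_space \<Rightarrow> 'b::euclidean_space"
  assumes F: "\<And>x. norm x \<le> 1 \<Longrightarrow> \<exists>D. (F has_derivative D) (at x) \<and> (\<not> surj D \<or> (\<forall>v. norm (D v) \<le> B * norm v))"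
    and B: "B \<ge> 0"
  shows "dil DIM('b) (cball 0 1) F \<le> ennreal (B ^ DIM('b))"
  unfolding dil_def
proof (rule SUP_least)
  fix x :: 'a assume x: "x \<in> cball 0 1"
  then obtain D where D: "(F has_derivative D) (at x)" "\<not> surj D \<or> (\<forall>v. norm (D v) \<le> B * norm v)"
    using F[of x] by auto
  have D1: "(F has_derivative D) (at x within cball 0 1)" using D(1) by (rule has_derivative_at_withinI)
  then have "(F has_derivative frechet_derivative F (at x within cball 0 1)) (at x within cball 0 1)"
    using frechet_derivative_works differentiable_def by blast
  then have eq: "frechet_derivative F (at x within cball 0 1) = D"
    using has_derivative_within_cball_unique[OF x] D1 by blast
  have lin: "linear D" using D(1) has_derivative_linear by blast
  have "(\<Prod>l = 1..DIM('b). singular_value D l) \<le> B ^ DIM('b)"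
  proof (cases "surj D")
    case True
    then show ?thesis using D(2) B by (intro prod_singular_values_le lin) auto
  next
    case False
    then show ?thesis using B by (subst prod_singular_values_eq_0[OF lin]) simp_all
  qed
  then show "ennreal (\<Prod>l = 1..DIM('b). singular_value (frechet_derivative F (at x within cball 0 1)) l)
      \<le> ennreal (B ^ DIM('b))"
    unfolding eq by (rule ennreal_leI)
qed

lemma smooth_on_bounded_derivative:
  assumes f: "smooth_on UNIV f" and C: "compact C"
  obtains B where "B > 0" "\<And>x v. x \<in> C \<Longrightarrow> norm (frechet_derivative f (at x) v) \<le> B * norm v"
proof -
  have "\<exists>B. \<forall>x\<in>C. norm (frechet_derivative f (at x) b) \<le> B" for b
  proof -
    have "continuous_on C (\<lambda>x. frechet_derivative f (at x) b)"
      using smooth_on_continuous[OF smooth_on_derivative[OF f]] by (rule continuous_on_subset) auto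
    then have "bounded ((\<lambda>x. frechet_derivative f (at x) b) ` C)"
      using C by (intro compact_imp_bounded compact_continuous_image)
    then show ?thesis by (auto simp: bounded_iff)
  qed
  then obtain B where B: "\<And>b x. x \<in> C \<Longrightarrow> norm (frechet_derivative f (at x) b) \<le> B b" by metis
  have "norm (frechet_derivative f (at x) v) \<le> ((\<Sum>b\<in>Basis. \<bar>B b\<bar>) + 1) * norm v" if "x \<in> C" for x v
  proof -
    have lin: "linear (frechet_derivative f (at x))"
      using smooth_on_has_derivative[OF f] has_derivative_linear by blast
    have "norm (frechet_derivative f (at x) v) = norm (\<Sum>b\<in>Basis. (v \<bullet> b) *\<^sub>R frechet_derivative f (at x) b)"
      by (rule arg_cong[OF linear_euclidean_expand[OF lin]])
    also have "\<dots> \<le> (\<Sum>b\<in>Basis. norm v * \<bar>B b\<bar>)"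
    proof (rule sum_norm_le)
      fix b :: 'a assume "b \<in> Basis"
      show "norm ((v \<bullet> b) *\<^sub>R frechet_derivative f (at x) b) \<le> norm v * \<bar>B b\<bar>"
        unfolding norm_scaleR
        using Basis_le_norm[OF \<open>b \<in> Basis\<close>, of v] B[OF that, of b] by (intro mult_mono) auto
    qed
    also have "\<dots> = (\<Sum>b\<in>Basis. \<bar>B b\<bar>) * norm v"
      by (simp add: sum_distrib_left mult.commute)
    also have "\<dots> \<le> ((\<Sum>b\<in>Basis. \<bar>B b\<bar>) + 1) * norm v" by (intro mult_right_mono) auto
    finally show ?thesis .
  qed
  moreover have "(\<Sum>b\<in>Basis. \<bar>B b\<bar>) + 1 > 0" by (intro add_nonneg_pos sum_nonneg) auto
  ultimately show thesis using that by blast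
qed

section \<open>Rearranging the fibres\<close>

text \<open>Compactness makes the generic separation quantitative. \<open>N\<close> vanishes only at
  two points of the fibres over \<open>y\<close> and \<open>y'\<close> on a common line in direction
  \<open>a\<close>, so it has a positive minimum, while aligned points of the tubes give
  \<open>N\<close> at most \<open>2 * \<tau>\<close>. The bound 1/4 keeps the tubes in the unit
  ball, because 1/2 + 1/4 < 7/8.\<close>

lemma separated_tubes:
  fixes f :: "real^'p \<Rightarrow> real^'q"
  assumes f: "generic_map f" and Y: "finite Y" "\<And>y. y \<in> Y \<Longrightarrow> norm y \<le> 1/2"
    "\<And>y a. y \<in> Y \<Longrightarrow> y $ a \<in> \<rat>"
  obtains \<tau> where "0 < \<tau>" "\<tau> \<le> 1/4"
    "\<And>y y' x s a. \<lbrakk>y \<in> Y; y' \<in> Y; norm (f x - y) \<le> \<tau>;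
       norm (f (x + s *\<^sub>R axis a 1) - y') \<le> \<tau>\<rbrakk> \<Longrightarrow> y = y'"
proof -
  define p where "p a x = x - (x $ a) *\<^sub>R axis a 1" for a and x :: "real^'p"
  define N where "N y y' a z = norm (f (fst z) - y) + norm (f (snd z) - y') + norm (p a (snd z - fst z))"
    for y y' a z
  have smf: "smooth_on UNIV f" using f by (simp add: generic_map_def)
  have "\<exists>\<mu>>0. \<forall>z\<in>cball 0 1 \<times> cball 0 1. \<mu> \<le> N y y' a z" if yy': "y \<in> Y" "y' \<in> Y" "y \<noteq> y'" for y y' a
  proof -
    have "continuous_on (cball 0 1 \<times> cball 0 1) (N y y' a)"
      unfolding N_def p_def
      by (intro continuous_intros continuous_on_compose2[OF smooth_on_continuous[OF smf]]) auto
    moreover have "compact (cball (0::real^'p) 1 \<times> cball (0::real^'p) 1)" by (intro compact_Times compact_cball)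
    ultimately obtain z where z: "z \<in> cball 0 1 \<times> cball 0 1" "\<And>z'. z' \<in> cball 0 1 \<times> cball 0 1 \<Longrightarrow> N y y' a z \<le> N y y' a z'"
      using continuous_attains_inf[of "cball 0 1 \<times> cball 0 1" "N y y' a"] by force
    have "N y y' a z \<noteq> 0"
    proof
      assume "N y y' a z = 0"
      then have 0: "f (fst z) = y" "f (snd z) = y'" "p a (snd z - fst z) = 0"
        unfolding N_def by (smt (verit) norm_ge_zero norm_le_zero_iff right_minus_eq)+
      then have "snd z = fst z + ((snd z - fst z) $ a) *\<^sub>R axis a 1" by (simp add: p_def algebra_simps)
      then obtain s where s: "snd z = fst z + s *\<^sub>R axis a 1" by blast
      have "f (fst z + s *\<^sub>R axis a 1) = f (fst z)"
        using f Y(2)[OF yy'(1)] Y(2)[OF yy'(2)] Y(3)[OF yy'(1)] Y(3)[OF yy'(2)] 0 s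
        unfolding generic_map_def by auto
      then show False using 0 s yy'(3) by simp
    qed
    then have "N y y' a z > 0" unfolding N_def by (smt (verit) norm_ge_zero)
    then show ?thesis using z(2) by blast
  qed
  then obtain \<mu> where \<mu>: "\<And>y y' a. \<lbrakk>y \<in> Y; y' \<in> Y; y \<noteq> y'\<rbrakk> \<Longrightarrow> \<mu> y y' a > 0 \<and> (\<forall>z\<in>cball 0 1 \<times> cball 0 1. \<mu> y y' a \<le> N y y' a z)"
    by metis
  define J where "J = {(y, y', a :: 'p). y \<in> Y \<and> y' \<in> Y \<and> y \<noteq> y'}"
  have "finite J" by (rule finite_subset[of _ "Y \<times> Y \<times> UNIV"]) (use Y(1) in \<open>auto simp: J_def\<close>)
  define \<tau> where "\<tau> = Min (insert (1/4) ((\<lambda>(y, y', a). \<mu> y y' a / 3) ` J))"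
  have \<tau>_le: "\<tau> \<le> 1/4"
    unfolding \<tau>_def by (rule Min_le) (use \<open>finite J\<close> in auto)
  have \<tau>_le': "\<tau> \<le> \<mu> y y' a / 3" if "y \<in> Y" "y' \<in> Y" "y \<noteq> y'" for y y' a
    unfolding \<tau>_def
    by (rule Min_le) (use \<open>finite J\<close> that in \<open>auto simp: J_def intro!: image_eqI[of _ _ "(y, y', a)"]\<close>)
  have "\<tau> > 0"
    unfolding \<tau>_def using \<open>finite J\<close> \<mu> by (subst Min_gr_iff) (auto simp: J_def)
  show thesis
  proof (rule that[OF \<open>\<tau> > 0\<close> \<tau>_le])
    fix y y' x s a
    assume Y2: "y \<in> Y" "y' \<in> Y" and x: "norm (f x - y) \<le> \<tau>" "norm (f (x + s *\<^sub>R axis a 1) - y') \<le> \<tau>"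
    show "y = y'"
    proof (rule ccontr)
      assume "y \<noteq> y'"
      note yy' = Y2 this
      have near: "norm z \<le> 1" if "w \<in> Y" "norm (f z - w) \<le> \<tau>" for z w
      proof (rule ccontr)
        assume "\<not> norm z \<le> 1"
        then have "7/8 \<le> norm (f z)" using f by (auto simp: generic_map_def)
        moreover have "norm (f z) \<le> norm (f z - w) + norm w" by (metis norm_triangle_sub add.commute)
        ultimately show False using that Y(2)[of w] \<tau>_le by linarith
      qed
      have "p a (s *\<^sub>R axis a 1) = 0" by (auto simp: p_def vec_eq_iff axis_def)
      then have "N y y' a (x, x + s *\<^sub>R axis a 1) \<le> 2 * \<tau>"
        using x by (simp add: N_def)
      moreover have "\<mu> y y' a \<le> N y y' a (x, x + s *\<^sub>R axis a 1)"
        using \<mu>[OF yy', of a] near[OF yy'(1) x(1)] near[OF yy'(2) x(2)] by auto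
      ultimately show False using \<tau>_le'[OF yy', of a] \<open>\<tau> > 0\<close> by linarith
    qed
  qed
qed

text \<open>Every coordinate of a point of \<open>Y\<close> is \<open>j / M\<close> with
  \<open>\<bar>j\<bar> \<le> M\<close>, so counting gives an injection into the grid
  \<open>{..<L}\<close> to the power \<open>CARD('p)\<close>. Addresses, scaled by 4, become the
  centres of the disjoint unit balls.\<close>

lemma lattice_addresses:
  fixes M L :: nat
  assumes M: "M > 0" and card: "(2 * M + 1) ^ CARD('q) \<le> L ^ CARD('p)"
  defines "Y \<equiv> {y :: real^'q. (\<forall>a. \<exists>j::int. y $ a = (1 / M) * j) \<and> norm y \<le> 1}"
  obtains n :: "real^'q \<Rightarrow> 'p::finite \<Rightarrow> nat"
  where "finite Y" "inj_on n Y" "\<And>y a. y \<in> Y \<Longrightarrow> n y a \<le> L"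
proof -
  define X where "X = (\<lambda>j. \<chi> a. (1 / M) * real_of_int (j a)) ` (PiE (UNIV :: 'q set) (\<lambda>_. {- int M..int M}))"
  have "Y \<subseteq> X"
  proof
    fix y assume "y \<in> Y"
    then obtain j :: "'q \<Rightarrow> int" where j: "\<And>a. y $ a = (1 / M) * j a" "norm y \<le> 1"
      unfolding Y_def by (auto simp: choice_iff)
    have "j a \<in> {- int M..int M}" for a
    proof -
      have "\<bar>(1 / M) * real_of_int (j a)\<bar> \<le> 1" using component_le_norm_cart[of y a] j by simp
      then have "\<bar>real_of_int (j a)\<bar> \<le> M" using M by (simp add: abs_mult field_simps)
      then show ?thesis by auto
    qed
    moreover have "y = (\<chi> a. (1 / M) * real_of_int (j a))" using j(1) by (simp add: vec_eq_iff)
    ultimately show "y \<in> X" unfolding X_def by (intro image_eqI[of _ _ j]) auto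
  qed
  have finPi: "finite (PiE (UNIV :: 'q set) (\<lambda>_. {- int M..int M}))" by (intro finite_PiE) auto
  have "finite X" unfolding X_def using finPi by (rule finite_imageI)
  then have finY: "finite Y" using \<open>Y \<subseteq> X\<close> finite_subset by blast
  have "card Y \<le> card X" using \<open>Y \<subseteq> X\<close> \<open>finite X\<close> card_mono by blast
  also have "card X \<le> card (PiE (UNIV :: 'q set) (\<lambda>_. {- int M..int M}))"
    unfolding X_def by (rule card_image_le[OF finPi])
  also have "\<dots> = (2 * M + 1) ^ CARD('q)"
  proof -
    have "card {- int M..int M} = 2 * M + 1" unfolding card_atLeastAtMost_int by linarith
    then show ?thesis by (simp only: card_PiE[OF finite_class.finite_UNIV] prod_constant)
  qed
  also have "\<dots> \<le> card (PiE (UNIV :: 'p set) (\<lambda>_. {..<L}))" using card by (simp add: card_PiE)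
  finally have "card Y \<le> card (PiE (UNIV :: 'p set) (\<lambda>_. {..<L}))" .
  moreover have "finite (PiE (UNIV :: 'p set) (\<lambda>_. {..<L}))" by (intro finite_PiE) auto
  ultimately obtain n where n: "n ` Y \<subseteq> PiE (UNIV :: 'p set) (\<lambda>_. {..<L})" "inj_on n Y"
    using card_le_inj[OF finY] by blast
  have "n y a \<le> L" if "y \<in> Y" for y a
  proof -
    have "n y \<in> PiE UNIV (\<lambda>_. {..<L})" using n(1) that by blast
    then show ?thesis by (auto simp: PiE_iff intro: less_imp_le)
  qed
  then show thesis using that finY n(2) by blast
qed

text \<open>The squeeze is lifted by \<open>x \<mapsto> H (x, ?q (f x))\<close>. It moves only
  values within \<open>\<delta> / 8\<close> of \<open>y\<close>, hence of norm below
  \<open>3 / 4 * \<delta>\<close>; beyond that, \<open>H (x, f x) = x\<close> glues the lift to the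
  identity. The unit ball is preserved because values of norm below 7/8 occur only there.\<close>

lemma lifted_squeeze:
  fixes f :: "real^'p \<Rightarrow> real^'q"
  assumes f: "generic_map f" and d: "0 < \<delta>" "\<delta> \<le> 7/8"
    and H: "smooth_on {(x, y). norm (f x) < \<delta> \<and> norm y < \<delta>} H"
    "\<And>x y. norm (f x) < \<delta> \<Longrightarrow> norm y < \<delta> \<Longrightarrow> f (H (x, y)) = y"
    "\<And>x. norm (f x) < \<delta> \<Longrightarrow> H (x, f x) = x"
    and \<mu>: "0 < \<mu>" "\<mu> < 1" and y: "norm y < \<delta> / 2"
  obtains E where "smooth_on UNIV E" "\<And>x. f (E x) = squeeze \<mu> (\<delta> / 16) y (f x)"
    "\<And>x. norm x \<ge> 1 \<Longrightarrow> E x = x" "\<And>x. norm x \<le> 1 \<Longrightarrow> norm (E x) \<le> 1"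
proof -
  let ?q = "squeeze \<mu> (\<delta> / 16) y"
  have smf: "smooth_on UNIV f" and far: "\<And>x. norm x \<ge> 1 \<Longrightarrow> norm (f x) \<ge> 7/8"
    using f by (auto simp: generic_map_def)
  note contf = smooth_on_continuous[OF smf]
  have q_far: "?q z = z" if "norm z > 3 / 4 * \<delta>" for z
  proof (rule squeeze_far)
    have "norm z \<le> norm (z - y) + norm y" by (metis norm_triangle_sub add.commute)
    then show "2 * (\<delta> / 16) \<le> norm (z - y)" using that y d by linarith
  qed (use d in simp)
  have q_ball: "norm (?q z) < \<delta>" if "norm z < \<delta>" for z
    using squeeze_in_ball[OF \<mu>, of y \<delta> z "\<delta> / 16"] that y d by simp
  define E where "E x = (if norm (f x) < \<delta> then H (x, ?q (f x)) else x)" for x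
  define U where "U = {x. norm (f x) < \<delta>}"
  define V where "V = {x. 3 / 4 * \<delta> < norm (f x)}"
  have "open U" "open V"
    unfolding U_def V_def using contf by (auto intro!: open_Collect_less continuous_intros)
  have openW: "open {(x, y). norm (f x) < \<delta> \<and> norm (y :: real^'q) < \<delta>}"
  proof -
    have "{(x, y). norm (f x) < \<delta> \<and> norm (y :: real^'q) < \<delta>} = U \<times> ball 0 \<delta>" by (auto simp: U_def)
    then show ?thesis using \<open>open U\<close> by (simp add: open_Times)
  qed
  have "smooth_on U (\<lambda>x. H (x, ?q (f x)))"
  proof (rule smooth_on_compose[OF \<open>open U\<close> openW _ H(1)])
    show "(\<lambda>x. (x, ?q (f x))) ` U \<subseteq> {(x, y). norm (f x) < \<delta> \<and> norm y < \<delta>}"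
      using q_ball by (auto simp: U_def)
    show "smooth_on U (\<lambda>x. (x, ?q (f x)))"
      by (intro smooth_on_Pair smooth_on_id smooth_on_compose_UNIV[OF _ smooth_on_squeeze] \<open>open U\<close>
          smooth_on_subset[OF smf]) auto
  qed
  then have "smooth_on UNIV E"
  proof (rule smooth_on_glue[OF \<open>open U\<close> \<open>open V\<close> _ smooth_on_id])
    show "E x = H (x, ?q (f x))" if "x \<in> U" for x using that by (simp add: E_def U_def)
    show "E x = x" if "x \<in> V" for x
      using that q_far[of "f x"] H(3)[of x] by (simp add: E_def V_def)
    show "UNIV \<subseteq> U \<union> V"
    proof
      fix x show "x \<in> U \<union> V" using d(1) by (cases "norm (f x) < \<delta>") (auto simp: U_def V_def)
    qed
  qed
  moreover have fE: "f (E x) = ?q (f x)" for x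
  proof (cases "norm (f x) < \<delta>")
    case True
    then show ?thesis using H(2)[OF True q_ball] by (simp add: E_def)
  next
    case False
    then show ?thesis using q_far[of "f x"] d by (simp add: E_def)
  qed
  moreover have "E x = x" if "norm x \<ge> 1" for x
    using far[OF that] d by (simp add: E_def)
  moreover have "norm (E x) \<le> 1" if "norm x \<le> 1" for x
  proof (cases "norm (f x) < \<delta>")
    case True
    then have "norm (f (E x)) < 7/8" using fE[of x] q_ball[of "f x"] d by simp
    then show ?thesis using far[of "E x"] by fastforce
  next
    case False
    then show ?thesis using that by (simp add: E_def)
  qed
  ultimately show thesis using that by blast
qed

text \<open>Each \<open>E y\<close> moves points of the unit ball only, and the centres are at least
  4 apart, so the displacements have disjoint supports and can simply be added.\<close>

lemma implant_maps:
  fixes E :: "'i \<Rightarrow> 'a::euclidean_space \<Rightarrow> 'a" and w :: "'i \<Rightarrow> 'a"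
  assumes Y: "finite Y" and E: "\<And>y. y \<in> Y \<Longrightarrow> smooth_on UNIV (E y)"
    "\<And>y x. y \<in> Y \<Longrightarrow> norm x \<ge> 1 \<Longrightarrow> E y x = x" "\<And>y x. y \<in> Y \<Longrightarrow> norm x \<le> 1 \<Longrightarrow> norm (E y x) \<le> 1"
    and w: "\<And>y y'. y \<in> Y \<Longrightarrow> y' \<in> Y \<Longrightarrow> y \<noteq> y' \<Longrightarrow> norm (w y - w y') \<ge> 4"
  obtains I where "smooth_on UNIV I" "\<And>x. norm (I x - x) \<le> 2"
    "\<And>y x. y \<in> Y \<Longrightarrow> norm (x - w y) < 2 \<Longrightarrow> I x = w y + E y (x - w y)"
    "\<And>y x. y \<in> Y \<Longrightarrow> norm (I x - w y) \<le> 1 \<Longrightarrow> norm (x - w y) \<le> 1"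
proof -
  define I where "I x = x + (\<Sum>y\<in>Y. E y (x - w y) - (x - w y))" for x
  have "smooth_on UNIV I"
    unfolding I_def
    by (intro smooth_on_add smooth_on_sum smooth_on_diff smooth_on_compose_UNIV[OF _ E(1)] smooth_on_id
        smooth_on_const open_UNIV)
  moreover have I1: "I x = w y + E y (x - w y)" if y: "y \<in> Y" and x: "norm (x - w y) < 2" for x y
  proof -
    have "E z (x - w z) - (x - w z) = 0" if z: "z \<in> Y - {y}" for z
    proof -
      have "norm (w y - w z) \<le> norm (x - w y) + norm (x - w z)"
        using norm_triangle_ineq4[of "x - w z" "x - w y"] by simp
      moreover have "norm (w y - w z) \<ge> 4" using w[of y z] y z by auto
      ultimately have "norm (x - w z) \<ge> 1" using x by linarith
      then show ?thesis using E(2)[of z] z by simp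
    qed
    then have "(\<Sum>z\<in>Y. E z (x - w z) - (x - w z)) = E y (x - w y) - (x - w y)"
      by (simp add: sum.remove[OF Y y])
    then show ?thesis by (simp add: I_def)
  qed
  moreover have I0: "I x = x" if "\<And>y. y \<in> Y \<Longrightarrow> norm (x - w y) \<ge> 1" for x
    using E(2) that by (simp add: I_def)
  moreover have "norm (I x - x) \<le> 2" for x
  proof (cases "\<exists>y\<in>Y. norm (x - w y) < 1")
    case True
    then obtain y where y: "y \<in> Y" "norm (x - w y) < 1" by blast
    then have "I x - x = E y (x - w y) - (x - w y)" using I1[of y x] by simp
    then have "norm (I x - x) \<le> norm (E y (x - w y)) + norm (x - w y)"
      by (metis norm_triangle_ineq4)
    moreover have "norm (E y (x - w y)) \<le> 1" using E(3)[OF y(1)] y(2) by simp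
    ultimately show ?thesis using y(2) by linarith
  next
    case False
    then show ?thesis using I0[of x] by (simp add: not_less)
  qed
  moreover have "norm (x - w y) \<le> 1" if y: "y \<in> Y" and "norm (I x - w y) \<le> 1" for x y
  proof (rule ccontr)
    assume far: "\<not> norm (x - w y) \<le> 1"
    show False
    proof (cases "\<exists>z\<in>Y. norm (x - w z) < 1")
      case True
      then obtain z where z: "z \<in> Y" "norm (x - w z) < 1" by blast
      then have "z \<noteq> y" using far by auto
      have "norm (I x - w z) \<le> 1" using I1[of z x] E(3)[OF z(1), of "x - w z"] z by simp
      moreover have "norm (w y - w z) \<le> norm (I x - w z) + norm (I x - w y)"
        using norm_triangle_ineq4[of "I x - w z" "I x - w y"] by simp
      ultimately show False using w[OF y z(1)] \<open>z \<noteq> y\<close> that(2) by fastforce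
    next
      case False
      then have "I x = x" using I0[of x] by (simp add: not_less)
      then show False using far that(2) by simp
    qed
  qed
  ultimately show thesis using that by blast
qed

text \<open>\<open>\<Psi>\<close> is the composition of the widening of the tubes with the separating shears; the two come in this
  order because the tubes have room to be widened only after they have been separated.\<close>

lemma rearrangement:
  fixes f :: "real^'p \<Rightarrow> real^'q" and n :: "real^'q \<Rightarrow> 'p \<Rightarrow> nat"
  assumes f: "generic_map f" and d: "0 < \<delta>" "\<delta> \<le> 7/8"
    and H: "smooth_on {(x, y). norm (f x) < \<delta> \<and> norm y < \<delta>} H"
    "\<And>x y. norm (f x) < \<delta> \<Longrightarrow> norm y < \<delta> \<Longrightarrow> f (H (x, y)) = y"
    "\<And>x. norm (f x) < \<delta> \<Longrightarrow> H (x, f x) = x"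
    and Y: "finite Y" "\<And>y. y \<in> Y \<Longrightarrow> norm y < \<delta> / 2"
    and n: "inj_on n Y" "\<And>y a. y \<in> Y \<Longrightarrow> n y a \<le> L"
    and \<tau>: "0 < \<tau>" "\<tau> \<le> 1/4" "\<tau> < \<delta> / 32"
    and sep: "\<And>y y' x s a. \<lbrakk>y \<in> Y; y' \<in> Y; norm (f x - y) \<le> \<tau>;
       norm (f (x + s *\<^sub>R axis a 1) - y') \<le> \<tau>\<rbrakk> \<Longrightarrow> y = y'"
  shows "\<exists>\<Psi>. smooth_on UNIV \<Psi> \<and> (\<forall>x. norm (\<Psi> x - x) \<le> 4 * L * CARD('p) + 2) \<and>
    (\<forall>x. \<forall>y\<in>Y. norm (f (\<Psi> x) - y) \<le> \<tau> \<longrightarrow> (\<exists>w V. open V \<and> x \<in> V \<and> norm (x - w) \<le> 1 \<and>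
       (\<forall>z\<in>V. f (\<Psi> z) = y + (32 * \<tau> / \<delta>) *\<^sub>R (f (z - w) - y))))"
proof -
  have smf: "smooth_on UNIV f" and far: "\<And>x. norm x \<ge> 1 \<Longrightarrow> norm (f x) \<ge> 7/8"
    using f by (auto simp: generic_map_def)
  note contf = smooth_on_continuous[OF smf]
  \<comment> \<open>With squeeze radius \<open>\<delta> / 16\<close> this gives
    \<open>\<mu> * (\<delta> / 16) = 2 * \<tau>\<close>, so a value within \<tau> of
    \<open>y\<close> comes strictly from the ball on which the squeeze is a homothety.\<close>
  define \<mu> where "\<mu> = 32 * \<tau> / \<delta>"
  have \<mu>: "0 < \<mu>" "\<mu> < 1" using \<tau> d by (auto simp: \<mu>_def field_simps)
  define T where "T y = {x. norm (f x - y) \<le> \<tau>}" for y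
  have T1: "T y \<subseteq> cball 0 1" if "y \<in> Y" for y
  proof
    fix x assume "x \<in> T y"
    then have "norm (f x) < 7/8"
      using Y(2)[OF that] \<tau>(2) d(2) norm_triangle_ineq[of "f x - y" y] by (simp add: T_def)
    then show "x \<in> cball 0 1" using far[of x] by fastforce
  qed
  have T2: "compact (T y)" if "y \<in> Y" for y
  proof -
    have "closed (T y)"
      unfolding T_def using contf by (intro closed_Collect_le continuous_intros)
    moreover have "bounded (T y)" using T1[OF that] bounded_cball bounded_subset by blast
    ultimately show ?thesis by (simp add: compact_eq_bounded_closed)
  qed
  have sepT: False if "y \<in> Y" "y' \<in> Y" "y \<noteq> y'" "x \<in> T y" "x + s *\<^sub>R axis a 1 \<in> T y'" for y y' x s a
    using sep[OF that(1,2), of x s a] that(3-5) by (simp add: T_def)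
  define w where "w y = (\<chi> a. 4 * real (n y a))" for y
  have "\<exists>\<Phi>. smooth_on UNIV \<Phi> \<and> (\<forall>x. norm (\<Phi> x - x) \<le> 4 * L * card (UNIV :: 'p set)) \<and>
    (\<forall>y\<in>Y. \<forall>x. \<Phi> x \<in> T y \<longrightarrow> (\<exists>V. open V \<and> x \<in> V \<and>
      (\<forall>z\<in>V. \<Phi> z = z - (\<chi> a. if a \<in> UNIV then 4 * real (n y a) else 0))))"
    by (rule separating_shears) (use Y(1) T1 T2 n(2) in \<open>blast intro: sepT\<close>)+
  then obtain \<Phi> where \<Phi>: "smooth_on UNIV \<Phi>" "\<And>x. norm (\<Phi> x - x) \<le> 4 * L * CARD('p)"
    "\<And>y x. y \<in> Y \<Longrightarrow> \<Phi> x \<in> T y \<Longrightarrow> \<exists>V. open V \<and> x \<in> V \<and> (\<forall>z\<in>V. \<Phi> z = z - w y)"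
    unfolding w_def by auto
  have wsep: "norm (w y - w y') \<ge> 4" if "y \<in> Y" "y' \<in> Y" "y \<noteq> y'" for y y'
  proof -
    have "n y \<noteq> n y'" using n(1) that by (meson inj_onD)
    then obtain a where a: "n y a \<noteq> n y' a" by (auto simp: fun_eq_iff)
    have "4 * 1 \<le> 4 * \<bar>real (n y a) - real (n y' a)\<bar>" using a by (intro mult_left_mono) linarith+
    also have "\<dots> = \<bar>(w y - w y') $ a\<bar>"
    proof -
      have "(w y - w y') $ a = 4 * (real (n y a) - real (n y' a))" by (simp add: w_def)
      then show ?thesis by (simp only: abs_mult abs_numeral)
    qed
    also have "\<dots> \<le> norm (w y - w y')" by (rule component_le_norm_cart)
    finally show ?thesis by simp
  qed
  have "\<exists>E. smooth_on UNIV E \<and> (\<forall>x. f (E x) = squeeze \<mu> (\<delta> / 16) y (f x)) \<and>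
      (\<forall>x. norm x \<ge> 1 \<longrightarrow> E x = x) \<and> (\<forall>x. norm x \<le> 1 \<longrightarrow> norm (E x) \<le> 1)" if "y \<in> Y" for y
    using lifted_squeeze[OF f d H \<mu> Y(2)[OF that]] by metis
  then obtain E where E: "\<And>y. y \<in> Y \<Longrightarrow> smooth_on UNIV (E y)"
    "\<And>y x. y \<in> Y \<Longrightarrow> f (E y x) = squeeze \<mu> (\<delta> / 16) y (f x)"
    "\<And>y x. y \<in> Y \<Longrightarrow> norm x \<ge> 1 \<Longrightarrow> E y x = x" "\<And>y x. y \<in> Y \<Longrightarrow> norm x \<le> 1 \<Longrightarrow> norm (E y x) \<le> 1"
    by metis
  obtain I where I: "smooth_on UNIV I" "\<And>x. norm (I x - x) \<le> 2"
    "\<And>y x. y \<in> Y \<Longrightarrow> norm (x - w y) < 2 \<Longrightarrow> I x = w y + E y (x - w y)"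
    "\<And>y x. y \<in> Y \<Longrightarrow> norm (I x - w y) \<le> 1 \<Longrightarrow> norm (x - w y) \<le> 1"
    by (rule implant_maps[of Y E w]) (use Y(1) E wsep in blast)+
  show ?thesis
  proof (intro exI[of _ "\<lambda>x. \<Phi> (I x)"] conjI allI ballI impI)
    show "smooth_on UNIV (\<lambda>x. \<Phi> (I x))"
      by (rule smooth_on_compose_UNIV[OF open_UNIV \<Phi>(1) I(1)])
    fix x
    show "norm (\<Phi> (I x) - x) \<le> 4 * L * CARD('p) + 2"
      using norm_triangle_ineq[of "\<Phi> (I x) - I x" "I x - x"] \<Phi>(2)[of "I x"] I(2)[of x] by simp
    fix y assume y: "y \<in> Y" and near: "norm (f (\<Phi> (I x)) - y) \<le> \<tau>"
    then have inT: "\<Phi> (I x) \<in> T y" by (simp add: T_def)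
    obtain V where V: "open V" "I x \<in> V" "\<And>z. z \<in> V \<Longrightarrow> \<Phi> z = z - w y"
      using \<Phi>(3)[OF y inT] by metis
    have "norm (I x - w y) \<le> 1"
      using T1[OF y] inT V(3)[OF V(2)] by (metis mem_cball_0 subsetD)
    then have x: "norm (x - w y) \<le> 1" by (rule I(4)[OF y])
    have f\<Psi>: "f (\<Phi> (I z)) = squeeze \<mu> (\<delta> / 16) y (f (z - w y))" if "I z \<in> V" "norm (z - w y) < 2" for z
      using V(3)[OF that(1)] I(3)[OF y that(2)] E(2)[OF y] by simp
    have "norm (squeeze \<mu> (\<delta> / 16) y (f (x - w y)) - y) < \<mu> * (\<delta> / 16)"
      using f\<Psi>[OF V(2)] x near \<tau>(1) d(1) by (simp add: \<mu>_def)
    then have fx: "norm (f (x - w y) - y) < \<delta> / 16" by (rule squeeze_preimage[OF \<mu>])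
    \<comment> \<open>The three conditions keep nearby points where \<open>\<Phi>\<close> is a
      translation, where \<open>I\<close> is a copy of \<open>E y\<close>, and where the squeeze is
      a homothety.\<close>
    define V' where "V' = I -` V \<inter> ball (w y) 2 \<inter> {z. norm (f (z - w y) - y) < \<delta> / 16}"
    have "open V'"
    proof -
      have "open {z. norm (f (z - w y) - y) < \<delta> / 16}"
        by (intro open_Collect_less continuous_intros continuous_on_compose2[OF contf]) auto
      then show ?thesis
        unfolding V'_def using V(1) smooth_on_continuous[OF I(1)] by (intro open_Int open_vimage) auto
    qed
    moreover have "x \<in> V'"
      using V(2) x fx by (simp add: V'_def dist_norm norm_minus_commute)
    moreover have "f (\<Phi> (I z)) = y + (32 * \<tau> / \<delta>) *\<^sub>R (f (z - w y) - y)" if "z \<in> V'" for z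
    proof -
      have "f (\<Phi> (I z)) = squeeze \<mu> (\<delta> / 16) y (f (z - w y))"
        using that by (intro f\<Psi>) (auto simp: V'_def dist_norm norm_minus_commute)
      also have "\<dots> = y + \<mu> *\<^sub>R (f (z - w y) - y)"
        using that d(1) by (intro squeeze_near) (auto simp: V'_def)
      finally show ?thesis by (simp add: \<mu>_def)
    qed
    ultimately show "\<exists>w V. open V \<and> x \<in> V \<and> norm (x - w) \<le> 1 \<and>
         (\<forall>z\<in>V. f (\<Phi> (I z)) = y + (32 * \<tau> / \<delta>) *\<^sub>R (f (z - w) - y))"
      using x by blast
  qed
qed

section \<open>Maps of small dilation\<close>

lemma staircase_derivative_le:
  fixes v :: "real^'q"
  assumes C: "\<And>t. \<bar>smooth_step' t\<bar> \<le> C" and "0 < h" "0 < \<sigma>" "2 * \<sigma> \<le> h"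
  shows "norm (\<chi> a. stair' h \<sigma> M (y $ a) * v $ a) \<le> C * h / \<sigma> * norm v"
proof -
  have "norm ((\<chi> a. stair' h \<sigma> M (y $ a) * v $ a) $ a) \<le> norm (((C * h / \<sigma>) *\<^sub>R v) $ a)" for a
  proof -
    have "\<bar>stair' h \<sigma> M (y $ a)\<bar> * \<bar>v $ a\<bar> \<le> \<bar>C * h / \<sigma>\<bar> * \<bar>v $ a\<bar>"
      using order_trans[OF stair'_le[OF assms, of M "y $ a"] abs_ge_self] by (rule mult_right_mono) simp
    then show ?thesis by (simp add: abs_mult)
  qed
  then have "norm (\<chi> a. stair' h \<sigma> M (y $ a) * v $ a) \<le> norm ((C * h / \<sigma>) *\<^sub>R v)"
    by (rule norm_le_componentwise_cart)
  moreover have "C \<ge> 0" using C[of 0] by linarith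
  ultimately show ?thesis using assms by simp
qed

text \<open>The constant \<open>K\<close> is fixed before \<open>M\<close> and \<open>L\<close>, and
  it does not see the tube thickness, for which compactness gives no explicit bound: on a tube the
  staircase stretches by at most \<open>C * h / \<sigma>\<close>, the widening contracts by
  \<open>32 * \<tau> / \<delta>\<close>, and \<open>\<tau> = CARD('q) * \<sigma>\<close>.\<close>

lemma low_rank_map:
  fixes f :: "real^'p \<Rightarrow> real^'q"
  assumes f: "generic_map f" and f1: "\<And>x. norm x \<ge> 2 \<Longrightarrow> norm (f x) = 1"
  obtains K M0 where "K > 0"
    "\<And>M L. \<lbrakk>M \<ge> M0; L > 0; (2 * M + 1) ^ CARD('q) \<le> L ^ CARD('p)\<rbrakk> \<Longrightarrow>
      \<exists>B r. smooth_on UNIV B \<and> 2 \<le> r \<and> r \<le> K * real L \<and> (\<forall>x. norm (B x) \<le> 1) \<and> (\<forall>x. norm x = r \<longrightarrow> B x = f x) \<and>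
        (\<forall>x. \<exists>D. (B has_derivative D) (at x) \<and> (\<not> surj D \<or> (\<forall>v. norm (D v) \<le> K / real M * norm v)))"
proof -
  let ?k = "real CARD('q)" and ?N = "CARD('p)"
  have smf: "smooth_on UNIV f" and f2: "\<And>x. norm (f x) \<le> 2"
    and far: "\<And>x. norm x \<ge> 1 \<Longrightarrow> norm (f x) \<ge> 7/8"
    and reg: "\<And>x. f x = 0 \<Longrightarrow> surj (frechet_derivative f (at x))"
    using f by (auto simp: generic_map_def)
  have k1: "?k \<ge> 1" using zero_less_card_finite[where 'a = 'q] by linarith
  have cpt: "norm x \<le> 1" if "norm (f x) < 7/8" for x using far[of x] that by fastforce
  obtain \<delta> H where d: "0 < \<delta>" "\<delta> \<le> 7/8"
    and H: "smooth_on {(x, y). norm (f x) < \<delta> \<and> norm y < \<delta>} H"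
    "\<And>x y. norm (f x) < \<delta> \<Longrightarrow> norm y < \<delta> \<Longrightarrow> f (H (x, y)) = y"
    "\<And>x. norm (f x) < \<delta> \<Longrightarrow> H (x, f x) = x"
    by (rule submersion_lift[OF smf _ cpt reg, of "7/8"]) auto
  define c where "c = \<delta> / 16"
  have c: "c > 0" using d by (simp add: c_def)
  let ?\<xi> = "sphere_push c :: real^'q \<Rightarrow> real^'q"
  obtain C\<xi> where C\<xi>: "C\<xi> > 0" "\<And>y v. y \<in> cball 0 3 \<Longrightarrow> norm (frechet_derivative ?\<xi> (at y) v) \<le> C\<xi> * norm v"
    using smooth_on_bounded_derivative[OF smooth_on_sphere_push[OF c] compact_cball] by metis
  obtain \<Lambda> where \<Lambda>: "\<Lambda> > 0" "\<And>x v. x \<in> cball 0 1 \<Longrightarrow> norm (frechet_derivative f (at x) v) \<le> \<Lambda> * norm v"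
    using smooth_on_bounded_derivative[OF smf compact_cball] by metis
  obtain C where C: "C > 0" "\<And>t. \<bar>smooth_step' t\<bar> \<le> C" using smooth_step'_bounded by blast
  \<comment> \<open>The factors are the derivative bounds of the push, of the staircase with
    \<open>h / \<sigma>\<close> removed, of the widening with \<sigma> removed, and of
    \<open>f\<close> on the unit ball.\<close>
  define K1 where "K1 = C\<xi> * C * (32 * ?k / \<delta>) * \<Lambda>"
  have K1: "K1 > 0" using C\<xi>(1) C(1) \<Lambda>(1) d k1 by (simp add: K1_def)
  define K where "K = max K1 (8 * ?N + 10)"
  have K: "K > 0" "K1 \<le> K" "8 * ?N + 10 \<le> K" using K1 by (auto simp: K_def)
  \<comment> \<open>From here on \<open>CARD('q) * h \<le> \<delta> / 16\<close>, which bounds how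
    far the staircase moves a value.\<close>
  define M0 where "M0 = nat \<lceil>16 * ?k / \<delta>\<rceil> + 1"
  show thesis
  proof (rule that[OF K(1), of M0])
    fix M L :: nat
    assume M: "M0 \<le> M" and L: "L > 0" and card: "(2 * M + 1) ^ CARD('q) \<le> L ^ CARD('p)"
    have "M > 0" using M by (simp add: M0_def)
    define h where "h = 1 / real M"
    have h: "h > 0" using \<open>M > 0\<close> by (simp add: h_def)
    have kh: "?k * h \<le> \<delta> / 16"
    proof -
      have "16 * ?k / \<delta> \<le> M" using M unfolding M0_def by linarith
      then show ?thesis using d(1) \<open>M > 0\<close> by (simp add: h_def field_simps)
    qed
    define Z where "Z = {y :: real^'q. (\<forall>a. \<exists>j::int. y $ a = (1 / M) * j) \<and> norm y \<le> 1}"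
    obtain n :: "real^'q \<Rightarrow> 'p \<Rightarrow> nat" where n: "finite Z" "inj_on n Z" "\<And>y a. y \<in> Z \<Longrightarrow> n y a \<le> L"
      using lattice_addresses[OF \<open>M > 0\<close> card, folded Z_def] by blast
    define Y where "Y = {y \<in> Z. norm y < \<delta> / 2}"
    have Y: "finite Y" "\<And>y. y \<in> Y \<Longrightarrow> norm y < \<delta> / 2" "inj_on n Y" "\<And>y a. y \<in> Y \<Longrightarrow> n y a \<le> L"
      using n by (auto simp: Y_def intro: inj_on_subset)
    have ratY: "y $ a \<in> \<rat>" if y: "y \<in> Y" for y a
    proof -
      obtain j :: int where "y $ a = (1 / M) * j" using y by (auto simp: Y_def Z_def)
      then show ?thesis by simp
    qed
    have halfY: "norm y \<le> 1/2" if "y \<in> Y" for y using Y(2)[OF that] d(2) by linarith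
    obtain \<tau>0 where \<tau>0: "0 < \<tau>0" "\<tau>0 \<le> 1/4"
      and sep0: "\<And>y y' x s a. \<lbrakk>y \<in> Y; y' \<in> Y; norm (f x - y) \<le> \<tau>0;
        norm (f (x + s *\<^sub>R axis a 1) - y') \<le> \<tau>0\<rbrakk> \<Longrightarrow> y = y'"
      using separated_tubes[OF f Y(1) halfY ratY] by metis
    \<comment> \<open>The three bounds make the windows of the staircase disjoint, keep \<tau> below
      the separating thickness \<open>\<tau>0\<close>, and keep it small against \<delta>.\<close>
    define \<sigma> where "\<sigma> = min (h / 2) (min (\<tau>0 / ?k) (\<delta> / (64 * ?k)))"
    define \<tau> where "\<tau> = ?k * \<sigma>"
    have \<sigma>: "\<sigma> > 0" "2 * \<sigma> \<le> h" using h \<tau>0 d k1 by (auto simp: \<sigma>_def)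
    have \<tau>: "0 < \<tau>" "\<tau> \<le> \<tau>0" "\<tau> \<le> \<delta> / 64" "\<tau> \<le> 1/4" "\<tau> < \<delta> / 32"
    proof -
      show "0 < \<tau>" using \<sigma> k1 by (simp add: \<tau>_def)
      have "?k * \<sigma> \<le> ?k * (\<tau>0 / ?k)" "?k * \<sigma> \<le> ?k * (\<delta> / (64 * ?k))"
        using k1 by (intro mult_left_mono; simp add: \<sigma>_def)+
      then show le: "\<tau> \<le> \<tau>0" "\<tau> \<le> \<delta> / 64" using k1 by (simp_all add: \<tau>_def)
      then show "\<tau> \<le> 1/4" "\<tau> < \<delta> / 32" using \<tau>0 d by linarith+
    qed
    have sep: "y = y'" if "y \<in> Y" "y' \<in> Y" "norm (f x - y) \<le> \<tau>"
        "norm (f (x + s *\<^sub>R axis a 1) - y') \<le> \<tau>" for y y' x s a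
      using sep0[OF that(1,2), of x s a] that(3,4) \<tau>(2) by linarith
    have "\<exists>\<Psi>. smooth_on UNIV \<Psi> \<and> (\<forall>x. norm (\<Psi> x - x) \<le> 4 * L * ?N + 2) \<and>
      (\<forall>x. \<forall>y\<in>Y. norm (f (\<Psi> x) - y) \<le> \<tau> \<longrightarrow> (\<exists>w V. open V \<and> x \<in> V \<and> norm (x - w) \<le> 1 \<and>
         (\<forall>z\<in>V. f (\<Psi> z) = y + (32 * \<tau> / \<delta>) *\<^sub>R (f (z - w) - y))))"
      by (rule rearrangement[OF f d H Y \<tau>(1) \<tau>(4,5) sep])
    then obtain \<Psi> where \<Psi>: "smooth_on UNIV \<Psi>" "\<And>x. norm (\<Psi> x - x) \<le> 4 * L * ?N + 2"
      and \<Psi>_near: "\<And>x y. y \<in> Y \<Longrightarrow> norm (f (\<Psi> x) - y) \<le> \<tau> \<Longrightarrow>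
       \<exists>w V. open V \<and> x \<in> V \<and> norm (x - w) \<le> 1 \<and>
         (\<forall>z\<in>V. f (\<Psi> z) = y + (32 * \<tau> / \<delta>) *\<^sub>R (f (z - w) - y))"
      by metis
    \<comment> \<open>The range \<open>2 * M\<close> lets the staircase cover all values of
      \<open>f\<close>, whose norm is at most 2, that is \<open>h * (2 * M)\<close>.\<close>
    define P where "P = (lattice_stair h \<sigma> (2 * M) :: real^'q \<Rightarrow> real^'q)"
    have smP: "smooth_on UNIV P" unfolding P_def by (rule smooth_on_lattice_stair)
    have dP: "(P has_derivative (\<lambda>v. \<chi> a. stair' h \<sigma> (2 * M) (y $ a) * v $ a)) (at y)" for y
      unfolding P_def using \<sigma> by (intro lattice_stair_has_derivative) simp
    have P_close: "norm (P y - y) \<le> \<delta> / 16" if "norm y \<le> 2" for y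
    proof -
      have "norm (P y - y) \<le> ?k * h"
        unfolding P_def using that \<sigma> h \<open>M > 0\<close> by (intro lattice_stair_close) (auto simp: h_def)
      then show ?thesis using kh by linarith
    qed
    define d0 where "d0 = 4 * real L * ?N + 2"
    define R where "R = d0 + 3"
    have R: "R > 0" unfolding R_def d0_def by (rule add_nonneg_pos) auto
    define s where "s x = smooth_step ((norm x)\<^sup>2 / R\<^sup>2)" for x :: "real^'p"
    \<comment> \<open>The cut-off \<open>s\<close> switches rearrangement and staircase off between
      radius \<open>R\<close> and \<open>2 * R\<close>. Displacements are at most \<open>d0\<close>,
      so beyond \<open>d0 + 2\<close> the argument of \<open>f\<close> has norm at least 2 and
      \<open>u\<close> lies on the unit sphere. The extra 1 in \<open>R\<close> leaves an open
      neighbourhood for differentiation.\<close>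
    define u where "u x = f (x + (1 - s x) *\<^sub>R (\<Psi> x - x))" for x
    define Q where "Q x = (1 - s x) *\<^sub>R P (u x) + s x *\<^sub>R u x" for x
    define B where "B x = ?\<xi> (Q x)" for x
    have sms: "smooth_on UNIV s"
      unfolding s_def[abs_def] divide_inverse
      by (intro smooth_on_smooth_step_compose smooth_on_mult smooth_on_power2_norm smooth_on_id smooth_on_const open_UNIV)
    have smu: "smooth_on UNIV u"
      unfolding u_def[abs_def]
      by (intro smooth_on_compose_UNIV[OF _ smf] smooth_on_add smooth_on_scaleR smooth_on_diff smooth_on_id
          smooth_on_const sms \<Psi>(1) open_UNIV)
    have smQ: "smooth_on UNIV Q"
      unfolding Q_def[abs_def]
      by (intro smooth_on_add smooth_on_scaleR smooth_on_diff smooth_on_const sms smu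
          smooth_on_compose_UNIV[OF _ smP] open_UNIV)
    have smB: "smooth_on UNIV B"
      unfolding B_def[abs_def] by (rule smooth_on_compose_UNIV[OF open_UNIV smooth_on_sphere_push[OF c] smQ])
    have dB: "(B has_derivative frechet_derivative B (at x)) (at x)" for x
      using smooth_on_has_derivative[OF smB] by blast
    have s01: "0 \<le> s x" "s x \<le> 1" for x using smooth_step_nonneg smooth_step_le_1 by (auto simp: s_def)
    have s0: "s x = 0" if "norm x \<le> R" for x
    proof -
      have "(norm x)\<^sup>2 \<le> R\<^sup>2" using that by (intro power_mono) auto
      then show ?thesis using R by (simp add: s_def smooth_step_eq_0 divide_le_eq_1)
    qed
    have Q_near: "Q x = P (f (\<Psi> x))" if "norm x \<le> R" for x
      by (simp add: Q_def u_def s0[OF that])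
    have u_far: "norm (u x) = 1" if "norm x > d0 + 2" for x
    proof -
      have "norm ((1 - s x) *\<^sub>R (\<Psi> x - x)) \<le> 1 * norm (\<Psi> x - x)"
        unfolding norm_scaleR using s01[of x] by (intro mult_right_mono) auto
      also have "\<dots> \<le> d0" using \<Psi>(2)[of x] by (simp add: d0_def)
      finally have "norm (x + (1 - s x) *\<^sub>R (\<Psi> x - x)) \<ge> norm x - d0"
        using norm_triangle_ineq4[of "x + (1 - s x) *\<^sub>R (\<Psi> x - x)" "(1 - s x) *\<^sub>R (\<Psi> x - x)"] by simp
      then show ?thesis unfolding u_def using that by (intro f1) linarith
    qed
    have B_far: "norm (B x) = 1" if "norm x > d0 + 2" for x
    proof -
      have "norm (Q x - u x) = (1 - s x) * norm (P (u x) - u x)"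
      proof -
        have "Q x - u x = (1 - s x) *\<^sub>R (P (u x) - u x)" by (simp add: Q_def algebra_simps)
        then show ?thesis using s01[of x] by simp
      qed
      also have "\<dots> \<le> 1 * (\<delta> / 16)"
        using s01[of x] u_far[OF that] by (intro mult_mono P_close) auto
      finally have "norm (Q x) \<ge> 1 - \<delta> / 16"
        using u_far[OF that] norm_triangle_ineq3[of "Q x" "u x"] by linarith
      then have "norm (Q x) \<ge> 2 * c" using d by (simp add: c_def)
      then show ?thesis unfolding B_def by (rule sphere_push_far(2)[OF c])
    qed
    have B_sphere: "B x = f x" if "norm x = 2 * R" for x
    proof -
      have "s x = 1" using that R by (simp add: s_def smooth_step_eq_1 power_mult_distrib)
      then have "B x = ?\<xi> (f x)" by (simp add: B_def Q_def u_def)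
      moreover have "norm (f x) = 1" using that by (intro f1) (simp add: R_def d0_def)
      ultimately show ?thesis using sphere_push_far(1)[OF c, of "f x"] d by (simp add: c_def)
    qed
    \<comment> \<open>Of the four cases (the collar and beyond, a coordinate on a flat step, a
      lattice point away from 0, a lattice point near 0), only the last allows a surjective
      derivative.\<close>
    have main: "\<not> surj (frechet_derivative B (at x)) \<or> (\<forall>v. norm (frechet_derivative B (at x) v) \<le> K / M * norm v)" for x
    proof (cases "norm x < R")
      case False
      have "open {x :: real^'p. norm x > d0 + 2}" by (intro open_Collect_less continuous_intros)
      moreover have "x \<in> {x. norm x > d0 + 2}" using False by (simp add: R_def)
      ultimately have "\<not> surj (frechet_derivative B (at x))"
        using B_far by (intro not_surj_of_constant_norm[OF dB]) auto
      then show ?thesis by blast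
    next
      case True
      define W where "W = (\<lambda>x. P (f (\<Psi> x)))"
      define y0 where "y0 = f (\<Psi> x)"
      have smf\<Psi>: "smooth_on UNIV (\<lambda>x. f (\<Psi> x))" by (rule smooth_on_compose_UNIV[OF open_UNIV smf \<Psi>(1)])
      define A where "A = frechet_derivative (\<lambda>x. f (\<Psi> x)) (at x)"
      have dA: "((\<lambda>x. f (\<Psi> x)) has_derivative A) (at x)"
        unfolding A_def using smooth_on_has_derivative[OF smf\<Psi>] by blast
      define DW where "DW v = (\<chi> a. stair' h \<sigma> (2 * M) (y0 $ a) * A v $ a)" for v
      have dW: "(W has_derivative DW) (at x)"
        unfolding W_def DW_def y0_def by (rule has_derivative_compose[OF dA dP])
      have contW: "continuous_on UNIV W"
        unfolding W_def
        using smooth_on_continuous[OF smooth_on_compose_UNIV[OF open_UNIV smP smf\<Psi>]] .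
      have d\<xi>: "(?\<xi> has_derivative frechet_derivative ?\<xi> (at y)) (at y)" for y
        using smooth_on_has_derivative[OF smooth_on_sphere_push[OF c]] by blast
      have BW: "B z = ?\<xi> (W z)" if "norm z < R" for z
        using that Q_near[of z] by (simp add: B_def W_def)
      have xR: "x \<in> ball 0 R" using True by simp
      have "(B has_derivative (\<lambda>v. frechet_derivative ?\<xi> (at (W x)) (DW v))) (at x)"
        by (rule has_derivative_transform_within_open[OF has_derivative_compose[OF dW d\<xi>] open_ball xR])
          (simp add: BW)
      then have DB: "frechet_derivative B (at x) = (\<lambda>v. frechet_derivative ?\<xi> (at (W x)) (DW v))"
        using frechet_derivative_at by metis
      show ?thesis
      proof (cases "\<exists>a. stair' h \<sigma> (2 * M) (y0 $ a) = 0")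
        case True
        then obtain a where a: "stair' h \<sigma> (2 * M) (y0 $ a) = 0" by blast
        have "\<not> surj DW"
        proof
          assume "surj DW"
          then obtain v where "DW v = axis a 1" by (metis surjD)
          moreover have "DW v $ a = 0" using a by (simp add: DW_def)
          ultimately show False by simp
        qed
        then have "\<not> surj (\<lambda>v. frechet_derivative ?\<xi> (at (W x)) (DW v))"
          by (rule not_surj_compose[OF has_derivative_linear[OF d\<xi>]])
        then show ?thesis unfolding DB by blast
      next
        case False
        have "\<exists>j::int. \<bar>y0 $ a - h * j\<bar> < \<sigma>" for a
        proof (rule ccontr)
          assume "\<nexists>j::int. \<bar>y0 $ a - h * j\<bar> < \<sigma>"
          then have "stair' h \<sigma> (2 * M) (y0 $ a) = 0"
            by (intro stair'_eq_0 \<sigma>) (auto simp: not_less)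
          then show False using False by blast
        qed
        then obtain j :: "'q \<Rightarrow> int" where j: "\<And>a. \<bar>y0 $ a - h * j a\<bar> < \<sigma>" by metis
        define y where "y = (\<chi> a. h * j a)"
        have y_near: "norm (y0 - y) \<le> \<tau>"
        proof -
          have "norm (y0 - y) \<le> (\<Sum>a\<in>UNIV. \<bar>(y0 - y) $ a\<bar>)" by (rule norm_le_l1_cart)
          also have "\<dots> \<le> (\<Sum>a\<in>(UNIV :: 'q set). \<sigma>)"
            by (rule sum_mono) (use j in \<open>auto simp: y_def intro: less_imp_le\<close>)
          finally show ?thesis by (simp add: \<tau>_def)
        qed
        have y0_le: "norm y0 \<le> 2" unfolding y0_def by (rule f2)
        have Wx: "W x = P y0" by (simp add: W_def y0_def)
        show ?thesis
        proof (cases "norm y < \<delta> / 2")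
          case False
          \<comment> \<open>The threshold \<open>\<delta> / 8\<close> is \<open>2 * c\<close>, from
            which on \<open>sphere_push\<close> lands on the unit sphere.\<close>
          have "norm (W x) \<ge> norm y - norm (y0 - y) - norm (P y0 - y0)"
            using norm_triangle_ineq2[of y0 "y0 - P y0"] norm_triangle_ineq2[of y "y - y0"]
            by (simp add: Wx norm_minus_commute)
          also have "norm y - norm (y0 - y) - norm (P y0 - y0) \<ge> \<delta> / 2 - \<delta> / 64 - \<delta> / 16"
            using False y_near \<tau>(3) P_close[OF y0_le] by linarith
          finally have "norm (W x) > \<delta> / 8" using d(1) by linarith
          then have "x \<in> ball 0 R \<inter> {z. norm (W z) > \<delta> / 8}" using xR by simp
          moreover have "open (ball 0 R \<inter> {z. norm (W z) > \<delta> / 8})"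
            using contW by (intro open_Int open_ball open_Collect_less continuous_intros)
          ultimately have "\<not> surj (frechet_derivative B (at x))"
            by (intro not_surj_of_constant_norm[OF dB]) (auto simp: BW c_def intro!: sphere_push_far(2) d(1))
          then show ?thesis by blast
        next
          case True
          have "y \<in> Z"
            using True d(2) by (auto simp: Z_def y_def h_def)
          then have "y \<in> Y" using True by (simp add: Y_def)
          from \<Psi>_near[OF this] y_near obtain w V where V: "open V" "x \<in> V" "norm (x - w) \<le> 1"
            "\<And>z. z \<in> V \<Longrightarrow> f (\<Psi> z) = y + (32 * \<tau> / \<delta>) *\<^sub>R (f (z - w) - y)"
            unfolding y0_def by metis
          define F where "F = frechet_derivative f (at (x - w))"
          have dF: "(f has_derivative F) (at (x - w))"
            unfolding F_def using smooth_on_has_derivative[OF smf] by blast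
          have "((\<lambda>z. z - w) has_derivative (\<lambda>v. v)) (at x)" by (auto intro!: derivative_eq_intros)
          from has_derivative_compose[OF this dF]
          have "((\<lambda>z. y + (32 * \<tau> / \<delta>) *\<^sub>R (f (z - w) - y)) has_derivative (\<lambda>v. (32 * \<tau> / \<delta>) *\<^sub>R F v)) (at x)"
            by (auto intro!: derivative_eq_intros)
          then have "((\<lambda>x. f (\<Psi> x)) has_derivative (\<lambda>v. (32 * \<tau> / \<delta>) *\<^sub>R F v)) (at x)"
            by (rule has_derivative_transform_within_open[OF _ V(1,2)]) (simp add: V(4))
          then have A: "A = (\<lambda>v. (32 * \<tau> / \<delta>) *\<^sub>R F v)" using dA has_derivative_unique by blast
          have "norm (frechet_derivative B (at x) v) \<le> K / M * norm v" for v
          proof -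
            have "norm (W x) \<le> 3"
              using P_close[OF y0_le] y0_le d(2) norm_triangle_ineq[of "P y0 - y0" y0] by (simp add: Wx)
            then have "norm (frechet_derivative B (at x) v) \<le> C\<xi> * norm (DW v)"
              unfolding DB by (intro C\<xi>(2)) simp
            also have "\<dots> \<le> C\<xi> * (C * h / \<sigma> * norm (A v))"
              unfolding DW_def
              using C\<xi>(1) staircase_derivative_le[OF C(2) h \<sigma>, of "2 * M" y0 "A v"] by (intro mult_left_mono) auto
            also have "norm (A v) = 32 * \<tau> / \<delta> * norm (F v)"
              using \<tau>(1) d(1) by (simp add: A)
            also have "C\<xi> * (C * h / \<sigma> * (32 * \<tau> / \<delta> * norm (F v))) \<le> C\<xi> * (C * h / \<sigma> * (32 * \<tau> / \<delta> * (\<Lambda> * norm v)))"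
              unfolding F_def using C\<xi>(1) C(1) h \<sigma>(1) \<tau>(1) d(1) V(3) by (intro mult_left_mono \<Lambda>(2)) auto
            also have "\<dots> = K1 * h * norm v"
              using \<sigma>(1) d(1) by (simp add: K1_def \<tau>_def)
            also have "\<dots> \<le> K * h * norm v"
              using K(2) h by (intro mult_right_mono) auto
            finally show ?thesis by (simp add: h_def)
          qed
          then show ?thesis by blast
        qed
      qed
    qed
    have RK: "2 * R \<le> K * L"
    proof -
      have "2 * R = 8 * ?N * real L + 10 * 1" by (simp add: R_def d0_def)
      also have "\<dots> \<le> 8 * ?N * real L + 10 * real L" using L by (intro add_left_mono mult_left_mono) auto
      also have "\<dots> = (8 * ?N + 10) * real L" by (simp add: algebra_simps)
      also have "\<dots> \<le> K * L" using K(3) by (intro mult_right_mono) auto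
      finally show ?thesis .
    qed
    have R2: "2 \<le> 2 * R" by (simp add: R_def d0_def)
    have "norm (B x) \<le> 1" for x unfolding B_def by (rule norm_sphere_push_le)
    then show "\<exists>B r. smooth_on UNIV B \<and> 2 \<le> r \<and> r \<le> K * real L \<and> (\<forall>x. norm (B x) \<le> 1) \<and> (\<forall>x. norm x = r \<longrightarrow> B x = f x) \<and>
        (\<forall>x. \<exists>D. (B has_derivative D) (at x) \<and> (\<not> surj D \<or> (\<forall>v. norm (D v) \<le> K / real M * norm v)))"
      using smB R2 RK B_sphere dB main by blast
  qed
qed

text \<open>With \<open>L = t ^ k\<close> and \<open>2 * M + 1 = t ^ (k + 1)\<close> the counting
  inequality reduces to \<open>k + 1 \<le> N\<close>, while \<open>L / M\<close> is at most
  \<open>4 / t\<close>. The base \<open>t\<close> is odd so that its power has the form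
  \<open>2 * M + 1\<close>.\<close>

lemma grid_sizes:
  fixes k N M0 :: nat and K \<eta> :: real
  assumes "0 < k" "k < N" "K > 0" "\<eta> > 0"
  obtains M L :: nat where "M0 \<le> M" "0 < L" "0 < M" "(2 * M + 1) ^ k \<le> L ^ N" "K * real L / real M \<le> \<eta>"
proof -
  obtain i :: nat where i: "real i > 4 * K / \<eta> + 4 * real M0" using reals_Archimedean2 by blast
  define t where "t = 2 * i + 3"
  define L where "L = t ^ k"
  define M where "M = (t ^ (k + 1) - 1) div 2"
  have "odd (t ^ (k + 1))" by (simp add: t_def)
  then have M2: "2 * M + 1 = t ^ (k + 1)" unfolding M_def by presburger
  have "t \<ge> 3" by (simp add: t_def)
  then have L: "L \<ge> 1" by (simp add: L_def)
  have "t * L \<ge> 3 * 1" using \<open>t \<ge> 3\<close> L by (intro mult_mono) auto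
  moreover have tL: "2 * M + 1 = t * L" using M2 by (simp add: L_def)
  ultimately have "4 * M \<ge> t * L" by linarith
  then have M4: "4 * real M \<ge> real t * real L" by (metis of_nat_le_iff of_nat_mult of_nat_numeral)
  have t_gt: "real t > 4 * K / \<eta> + 4 * real M0" using i by (simp add: t_def)
  have "real t * 1 \<le> real t * real L" using L by (intro mult_left_mono) auto
  moreover have "4 * K / \<eta> > 0" using assms by simp
  ultimately have M0: "real M0 < real M" using M4 t_gt by linarith
  show thesis
  proof (rule that[of M L])
    show "M0 \<le> M" "0 < M" using M0 by linarith+
    show "0 < L" using L by simp
    have "(2 * M + 1) ^ k = t ^ ((k + 1) * k)" unfolding M2 by (simp only: power_mult)
    also have "\<dots> \<le> t ^ (N * k)"
      using \<open>t \<ge> 3\<close> \<open>k < N\<close> by (intro power_increasing mult_right_mono) auto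
    also have "\<dots> = L ^ N" by (simp add: L_def power_mult[symmetric] mult.commute)
    finally show "(2 * M + 1) ^ k \<le> L ^ N" .
    have "4 * K / \<eta> \<le> real t" using t_gt by simp
    then have "4 * K \<le> \<eta> * real t" using assms by (simp add: field_simps)
    then have "4 * K * real L \<le> \<eta> * real t * real L" by (rule mult_right_mono) simp
    also have "\<dots> \<le> \<eta> * (4 * real M)" using M4 assms by (simp add: mult.assoc)
    finally show "K * real L / real M \<le> \<eta>" using \<open>0 < M\<close> by (simp add: field_simps)
  qed
qed

theorem theorem1p3:
  fixes m n :: nat
    and G :: "real ^ 'p \<Rightarrow> real ^ 'q"
    and \<epsilon> :: real
  assumes "CARD('p) = m + 1" and "CARD('q) = n + 1"
    and "m > 0" and "n > 0"
    and "m > n" and "real n > real m / 2"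
    and "smooth_map_on (sphere 0 1) G" and "G ` sphere 0 1 \<subseteq> sphere 0 1"
    and "\<epsilon> > 0"
  shows "\<exists>F :: real ^ 'p \<Rightarrow> real ^ 'q.
           smooth_map_on (cball 0 1) F \<and> F ` cball 0 1 \<subseteq> cball 0 1 \<and>
           (\<forall>x\<in>sphere 0 1. F x = G x) \<and>
           dil (n + 1) (cball 0 1) F < ennreal \<epsilon>"
proof -
  define g where "g x = G (inverse (norm x) *\<^sub>R x)" for x
  have smg: "smooth_on (- {0}) g" unfolding g_def by (rule smooth_on_radial[OF assms(7)])
  have g1: "norm (g x) = 1" if "x \<noteq> 0" for x
  proof -
    have "inverse (norm x) *\<^sub>R x \<in> sphere 0 1" using that by simp
    then have "g x \<in> sphere 0 1" unfolding g_def using assms(8) by blast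
    then show ?thesis by simp
  qed
  have "CARD('p) + 1 < 2 * CARD('q)" using assms(1,2,6) by linarith
  then obtain f where f: "generic_map f" "\<And>x. norm x \<ge> 2 \<Longrightarrow> f x = g x"
    using generic_extension[OF smg g1] by metis
  have f1: "norm (f x) = 1" if "norm x \<ge> 2" for x
    using f(2)[OF that] g1[of x] that by (cases "x = 0") auto
  obtain K M0 where K: "K > 0"
    "\<And>M L. \<lbrakk>M \<ge> M0; L > 0; (2 * M + 1) ^ CARD('q) \<le> L ^ CARD('p)\<rbrakk> \<Longrightarrow>
      \<exists>B r. smooth_on UNIV B \<and> 2 \<le> r \<and> r \<le> K * real L \<and> (\<forall>x. norm (B x) \<le> 1) \<and> (\<forall>x. norm x = r \<longrightarrow> B x = f x) \<and>
        (\<forall>x. \<exists>D. (B has_derivative D) (at x) \<and> (\<not> surj D \<or> (\<forall>v. norm (D v) \<le> K / real M * norm v)))"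
    using low_rank_map[OF f(1) f1] by metis
  \<comment> \<open>Being at most 1, \<eta> dominates its own power \<open>n + 1\<close>, and it is
    below \<epsilon>.\<close>
  define \<eta> where "\<eta> = min 1 (\<epsilon> / 2)"
  have \<eta>: "0 < \<eta>" "\<eta> \<le> 1" "\<eta> < \<epsilon>" using assms(9) by (auto simp: \<eta>_def min_less_iff_disj)
  have "CARD('q) < CARD('p)" using assms(1,2,5) by simp
  \<comment> \<open>Rescaling the ball of radius \<open>r \<le> K * L\<close> to unit size
    multiplies the bound \<open>K / M\<close> by at most \<open>K * L\<close>, whence the
    square.\<close>
  moreover have "K\<^sup>2 > 0" using K(1) by simp
  ultimately obtain M L where sizes: "M0 \<le> M" "0 < L" "0 < M" "(2 * M + 1) ^ CARD('q) \<le> L ^ CARD('p)"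
    "K\<^sup>2 * real L / real M \<le> \<eta>"
    using grid_sizes[OF zero_less_card_finite _ _ \<eta>(1)] by metis
  obtain B r where B: "smooth_on UNIV B" "2 \<le> r" "r \<le> K * real L" "\<And>x. norm (B x) \<le> 1"
    "\<And>x. norm x = r \<Longrightarrow> B x = f x"
    "\<And>x. \<exists>D. (B has_derivative D) (at x) \<and> (\<not> surj D \<or> (\<forall>v. norm (D v) \<le> K / real M * norm v))"
    using K(2)[OF sizes(1,2,4)] by metis
  define F where "F x = B (r *\<^sub>R x)" for x
  have "smooth_on UNIV F"
    unfolding F_def
    by (intro smooth_on_compose_UNIV[OF _ B(1)] smooth_on_scaleR smooth_on_const smooth_on_id open_UNIV)
  then have "smooth_map_on (cball 0 1) F"
    unfolding smooth_map_on_def smooth_on_def by blast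
  moreover have "F ` cball 0 1 \<subseteq> cball 0 1" using B(4) by (auto simp: F_def)
  moreover have "F x = G x" if "x \<in> sphere 0 1" for x
  proof -
    have r: "norm (r *\<^sub>R x) = r" using that B(2) by simp
    have "F x = g (r *\<^sub>R x)" unfolding F_def using B(5)[OF r] f(2) r B(2) by metis
    also have "\<dots> = G x" using that B(2) by (simp add: g_def)
    finally show ?thesis .
  qed
  moreover have dil_le: "dil DIM(real^'q) (cball 0 1) F \<le> ennreal (\<eta> ^ DIM(real^'q))"
  proof (rule dil_cball_le)
    fix x :: "real^'p"
    obtain D where D: "(B has_derivative D) (at (r *\<^sub>R x))" "\<not> surj D \<or> (\<forall>v. norm (D v) \<le> K / real M * norm v)"
      using B(6) by metis
    have "((*\<^sub>R) r has_derivative (*\<^sub>R) r) (at x)" by (auto intro!: derivative_eq_intros)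
    from has_derivative_compose[OF this D(1)] have "(F has_derivative (\<lambda>v. D (r *\<^sub>R v))) (at x)"
      by (simp add: F_def[abs_def])
    moreover have "\<not> surj (\<lambda>v. D (r *\<^sub>R v))" if "\<not> surj D"
      using that unfolding surj_def by metis
    moreover have "norm (D (r *\<^sub>R v)) \<le> \<eta> * norm v" if "\<forall>v. norm (D v) \<le> K / real M * norm v" for v
    proof -
      have "norm (D (r *\<^sub>R v)) \<le> K / M * norm (r *\<^sub>R v)" using that by blast
      also have "\<dots> = K / M * r * norm v" using B(2) by simp
      also have "\<dots> \<le> K / M * (K * real L) * norm v"
        using K(1) B(3) by (intro mult_right_mono mult_left_mono) auto
      also have "\<dots> = K\<^sup>2 * real L / M * norm v" by (simp add: power2_eq_square)
      also have "\<dots> \<le> \<eta> * norm v" using sizes(5) by (intro mult_right_mono) auto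
      finally show ?thesis .
    qed
    ultimately show "\<exists>D. (F has_derivative D) (at x) \<and> (\<not> surj D \<or> (\<forall>v. norm (D v) \<le> \<eta> * norm v))"
      using D(2) by blast
  qed (use \<eta> in simp)
  then have "dil (n + 1) (cball 0 1) F < ennreal \<epsilon>"
  proof -
    have dim: "DIM(real^'q) = n + 1" using assms(2) by simp
    have "\<eta> ^ (n + 1) \<le> \<eta> ^ 1" using \<eta> by (intro power_decreasing) auto
    then have "\<eta> ^ (n + 1) < \<epsilon>" using \<eta>(3) by (simp only: power_one_right)
    then have "ennreal (\<eta> ^ (n + 1)) < ennreal \<epsilon>" using assms(9) by (intro ennreal_lessI)
    then show ?thesis using dil_le unfolding dim by (rule le_less_trans[rotated])
  qed
  ultimately show ?thesis by blast
qed

end
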